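(* Let $n\ge0$ and let ${}^n\pi$ be a finite type factor-representation of the subgroup $B_\infty^{(n)}=B_n\cdot B_{n\infty}$ of $B=\mathbb{Z}_2\wr\mathfrak{S}_\infty$. Then ${\rm Ind}^{B}_{B_\infty^{(n)}}\,{}^n\pi$ is a stable factor-representation of $B$.
   Context: The group $B$. $\mathfrak{S}_\infty$ is the group of finitely supported permutations of $\mathbb{N}=\{1,2,\dots\}$; ${}_0\mathbb{Z}_2^\infty$ is the group of finitely supported sequences $z=(z_1,z_2,\dots)$ with $z_i\in\mathbb{Z}_2=\{0,1\}$. $B={}_0\mathbb{Z}_2^\infty\rtimes\mathfrak{S}_\infty$ with $(z,s)(z',s')=(z+sz',ss')$, $(sz)_i=z_{s^{-1}(i)}$; both factors are regarded as subgroups of $B$. For $b=sz$ put ${\rm supp}\,b=\{k: s(k)\ne k \text{ or } z_k\neq 0\}$. $B_n=\{b:{\rm supp}\,b\subset\{1,\dots,n\}\}$, $B_{n\infty}=\{b:{\rm supp}\,b\subset\{n+1,n+2,\dots\}\}$. Stability. For a countable group $G$, give ${\rm Aut}\,G$ the topology whose neighbourhoods of the identity are generated (by finite intersections) by the sets $\mathfrak{U}_g=\{\theta:\theta(g)=g\}$, $g\in G$; ${\rm Ad}\,G$ is the subgroup of inner automorphisms with the induced topology. A unitary representation $\pi$ of $G$ on $\mathcal{H}$ is stable if for every $\eta\in\mathcal{H}$ the functional $\omega_\eta(a)=(\pi(a)\eta,\eta)$ on $C^*[G]$ is such that ${\rm Ad}\,G\ni\theta\mapsto\omega_\eta\circ\theta\in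 C^*[G]^*$ is continuous for the norm topology of the dual. It is a factor-representation (of finite type) if $\pi(G)''$ is a factor (of finite type). ${\rm Ind}$ denotes unitary induction of representations of discrete groups. *)

theory Defs
  imports
    "HOL-Analysis.Analysis"
    "HOL-Algebra.Coset"
    "HOL-Algebra.Bij"
    "HOL-Combinatorics.Permutations"
    "HOL-Library.Z2"
    "HOL-Library.Function_Algebras"
begin

section \<open>Complex Hilbert spaces and their operators\<close>

text \<open>A Hilbert space is a linear subspace \<open>carrier H\<close> of an ambient complex vector space, given by
  a type \<open>'v\<close> and a scalar multiplication, together with an inner product, linear in its first
  argument. The carrier is explicit because the space of an induced representation depends on the
  representation that is induced.\<close>

record 'v hspace = "'v partial_object" +
  scal :: "complex \<Rightarrow> 'v \<Rightarrow> 'v"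
  iprod :: "'v \<Rightarrow> 'v \<Rightarrow> complex"

definition hnorm :: "'v hspace \<Rightarrow> 'v \<Rightarrow> real" where
  "hnorm H x = sqrt (Re (iprod H x x))"

definition hilbert_space :: "'v::ab_group_add hspace \<Rightarrow> bool" where
  "hilbert_space H \<longleftrightarrow>
     vector_space (scal H) \<and> module.subspace (scal H) (carrier H) \<and>
     (\<forall>x\<in>carrier H. \<forall>y\<in>carrier H. \<forall>z\<in>carrier H.
        iprod H (x + y) z = iprod H x z + iprod H y z) \<and>
     (\<forall>c. \<forall>x\<in>carrier H. \<forall>y\<in>carrier H. iprod H (scal H c x) y = c * iprod H x y) \<and>
     (\<forall>x\<in>carrier H. \<forall>y\<in>carrier H. iprod H y x = cnj (iprod H x y)) \<and>
     (\<forall>x\<in>carrier H. iprod H x x \<in> \<real>\<^sub>\<ge>\<^sub>0 \<and> (iprod H x x = 0 \<longrightarrow> x = 0)) \<and>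
     (\<forall>u. (\<forall>k::nat. u k \<in> carrier H) \<and>
          (\<forall>e>0. \<exists>N. \<forall>j\<ge>N. \<forall>k\<ge>N. hnorm H (u j - u k) < e) \<longrightarrow>
          (\<exists>x\<in>carrier H. (\<lambda>k. hnorm H (u k - x)) \<longlonglongrightarrow> 0))"

text \<open>Operators are extensional functions, so that equality of operators is equality on the
  carrier.\<close>

definition bounded_ops :: "'v::ab_group_add hspace \<Rightarrow> ('v \<Rightarrow> 'v) set" where
  "bounded_ops H = {T \<in> carrier H \<rightarrow>\<^sub>E carrier H.
     (\<forall>x\<in>carrier H. \<forall>y\<in>carrier H. T (x + y) = T x + T y) \<and>
     (\<forall>c. \<forall>x\<in>carrier H. T (scal H c x) = scal H c (T x)) \<and>
     (\<exists>K. \<forall>x\<in>carrier H. hnorm H (T x) \<le> K * hnorm H x)}"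

definition scalar_op :: "'v::ab_group_add hspace \<Rightarrow> complex \<Rightarrow> 'v \<Rightarrow> 'v" where
  "scalar_op H c = (\<lambda>x\<in>carrier H. scal H c x)"

definition op_plus :: "'v::ab_group_add hspace \<Rightarrow> ('v \<Rightarrow> 'v) \<Rightarrow> ('v \<Rightarrow> 'v) \<Rightarrow> 'v \<Rightarrow> 'v" where
  "op_plus H S T = (\<lambda>x\<in>carrier H. S x + T x)"

definition op_minus :: "'v::ab_group_add hspace \<Rightarrow> ('v \<Rightarrow> 'v) \<Rightarrow> ('v \<Rightarrow> 'v) \<Rightarrow> 'v \<Rightarrow> 'v" where
  "op_minus H S T = (\<lambda>x\<in>carrier H. S x - T x)"

definition adjoint_pair :: "'v::ab_group_add hspace \<Rightarrow> ('v \<Rightarrow> 'v) \<Rightarrow> ('v \<Rightarrow> 'v) \<Rightarrow> bool" where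
  "adjoint_pair H T S \<longleftrightarrow>
     (\<forall>x\<in>carrier H. \<forall>y\<in>carrier H. iprod H (T x) y = iprod H x (S y))"

definition positive_op :: "'v::ab_group_add hspace \<Rightarrow> ('v \<Rightarrow> 'v) \<Rightarrow> bool" where
  "positive_op H T \<longleftrightarrow> T \<in> bounded_ops H \<and> (\<forall>x\<in>carrier H. iprod H (T x) x \<in> \<real>\<^sub>\<ge>\<^sub>0)"

definition op_le :: "'v::ab_group_add hspace \<Rightarrow> ('v \<Rightarrow> 'v) \<Rightarrow> ('v \<Rightarrow> 'v) \<Rightarrow> bool" where
  "op_le H S T \<longleftrightarrow> positive_op H (op_minus H T S)"


section \<open>Von Neumann algebras\<close>

definition commutant :: "'v::ab_group_add hspace \<Rightarrow> ('v \<Rightarrow> 'v) set \<Rightarrow> ('v \<Rightarrow> 'v) set" where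
  "commutant H M = {T \<in> bounded_ops H. \<forall>S\<in>M. compose (carrier H) T S = compose (carrier H) S T}"

definition von_neumann_algebra :: "'v::ab_group_add hspace \<Rightarrow> ('v \<Rightarrow> 'v) set \<Rightarrow> bool" where
  "von_neumann_algebra H M \<longleftrightarrow>
     M \<subseteq> bounded_ops H \<and> (\<forall>T\<in>M. \<exists>S\<in>M. adjoint_pair H T S) \<and>
     commutant H (commutant H M) = M"

definition factor :: "'v::ab_group_add hspace \<Rightarrow> ('v \<Rightarrow> 'v) set \<Rightarrow> bool" where
  "factor H M \<longleftrightarrow>
     carrier H \<noteq> {0} \<and> von_neumann_algebra H M \<and> M \<inter> commutant H M = range (scalar_op H)"

definition pos_part :: "'v::ab_group_add hspace \<Rightarrow> ('v \<Rightarrow> 'v) set \<Rightarrow> ('v \<Rightarrow> 'v) set" where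
  "pos_part H M = {T \<in> M. positive_op H T}"

definition finite_trace ::
    "'v::ab_group_add hspace \<Rightarrow> ('v \<Rightarrow> 'v) set \<Rightarrow> (('v \<Rightarrow> 'v) \<Rightarrow> real) \<Rightarrow> bool" where
  "finite_trace H M \<phi> \<longleftrightarrow>
     (\<forall>T\<in>pos_part H M. 0 \<le> \<phi> T) \<and>
     (\<forall>S\<in>pos_part H M. \<forall>T\<in>pos_part H M. \<phi> (op_plus H S T) = \<phi> S + \<phi> T) \<and>
     (\<forall>c\<ge>0. \<forall>T\<in>pos_part H M.
        \<phi> (compose (carrier H) (scalar_op H (complex_of_real c)) T) = c * \<phi> T) \<and>
     (\<forall>T\<in>M. \<forall>S\<in>M. adjoint_pair H T S \<longrightarrow>
        \<phi> (compose (carrier H) S T) = \<phi> (compose (carrier H) T S))"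

text \<open>Normality: \<open>\<phi>\<close> respects suprema of upward directed families in the positive part.\<close>

definition normal_trace ::
    "'v::ab_group_add hspace \<Rightarrow> ('v \<Rightarrow> 'v) set \<Rightarrow> (('v \<Rightarrow> 'v) \<Rightarrow> real) \<Rightarrow> bool" where
  "normal_trace H M \<phi> \<longleftrightarrow>
     (\<forall>F S. F \<subseteq> pos_part H M \<and> F \<noteq> {} \<and>
        (\<forall>T1\<in>F. \<forall>T2\<in>F. \<exists>T\<in>F. op_le H T1 T \<and> op_le H T2 T) \<and>
        S \<in> pos_part H M \<and> (\<forall>T\<in>F. op_le H T S) \<and>
        (\<forall>R\<in>pos_part H M. (\<forall>T\<in>F. op_le H T R) \<longrightarrow> op_le H S R) \<longrightarrow>
        \<phi> S = (SUP T\<in>F. \<phi> T))"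

text \<open>Finiteness in the sense of Dixmier: the finite normal traces separate the positive part
  from \<open>0\<close>.\<close>

definition finite_vna :: "'v::ab_group_add hspace \<Rightarrow> ('v \<Rightarrow> 'v) set \<Rightarrow> bool" where
  "finite_vna H M \<longleftrightarrow> von_neumann_algebra H M \<and>
     (\<forall>T\<in>pos_part H M. T \<noteq> scalar_op H 0 \<longrightarrow>
        (\<exists>\<phi>. finite_trace H M \<phi> \<and> normal_trace H M \<phi> \<and> \<phi> T \<noteq> 0))"


section \<open>Unitary representations of discrete groups\<close>

definition unitary_group :: "'v::ab_group_add hspace \<Rightarrow> ('v \<Rightarrow> 'v) monoid" where
  "unitary_group H = BijGroup (carrier H)
     \<lparr>carrier := {U \<in> Bij (carrier H) \<inter> bounded_ops H.
        \<forall>x\<in>carrier H. \<forall>y\<in>carrier H. iprod H (U x) (U y) = iprod H x y}\<rparr>"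

definition unitary_rep :: "'g monoid \<Rightarrow> 'v::ab_group_add hspace \<Rightarrow> ('g \<Rightarrow> 'v \<Rightarrow> 'v) \<Rightarrow> bool" where
  "unitary_rep G H \<pi> \<longleftrightarrow> group G \<and> hilbert_space H \<and> \<pi> \<in> hom G (unitary_group H)"

definition rep_vna :: "'g monoid \<Rightarrow> 'v::ab_group_add hspace \<Rightarrow> ('g \<Rightarrow> 'v \<Rightarrow> 'v) \<Rightarrow> ('v \<Rightarrow> 'v) set" where
  "rep_vna G H \<pi> = commutant H (commutant H (\<pi> ` carrier G))"

definition factor_rep :: "'g monoid \<Rightarrow> 'v::ab_group_add hspace \<Rightarrow> ('g \<Rightarrow> 'v \<Rightarrow> 'v) \<Rightarrow> bool" where
  "factor_rep G H \<pi> \<longleftrightarrow> unitary_rep G H \<pi> \<and> factor H (rep_vna G H \<pi>)"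

definition finite_type_factor_rep ::
    "'g monoid \<Rightarrow> 'v::ab_group_add hspace \<Rightarrow> ('g \<Rightarrow> 'v \<Rightarrow> 'v) \<Rightarrow> bool" where
  "finite_type_factor_rep G H \<pi> \<longleftrightarrow> factor_rep G H \<pi> \<and> finite_vna H (rep_vna G H \<pi>)"

text \<open>The induced representation acts by right translations on the functions \<open>f\<close> on \<open>G\<close> with
  \<open>f (k x) = \<pi> k (f x)\<close> for \<open>k \<in> K\<close> that are square summable over \<open>K \<setminus> G\<close>. By this equivariance
  and unitarity of \<open>\<pi>\<close>, the terms of the sums below do not depend on the representatives chosen.
  Functions are extended by \<open>0\<close> outside \<open>carrier G\<close>.\<close>

definition ind_space ::
    "'g monoid \<Rightarrow> 'g set \<Rightarrow> 'v::ab_group_add hspace \<Rightarrow> ('g \<Rightarrow> 'v \<Rightarrow> 'v) \<Rightarrow> ('g \<Rightarrow> 'v) hspace" where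
  "ind_space G K H \<pi> =
     \<lparr>carrier = {f. (\<forall>x\<in>carrier G. f x \<in> carrier H) \<and> (\<forall>x. x \<notin> carrier G \<longrightarrow> f x = 0) \<and>
         (\<forall>k\<in>K. \<forall>x\<in>carrier G. f (k \<otimes>\<^bsub>G\<^esub> x) = \<pi> k (f x)) \<and>
         (\<lambda>C. (hnorm H (f (SOME x. x \<in> C)))\<^sup>2) summable_on (rcosets\<^bsub>G\<^esub> K)},
      scal = (\<lambda>c f x. scal H c (f x)),
      iprod = (\<lambda>f1 f2. \<Sum>\<^sub>\<infinity>C\<in>rcosets\<^bsub>G\<^esub> K.
         iprod H (f1 (SOME x. x \<in> C)) (f2 (SOME x. x \<in> C)))\<rparr>"

definition ind_rep ::
    "'g monoid \<Rightarrow> 'g set \<Rightarrow> 'v::ab_group_add hspace \<Rightarrow> ('g \<Rightarrow> 'v \<Rightarrow> 'v) \<Rightarrow>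
       'g \<Rightarrow> ('g \<Rightarrow> 'v) \<Rightarrow> ('g \<Rightarrow> 'v)" where
  "ind_rep G K H \<pi> g =
     (\<lambda>f\<in>carrier (ind_space G K H \<pi>). \<lambda>x. if x \<in> carrier G then f (x \<otimes>\<^bsub>G\<^esub> g) else 0)"


section \<open>The group C*-algebra and its dual\<close>

definition group_alg :: "'g monoid \<Rightarrow> ('g \<Rightarrow> complex) set" where
  "group_alg G = {a. finite {g. a g \<noteq> 0} \<and> {g. a g \<noteq> 0} \<subseteq> carrier G}"

definition ga_mult :: "'g monoid \<Rightarrow> ('g \<Rightarrow> complex) \<Rightarrow> ('g \<Rightarrow> complex) \<Rightarrow> 'g \<Rightarrow> complex" where
  "ga_mult G a b = (\<lambda>g. if g \<in> carrier G
     then \<Sum>h | a h \<noteq> 0. a h * b (inv\<^bsub>G\<^esub> h \<otimes>\<^bsub>G\<^esub> g) else 0)"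

definition ga_star :: "'g monoid \<Rightarrow> ('g \<Rightarrow> complex) \<Rightarrow> 'g \<Rightarrow> complex" where
  "ga_star G a = (\<lambda>g. if g \<in> carrier G then cnj (a (inv\<^bsub>G\<^esub> g)) else 0)"

definition cstar_seminorm :: "'g monoid \<Rightarrow> (('g \<Rightarrow> complex) \<Rightarrow> real) \<Rightarrow> bool" where
  "cstar_seminorm G p \<longleftrightarrow>
     (\<forall>a\<in>group_alg G. 0 \<le> p a) \<and>
     (\<forall>a\<in>group_alg G. \<forall>b\<in>group_alg G. p (a + b) \<le> p a + p b) \<and>
     (\<forall>c. \<forall>a\<in>group_alg G. p (\<lambda>g. c * a g) = cmod c * p a) \<and>
     (\<forall>a\<in>group_alg G. \<forall>b\<in>group_alg G. p (ga_mult G a b) \<le> p a * p b) \<and>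
     (\<forall>a\<in>group_alg G. p (ga_mult G (ga_star G a) a) = (p a)\<^sup>2)"

text \<open>The norm of the enveloping C*-algebra \<open>C*[G]\<close> is the greatest C*-seminorm on the group
  algebra. The supremum is finite: a C*-seminorm takes only the values \<open>0\<close> and \<open>1\<close> at the identity,
  hence is at most \<open>1\<close> at every group element, hence at most the 1-norm.\<close>

definition cstar_norm :: "'g monoid \<Rightarrow> ('g \<Rightarrow> complex) \<Rightarrow> real" where
  "cstar_norm G a = (SUP p\<in>Collect (cstar_seminorm G). p a)"

text \<open>\<open>C*[G]\<close> is the completion of the group algebra, and a bounded functional on it is the same,
  with the same norm, as a bounded functional on the group algebra. The latter is represented by its
  values on group elements.\<close>

definition functional_at :: "('g \<Rightarrow> complex) \<Rightarrow> ('g \<Rightarrow> complex) \<Rightarrow> complex" where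
  "functional_at \<omega> a = (\<Sum>g | a g \<noteq> 0. a g * \<omega> g)"

definition cstar_dual :: "'g monoid \<Rightarrow> ('g \<Rightarrow> complex) set" where
  "cstar_dual G = {\<omega> \<in> extensional (carrier G).
     \<exists>K. \<forall>a\<in>group_alg G. cmod (functional_at \<omega> a) \<le> K * cstar_norm G a}"

definition dual_norm :: "'g monoid \<Rightarrow> ('g \<Rightarrow> complex) \<Rightarrow> real" where
  "dual_norm G \<omega> = (SUP a\<in>{a \<in> group_alg G. cstar_norm G a \<le> 1}. cmod (functional_at \<omega> a))"

text \<open>The value \<open>0\<close> outside the dual is there because \<^locale>\<open>Metric_space\<close> asks for a
  nonnegative distance on the whole type.\<close>

definition dual_dist :: "'g monoid \<Rightarrow> ('g \<Rightarrow> complex) \<Rightarrow> ('g \<Rightarrow> complex) \<Rightarrow> real" where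
  "dual_dist G \<omega>1 \<omega>2 = (if \<omega>1 \<in> cstar_dual G \<and> \<omega>2 \<in> cstar_dual G
     then dual_norm G (\<lambda>g\<in>carrier G. \<omega>1 g - \<omega>2 g) else 0)"

definition dual_topology :: "'g monoid \<Rightarrow> ('g \<Rightarrow> complex) topology" where
  "dual_topology G = Metric_space.mtopology (cstar_dual G) (dual_dist G)"


section \<open>Stable representations\<close>

definition aut_stab :: "'g monoid \<Rightarrow> 'g \<Rightarrow> ('g \<Rightarrow> 'g) set" where
  "aut_stab G g = {\<theta> \<in> auto G. \<theta> g = g}"

text \<open>The group topology on the automorphism group for which the sets \<^const>\<open>aut_stab\<close> form a
  subbase of neighbourhoods of the identity: their left translates are a subbase of the topology.
  (A translate containing the identity is itself one of these subgroups.)\<close>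

definition aut_topology :: "'g monoid \<Rightarrow> ('g \<Rightarrow> 'g) topology" where
  "aut_topology G = topology_generated_by
     {\<theta> <#\<^bsub>AutoGroup G\<^esub> aut_stab G g | \<theta> g. \<theta> \<in> auto G \<and> g \<in> carrier G}"

definition inner_autos :: "'g monoid \<Rightarrow> ('g \<Rightarrow> 'g) set" where
  "inner_autos G = (\<lambda>g. \<lambda>x\<in>carrier G. g \<otimes>\<^bsub>G\<^esub> x \<otimes>\<^bsub>G\<^esub> inv\<^bsub>G\<^esub> g) ` carrier G"

definition vector_functional ::
    "'g monoid \<Rightarrow> 'v::ab_group_add hspace \<Rightarrow> ('g \<Rightarrow> 'v \<Rightarrow> 'v) \<Rightarrow> 'v \<Rightarrow> 'g \<Rightarrow> complex" where
  "vector_functional G H \<pi> \<eta> = (\<lambda>g\<in>carrier G. iprod H (\<pi> g \<eta>) \<eta>)"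

definition stable_rep :: "'g monoid \<Rightarrow> 'v::ab_group_add hspace \<Rightarrow> ('g \<Rightarrow> 'v \<Rightarrow> 'v) \<Rightarrow> bool" where
  "stable_rep G H \<pi> \<longleftrightarrow> unitary_rep G H \<pi> \<and>
     (\<forall>\<eta>\<in>carrier H.
        continuous_map (subtopology (aut_topology G) (inner_autos G)) (dual_topology G)
          (\<lambda>\<theta>. compose (carrier G) (vector_functional G H \<pi> \<eta>) \<theta>))"


section \<open>The group \<open>B\<close>\<close>

text \<open>The pair \<open>(z, s)\<close> stands for a finitely supported sequence and a finitely supported permutation
  of \<open>{1, 2, \<dots>}\<close>, both extended trivially to index \<open>0\<close>.\<close>

definition B_grp :: "((nat \<Rightarrow> bit) \<times> (nat \<Rightarrow> nat)) monoid" where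
  "B_grp =
     \<lparr>carrier = {(z, s). finite {k. z k \<noteq> 0} \<and> z 0 = 0 \<and> s permutes {1..} \<and> finite {k. s k \<noteq> k}},
      mult = (\<lambda>(z, s) (z', s'). (\<lambda>k. z k + z' (inv_into UNIV s k), s \<circ> s')),
      one = (\<lambda>k. 0, id)\<rparr>"

text \<open>The element \<open>s z\<close> is the pair \<open>(z \<circ> s\<^sup>-\<^sup>1, s)\<close>; at a fixed point of \<open>s\<close> its first component
  agrees with \<open>z\<close>, so the support can be read off the pair.\<close>

definition B_supp :: "(nat \<Rightarrow> bit) \<times> (nat \<Rightarrow> nat) \<Rightarrow> nat set" where
  "B_supp b = {k. snd b k \<noteq> k \<or> fst b k \<noteq> 0}"

definition B_fin :: "nat \<Rightarrow> ((nat \<Rightarrow> bit) \<times> (nat \<Rightarrow> nat)) set" where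
  "B_fin n = {b \<in> carrier B_grp. B_supp b \<subseteq> {1..n}}"

definition B_tail :: "nat \<Rightarrow> ((nat \<Rightarrow> bit) \<times> (nat \<Rightarrow> nat)) set" where
  "B_tail n = {b \<in> carrier B_grp. B_supp b \<subseteq> {n + 1..}}"

definition B_inf :: "nat \<Rightarrow> ((nat \<Rightarrow> bit) \<times> (nat \<Rightarrow> nat)) set" where
  "B_inf n = B_fin n <#>\<^bsub>B_grp\<^esub> B_tail n"

end

theory Submission
  imports Defs
begin

text \<open>Let \<open>M = \<pi>(K)''\<close>, \<open>K = B\<^sub>n B\<^sub>n\<^sub>\<infinity>\<close>, be the finite factor, acting on \<open>H\<close>, and let \<open>\<delta>\<^sub>x v\<close> be the element of the
  induced space that is supported on the coset \<open>K x\<close> and takes the value \<open>v\<close> at \<open>x\<close>.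

  Factoriality. An operator \<open>T\<close> in the centre of the induced von Neumann algebra commutes with the
  pointwise action of \<open>M'\<close>, so the coefficients \<open>T\<^sub>x v = (T \<delta>\<^sub>1 v)(x)\<close> are operators in \<open>M\<close>. Since
  \<open>T\<^sub>x\<^sub>k = T\<^sub>x \<pi>(k)\<close> for \<open>k \<in> K\<close>, the coefficient \<open>T\<^sub>1\<close> is central in \<open>M\<close>, hence scalar. For \<open>x \<notin> K\<close> the
  cosets \<open>K x k\<close> form an infinite set, the operators \<open>T\<^sub>x\<^sub>k\<^sup>* T\<^sub>x\<^sub>k\<close> all have the same trace, and their
  sum over these cosets is bounded, which forces \<open>T\<^sub>x = 0\<close>.

  Stability. It suffices that a functional \<open>a \<mapsto> (\<pi>(a) v, y)\<close> is almost invariant, in norm, under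
  conjugation by the elements centralizing a large finite subset of \<open>K\<close>; an element centralizing the
  signs at \<open>1, \<dots>, n\<close> lies in \<open>K\<close>, so this passes to the induced representation. Suppose that
  \<open>p \<noteq> 0\<close> is orthogonal to all \<open>y\<close> that are good for a given \<open>v\<close>. Minimize \<open>\<parallel>p - b v\<parallel>\<^sup>2 + \<phi>(b\<^sup>* b)\<close> over
  the \<open>b \<in> M\<close> that commute with the centralizer of some finite set, \<open>\<phi>\<close> being a normal trace. By the
  Euler equation the limit \<open>y\<close> of \<open>p - b v\<close> along a minimizing sequence is good, whence
  \<open>y = 0\<close>, and the sequence satisfies \<open>\<phi>(b\<^sup>* b) \<rightarrow> 0\<close> and \<open>b v \<rightarrow> p\<close>. By normality \<open>\<phi>\<close> then
  vanishes on the projection onto the closure of \<open>M' p\<close>, for every \<open>\<phi>\<close>, a contradiction.\<close>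

section \<open>Hilbert spaces\<close>

text \<open>A vector functional is exactly invariant under conjugation when its vector is tracial;
  here the factor acts on an arbitrary space, so a trace vector need not exist and invariance has to
  be produced. The trace term of the minimized functional does this. Its derivative at
  \<open>b\<close> in direction \<open>c\<close> is \<open>-2 Re (p - b v, c v)\<close> plus twice
  the real part of the trace of \<open>c\<^sup>* b\<close>. If \<open>\<pi> g\<close> commutes with
  \<open>b\<close>, conjugating \<open>c\<close> by \<open>\<pi> g\<close> leaves the second term
  alone; the derivative being nearly zero at an almost minimizer, the first term hardly changes
  either, uniformly over contractions \<open>c\<close>. Hence the restriction to operators commuting
  with some centralizer; the infimum need not be attained among them. Normality serves to exclude
  that \<open>b v\<close> approaches \<open>p \<noteq> 0\<close> while \<open>b\<close> tends to 0
  in trace, for every trace. The argument stays with bounded operators: resolvents, themselves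
  obtained by minimization, replace spectral theory. Of \<open>B\<close> itself only two facts
  enter: the orbits of \<open>K\<close> on the cosets other than \<open>K\<close> are infinite, and
  some finite set has its centralizer inside \<open>K\<close>.\<close>

lemma quadratic_discriminant_bound:
  fixes d l q :: real
  assumes "\<And>r. 0 \<le> d + r * l + r\<^sup>2 * q" and "0 \<le> q"
  shows "l\<^sup>2 \<le> 4 * d * q"
proof (cases "q = 0")
  case True
  have "l = 0"
  proof (rule ccontr)
    assume "l \<noteq> 0"
    \<comment> \<open>At this \<open>r\<close> the affine function takes the value -1.\<close>
    then show False using assms(1)[of "- (d + 1) / l"] True by simp
  qed
  then show ?thesis using True by simp
next
  case False
  then have q: "0 < q" using assms by simp
  have "0 \<le> d + (- l / (2 * q)) * l + (- l / (2 * q))\<^sup>2 * q" by (rule assms)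
  also have "\<dots> = d - l\<^sup>2 / (4 * q)"
    using q by (simp add: field_simps power2_eq_square)
  finally show ?thesis using q by (simp add: field_simps)
qed

text \<open>Almost minimizers stand in for a minimizer, so no completeness is required.
  \<open>L b c\<close> is the derivative of \<open>J\<close> at \<open>b\<close> in direction
  \<open>c\<close>, and \<open>q\<close> is its quadratic part: the bound on \<open>L\<close> is the
  Euler equation with an error term, the bound on \<open>q\<close> is the Cauchy property. The
  linear structure is abstracted into \<open>add\<close> and \<open>dif\<close> because the lemma
  serves vectors of a Hilbert space as well as operators.\<close>

lemma quadratic_minimizing_sequence:
  fixes J q :: "'b \<Rightarrow> real" and L :: "'b \<Rightarrow> 'b \<Rightarrow> real"
    and add :: "real \<Rightarrow> 'b \<Rightarrow> 'b \<Rightarrow> 'b" and dif :: "'b \<Rightarrow> 'b \<Rightarrow> 'b"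
  assumes ne: "W \<noteq> {}" and bd: "\<And>b. b \<in> W \<Longrightarrow> m \<le> J b"
    and add: "\<And>r b c. b \<in> W \<Longrightarrow> c \<in> W \<Longrightarrow> add r b c \<in> W"
    and J: "\<And>r b c. b \<in> W \<Longrightarrow> c \<in> W \<Longrightarrow> J (add r b c) = J b + r * L b c + r\<^sup>2 * q c"
    and q: "\<And>c. c \<in> W \<Longrightarrow> 0 \<le> q c"
    and dif: "\<And>b c. b \<in> W \<Longrightarrow> c \<in> W \<Longrightarrow> dif b c \<in> W"
    and ad: "\<And>b c. b \<in> W \<Longrightarrow> c \<in> W \<Longrightarrow> add 1 c (dif b c) = b"
  obtains u d where "\<And>k::nat. u k \<in> W" "\<And>k. 0 \<le> d k" "d \<longlonglongrightarrow> (0::real)"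
    "\<And>k c. c \<in> W \<Longrightarrow> (L (u k) c)\<^sup>2 \<le> 4 * d k * q c"
    "\<And>j k. q (dif (u j) (u k)) \<le> 2 * (d j + d k)"
proof -
  define I where "I = Inf (J ` W)"
  have bdd: "bdd_below (J ` W)" using bd by (intro bdd_belowI2[where m = m])
  have I: "I \<le> J b" if "b \<in> W" for b
    unfolding I_def using bdd that by (auto intro: cInf_lower)
  define d :: "nat \<Rightarrow> real" where "d k = 1 / Suc k" for k
  have "\<exists>b\<in>W. J b < I + d k" for k
  proof -
    have "Inf (J ` W) < I + d k" unfolding I_def d_def by simp
    then show ?thesis using cInf_lessD[of "J ` W"] ne by blast
  qed
  then obtain u where u: "\<And>k. u k \<in> W" "\<And>k. J (u k) < I + d k" by metis
  have "(L (u k) c)\<^sup>2 \<le> 4 * d k * q c" if c: "c \<in> W" for k c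
  proof (rule quadratic_discriminant_bound)
    show "0 \<le> d k + r * L (u k) c + r\<^sup>2 * q c" for r
      using I[OF add[OF u(1) c], of r k] J[OF u(1) c, of r k] u(2)[of k] by linarith
  qed (use q c in auto)
  moreover have "q (dif (u j) (u k)) \<le> 2 * (d j + d k)" for j k
  proof -
    let ?c = "dif (u j) (u k)"
    have c: "?c \<in> W" using dif u by blast
    have 1: "J (u j) = J (u k) + L (u k) ?c + q ?c"
      using J[OF u(1) c, of 1 k] ad[OF u(1) u(1), of k j] by simp
    \<comment> \<open>Comparison with the midpoint of \<open>u k\<close> and \<open>u j\<close>, as
      in the parallelogram law.\<close>
    have 2: "J (add (1/2) (u k) ?c) = J (u k) + (1/2) * L (u k) ?c + (1/4) * q ?c"
      using J[OF u(1) c, of "1/2" k] by (simp add: power2_eq_square)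
    have "I \<le> J (u k) + (1/2) * L (u k) ?c + (1/4) * q ?c"
      using I[OF add[OF u(1) c], of "1/2" k] unfolding 2 .
    then show ?thesis using 1 u(2)[of k] u(2)[of j] by argo
  qed
  moreover have "d \<longlonglongrightarrow> 0" unfolding d_def using LIMSEQ_Suc[OF lim_const_over_n[of 1]] by simp
  moreover have "0 \<le> d k" for k unfolding d_def by simp
  ultimately show ?thesis using that u(1) by blast
qed

section \<open>Inner product and norm\<close>

locale hilb =
  fixes H :: "'v::ab_group_add hspace"
  assumes hilbert: "hilbert_space H"
begin

abbreviation "X \<equiv> carrier H"
abbreviation "ip \<equiv> iprod H"
abbreviation "sc \<equiv> scal H"
abbreviation "nm \<equiv> hnorm H"

sublocale vs: vector_space sc
  using hilbert unfolding hilbert_space_def by blast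

lemma subspace_X: "vs.subspace X"
  using hilbert unfolding hilbert_space_def by blast

lemma zero_in [simp, intro]: "0 \<in> X"
  and add_in [simp, intro]: "x \<in> X \<Longrightarrow> y \<in> X \<Longrightarrow> x + y \<in> X"
  and scale_in [simp, intro]: "x \<in> X \<Longrightarrow> sc c x \<in> X"
  and neg_in [simp, intro]: "x \<in> X \<Longrightarrow> - x \<in> X"
  and diff_in [simp, intro]: "x \<in> X \<Longrightarrow> y \<in> X \<Longrightarrow> x - y \<in> X"
  by (fact subspace_X[THEN vs.subspace_0] subspace_X[THEN vs.subspace_add] subspace_X[THEN vs.subspace_scale]
      subspace_X[THEN vs.subspace_neg] subspace_X[THEN vs.subspace_diff])+

lemma sum_in [intro]: "(\<And>i. i \<in> I \<Longrightarrow> f i \<in> X) \<Longrightarrow> (\<Sum>i\<in>I. f i) \<in> X"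
  using vs.subspace_sum[OF subspace_X] by blast

lemma
  shows ip_add_left: "x \<in> X \<Longrightarrow> y \<in> X \<Longrightarrow> z \<in> X \<Longrightarrow> ip (x + y) z = ip x z + ip y z"
    and ip_scale_left: "x \<in> X \<Longrightarrow> y \<in> X \<Longrightarrow> ip (sc c x) y = c * ip x y"
    and ip_commute: "x \<in> X \<Longrightarrow> y \<in> X \<Longrightarrow> ip y x = cnj (ip x y)"
    and ip_self: "x \<in> X \<Longrightarrow> ip x x \<in> \<real>\<^sub>\<ge>\<^sub>0"
    and ip_self_eq0: "x \<in> X \<Longrightarrow> ip x x = 0 \<Longrightarrow> x = 0"
proof -
  note h = hilbert[unfolded hilbert_space_def, THEN conjunct2, THEN conjunct2]
  note h2 = h[THEN conjunct2] note h3 = h2[THEN conjunct2] note h4 = h3[THEN conjunct2]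
  show "x \<in> X \<Longrightarrow> y \<in> X \<Longrightarrow> z \<in> X \<Longrightarrow> ip (x + y) z = ip x z + ip y z"
    using h[THEN conjunct1] by blast
  show "x \<in> X \<Longrightarrow> y \<in> X \<Longrightarrow> ip (sc c x) y = c * ip x y"
    using h2[THEN conjunct1] by blast
  show "x \<in> X \<Longrightarrow> y \<in> X \<Longrightarrow> ip y x = cnj (ip x y)"
    using h3[THEN conjunct1] by blast
  show "x \<in> X \<Longrightarrow> ip x x \<in> \<real>\<^sub>\<ge>\<^sub>0" "x \<in> X \<Longrightarrow> ip x x = 0 \<Longrightarrow> x = 0"
    using h4[THEN conjunct1] by blast+
qed

lemma complete:
  assumes "\<And>k::nat. u k \<in> X" "\<And>e. e > 0 \<Longrightarrow> \<exists>N. \<forall>j\<ge>N. \<forall>k\<ge>N. nm (u j - u k) < e"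
  obtains x where "x \<in> X" "(\<lambda>k. nm (u k - x)) \<longlonglongrightarrow> 0"
proof -
  have "\<forall>u. (\<forall>k::nat. u k \<in> X) \<and> (\<forall>e>0. \<exists>N. \<forall>j\<ge>N. \<forall>k\<ge>N. nm (u j - u k) < e) \<longrightarrow>
      (\<exists>x\<in>X. (\<lambda>k. nm (u k - x)) \<longlonglongrightarrow> 0)"
    by (rule hilbert[unfolded hilbert_space_def, THEN conjunct2, THEN conjunct2, THEN conjunct2,
          THEN conjunct2, THEN conjunct2, THEN conjunct2])
  then have "\<exists>x\<in>X. (\<lambda>k. nm (u k - x)) \<longlonglongrightarrow> 0"
    using assms by (elim allE[of _ u] impE) simp_all
  then show ?thesis using that by (elim bexE)
qed

lemma ip_add_right: "x \<in> X \<Longrightarrow> y \<in> X \<Longrightarrow> z \<in> X \<Longrightarrow> ip z (x + y) = ip z x + ip z y"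
  using ip_add_left ip_commute add_in by (metis complex_cnj_add)

lemma ip_scale_right: "x \<in> X \<Longrightarrow> y \<in> X \<Longrightarrow> ip y (sc c x) = cnj c * ip y x"
  using ip_scale_left ip_commute scale_in by (metis complex_cnj_mult)

lemma neg_eq_scale: "- x = sc (- 1) x"
  by simp

lemma ip_minus_left: "x \<in> X \<Longrightarrow> y \<in> X \<Longrightarrow> ip (- x) y = - ip x y"
  by (metis ip_scale_left mult_minus1 neg_eq_scale)

lemma ip_minus_right: "x \<in> X \<Longrightarrow> y \<in> X \<Longrightarrow> ip y (- x) = - ip y x"
  by (metis ip_minus_left ip_commute neg_in complex_cnj_minus)

lemma ip_diff_left: "x \<in> X \<Longrightarrow> y \<in> X \<Longrightarrow> z \<in> X \<Longrightarrow> ip (x - y) z = ip x z - ip y z"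
  using ip_add_left[of x "- y" z] ip_minus_left by simp

lemma ip_diff_right: "x \<in> X \<Longrightarrow> y \<in> X \<Longrightarrow> z \<in> X \<Longrightarrow> ip z (x - y) = ip z x - ip z y"
  using ip_add_right[of x "- y" z] ip_minus_right by simp

lemma ip_zero_left [simp]: "x \<in> X \<Longrightarrow> ip 0 x = 0"
  using ip_diff_left[of x x x] by simp

lemma ip_zero_right [simp]: "x \<in> X \<Longrightarrow> ip x 0 = 0"
  using ip_diff_right[of x x x] by simp

lemma ip_sum_left:
  "(\<And>i. i \<in> I \<Longrightarrow> f i \<in> X) \<Longrightarrow> y \<in> X \<Longrightarrow> ip (\<Sum>i\<in>I. f i) y = (\<Sum>i\<in>I. ip (f i) y)"
proof (induction I rule: infinite_finite_induct)
  case (insert i I)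
  then show ?case by (simp add: ip_add_left sum_in)
qed auto

lemmas ip_simps = ip_add_left ip_add_right ip_scale_left ip_scale_right ip_minus_left ip_minus_right
  ip_diff_left ip_diff_right

lemma Re_ip_commute: "x \<in> X \<Longrightarrow> y \<in> X \<Longrightarrow> Re (ip y x) = Re (ip x y)"
  by (simp add: ip_commute[of x y])

lemma nm_ge0 [simp]: "x \<in> X \<Longrightarrow> 0 \<le> nm x"
  unfolding hnorm_def using ip_self[of x] by (simp add: complex_nonneg_Reals_iff)

lemma nm_sq: "x \<in> X \<Longrightarrow> (nm x)\<^sup>2 = Re (ip x x)"
  unfolding hnorm_def using ip_self[of x] by (simp add: complex_nonneg_Reals_iff)

lemma ip_nm_sq: "x \<in> X \<Longrightarrow> ip x x = complex_of_real ((nm x)\<^sup>2)"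
  using nm_sq[of x] ip_self[of x] by (simp add: complex_nonneg_Reals_iff complex_eq_iff)

lemma nm_eq0 [simp]: "x \<in> X \<Longrightarrow> nm x = 0 \<longleftrightarrow> x = 0"
  using ip_nm_sq[of x] ip_self_eq0[of x] by auto

lemma nm_zero [simp]: "nm 0 = 0"
  using nm_eq0[of 0] by simp

lemma nm_scale: "x \<in> X \<Longrightarrow> nm (sc c x) = cmod c * nm x"
proof -
  assume x: "x \<in> X"
  have "complex_of_real ((nm (sc c x))\<^sup>2) = c * cnj c * ip x x"
    using x unfolding ip_nm_sq[OF scale_in[OF x], symmetric] by (simp add: ip_simps)
  also have "\<dots> = complex_of_real ((cmod c)\<^sup>2 * (nm x)\<^sup>2)"
    unfolding ip_nm_sq[OF x] complex_norm_square[symmetric] by simp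
  finally have "(nm (sc c x))\<^sup>2 = (cmod c * nm x)\<^sup>2"
    unfolding of_real_eq_iff power_mult_distrib .
  then show ?thesis using x by (simp add: power2_eq_iff_nonneg)
qed

lemma nm_minus [simp]: "x \<in> X \<Longrightarrow> nm (- x) = nm x"
  using nm_scale[of x "-1"] by simp

lemma nm_diff_commute: "x \<in> X \<Longrightarrow> y \<in> X \<Longrightarrow> nm (x - y) = nm (y - x)"
  using nm_minus[of "x - y"] by simp

lemma nm_add_sq: "x \<in> X \<Longrightarrow> y \<in> X \<Longrightarrow> (nm (x + y))\<^sup>2 = (nm x)\<^sup>2 + 2 * Re (ip x y) + (nm y)\<^sup>2"
  by (simp add: nm_sq ip_simps Re_ip_commute)

lemma nm_diff_sq: "x \<in> X \<Longrightarrow> y \<in> X \<Longrightarrow> (nm (x - y))\<^sup>2 = (nm x)\<^sup>2 - 2 * Re (ip x y) + (nm y)\<^sup>2"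
  by (simp add: nm_sq ip_simps Re_ip_commute)

lemma nm_add_scale_sq:
  "x \<in> X \<Longrightarrow> y \<in> X \<Longrightarrow>
    (nm (x + sc (complex_of_real r) y))\<^sup>2 = (nm x)\<^sup>2 + r * (2 * Re (ip x y)) + r\<^sup>2 * (nm y)\<^sup>2"
  by (simp add: nm_add_sq nm_scale ip_simps power_mult_distrib)

lemma Cauchy_Schwarz: 
  assumes "x \<in> X" "y \<in> X"
  shows "cmod (ip x y) \<le> nm x * nm y"
proof -
  let ?c = "ip x y"
  \<comment> \<open>Scaling \<open>y\<close> by its inner product with \<open>x\<close> makes the
    mixed term real, so a real parameter \<open>r\<close> is enough.\<close>
  have "0 \<le> (nm x)\<^sup>2 + r * (2 * (cmod ?c)\<^sup>2) + r\<^sup>2 * ((cmod ?c)\<^sup>2 * (nm y)\<^sup>2)" for r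
  proof -
    have "0 \<le> (nm (x + sc (complex_of_real r) (sc ?c y)))\<^sup>2" by simp
    also have "\<dots> = (nm x)\<^sup>2 + r * (2 * Re (cnj ?c * ?c)) + r\<^sup>2 * (cmod ?c * nm y)\<^sup>2"
      using assms by (simp only: nm_add_scale_sq scale_in nm_scale ip_scale_right)
    also have "Re (cnj ?c * ?c) = (cmod ?c)\<^sup>2"
      unfolding mult.commute[of "cnj ?c"] complex_norm_square[symmetric] by simp
    finally show ?thesis by (simp only: power_mult_distrib)
  qed
  then have "(2 * (cmod ?c)\<^sup>2)\<^sup>2 \<le> 4 * (nm x)\<^sup>2 * ((cmod ?c)\<^sup>2 * (nm y)\<^sup>2)"
    by (rule quadratic_discriminant_bound) simp
  then have "(cmod ?c)\<^sup>2 * (cmod ?c)\<^sup>2 \<le> (cmod ?c)\<^sup>2 * (nm x * nm y)\<^sup>2"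
    by (simp add: power2_eq_square algebra_simps)
  then have "?c = 0 \<or> (cmod ?c)\<^sup>2 \<le> (nm x * nm y)\<^sup>2"
    using mult_le_cancel_left_pos[of "(cmod ?c)\<^sup>2"] by fastforce
  then show ?thesis
    using assms by (auto intro: power2_le_imp_le)
qed

lemma Re_ip_le: "x \<in> X \<Longrightarrow> y \<in> X \<Longrightarrow> Re (ip x y) \<le> nm x * nm y"
  using Cauchy_Schwarz complex_Re_le_cmod order_trans by blast

lemma nm_triangle: assumes "x \<in> X" "y \<in> X" shows "nm (x + y) \<le> nm x + nm y"
proof (rule power2_le_imp_le)
  show "(nm (x + y))\<^sup>2 \<le> (nm x + nm y)\<^sup>2"
    using Re_ip_le[OF assms] assms by (simp add: nm_add_sq power2_sum)
qed (use assms in simp)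

lemma nm_triangle_diff: "x \<in> X \<Longrightarrow> y \<in> X \<Longrightarrow> nm (x - y) \<le> nm x + nm y"
  using nm_triangle[of x "- y"] by simp

lemma nm_triangle_via: "x \<in> X \<Longrightarrow> y \<in> X \<Longrightarrow> z \<in> X \<Longrightarrow> nm (x - z) \<le> nm (x - y) + nm (y - z)"
  using nm_triangle[of "x - y" "y - z"] by simp

lemma nm_le_diff: "x \<in> X \<Longrightarrow> y \<in> X \<Longrightarrow> \<bar>nm x - nm y\<bar> \<le> nm (x - y)"
  using nm_triangle[of "x - y" y] nm_triangle[of "y - x" x] nm_diff_commute[of x y] by simp

lemma nm_sum_le: "(\<And>i. i \<in> I \<Longrightarrow> f i \<in> X) \<Longrightarrow> nm (\<Sum>i\<in>I. f i) \<le> (\<Sum>i\<in>I. nm (f i))"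
proof (induction I rule: infinite_finite_induct)
  case (insert i I)
  then have "nm (f i + (\<Sum>i\<in>I. f i)) \<le> nm (f i) + nm (\<Sum>i\<in>I. f i)"
    by (intro nm_triangle sum_in) auto
  with insert show ?case by simp
qed auto

lemma nm_le_if_ip_le:
  assumes "x \<in> X" "0 \<le> K" "\<And>y. y \<in> X \<Longrightarrow> cmod (ip x y) \<le> K * nm y"
  shows "nm x \<le> K"
proof (cases "nm x = 0")
  case False
  have "nm x * nm x \<le> K * nm x"
    using assms(3)[of x] assms(1) by (simp add: ip_nm_sq power2_eq_square norm_mult)
  moreover have "0 < nm x" using False nm_ge0[OF assms(1)] by linarith
  ultimately show ?thesis by simp
qed (use assms in simp)

lemma eq_if_ip_eq: "x \<in> X \<Longrightarrow> y \<in> X \<Longrightarrow> (\<And>z. z \<in> X \<Longrightarrow> ip x z = ip y z) \<Longrightarrow> x = y"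
  using ip_self_eq0[of "x - y"] by (simp add: ip_simps)

lemma tendsto_ip_left:
  assumes "\<And>k. u k \<in> X" "x \<in> X" "y \<in> X" "((\<lambda>k. nm (u k - x)) \<longlongrightarrow> 0) F"
  shows "((\<lambda>k. ip (u k) y) \<longlongrightarrow> ip x y) F"
proof (rule Lim_null[THEN iffD2], rule Lim_null_comparison)
  show "\<forall>\<^sub>F k in F. norm (ip (u k) y - ip x y) \<le> nm (u k - x) * nm y"
    using Cauchy_Schwarz assms by (simp flip: ip_diff_left)
  show "((\<lambda>k. nm (u k - x) * nm y) \<longlongrightarrow> 0) F"
    using tendsto_mult_right[OF assms(4)] by simp
qed

lemma tendsto_nm:
  assumes "\<And>k. u k \<in> X" "x \<in> X" "((\<lambda>k. nm (u k - x)) \<longlongrightarrow> 0) F"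
  shows "((\<lambda>k. nm (u k)) \<longlongrightarrow> nm x) F"
proof (rule Lim_null[THEN iffD2], rule Lim_null_comparison)
  show "\<forall>\<^sub>F k in F. norm (nm (u k) - nm x) \<le> nm (u k - x)"
    using nm_le_diff assms by simp
qed (use assms in simp)

section \<open>The theorems of Lax-Milgram and Riesz, and orthogonal projection\<close>

text \<open>For symmetric coercive \<open>A\<close> the equation is the Euler equation of
  \<open>J x = (A x, x) - 2 Re (l x)\<close>, and coercivity makes a minimizing sequence Cauchy. The
  identity for \<open>A\<close> gives Riesz representation, \<open>1 + s\<close> for
  \<open>A\<close> gives resolvents.\<close>

lemma lax_milgram:
  assumes AX: "\<And>x. x \<in> X \<Longrightarrow> A x \<in> X"
    and A_add: "\<And>x y. x \<in> X \<Longrightarrow> y \<in> X \<Longrightarrow> A (x + y) = A x + A y"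
    and A_scale: "\<And>c x. x \<in> X \<Longrightarrow> A (sc c x) = sc c (A x)"
    and A_sym: "\<And>x y. x \<in> X \<Longrightarrow> y \<in> X \<Longrightarrow> ip (A x) y = ip x (A y)"
    and A_ge: "\<And>x. x \<in> X \<Longrightarrow> (nm x)\<^sup>2 \<le> Re (ip (A x) x)"
    and A_le: "\<And>x. x \<in> X \<Longrightarrow> nm (A x) \<le> K * nm x"
    and l_add: "\<And>x y. x \<in> X \<Longrightarrow> y \<in> X \<Longrightarrow> l (x + y) = l x + l y"
    and l_scale: "\<And>c x. x \<in> X \<Longrightarrow> l (sc c x) = c * l x"
    and l_le: "\<And>x. x \<in> X \<Longrightarrow> cmod (l x) \<le> C * nm x"
  obtains x where "x \<in> X" "\<And>y. y \<in> X \<Longrightarrow> l y = ip y (A x)"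
proof -
  define J where "J x = Re (ip (A x) x) - 2 * Re (l x)" for x
  define L where "L x y = 2 * Re (ip (A x) y) - 2 * Re (l y)" for x y
  define q where "q x = Re (ip (A x) x)" for x
  have nmq: "(nm x)\<^sup>2 \<le> q x" if "x \<in> X" for x unfolding q_def using A_ge that .
  \<comment> \<open>Completing the square in \<open>nm x\<close>.\<close>
  have lower: "- C\<^sup>2 \<le> J x" if x: "x \<in> X" for x
  proof -
    have "Re (l x) \<le> C * nm x" using l_le[OF x] complex_Re_le_cmod order_trans by blast
    moreover have "0 \<le> (nm x - C)\<^sup>2" by simp
    ultimately show ?thesis using A_ge[OF x] unfolding J_def power2_diff by (simp add: algebra_simps)
  qed
  have expand: "J (x + sc (complex_of_real r) y) = J x + r * L x y + r\<^sup>2 * q y"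
    if "x \<in> X" "y \<in> X" for r x y
  proof -
    have "Re (ip (A y) x) = Re (ip (A x) y)"
      using that A_sym Re_ip_commute AX by metis
    then show ?thesis
      unfolding J_def L_def q_def using that
      by (simp add: A_add A_scale l_add l_scale ip_simps AX algebra_simps power2_eq_square)
  qed
  obtain u d where u: "\<And>k::nat. u k \<in> X" and d: "\<And>k. 0 \<le> d k" "d \<longlonglongrightarrow> (0::real)"
    and L: "\<And>k c. c \<in> X \<Longrightarrow> (L (u k) c)\<^sup>2 \<le> 4 * d k * q c"
    and Q: "\<And>j k. q (u j - u k) \<le> 2 * (d j + d k)"
    by (rule quadratic_minimizing_sequence[of X "- C\<^sup>2" J "\<lambda>r x y. x + sc (complex_of_real r) y" L q
          "\<lambda>x y. x - y"])
      (use expand lower order_trans[OF zero_le_power2 nmq] in auto)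
  have "\<exists>N. \<forall>j\<ge>N. \<forall>k\<ge>N. nm (u j - u k) < e" if e: "e > 0" for e
  proof -
    have "\<forall>\<^sub>F k in sequentially. d k < e\<^sup>2 / 4"
      by (rule order_tendstoD(2)[OF d(2)]) (use e in simp)
    then obtain N where N: "\<And>k. k \<ge> N \<Longrightarrow> d k < e\<^sup>2 / 4" unfolding eventually_sequentially by blast
    have "nm (u j - u k) < e" if "j \<ge> N" "k \<ge> N" for j k
    proof (rule power2_less_imp_less)
      show "(nm (u j - u k))\<^sup>2 < e\<^sup>2"
        using nmq[of "u j - u k"] Q[of j k] N[OF that(1)] N[OF that(2)] u by simp
    qed (use e in simp)
    then show ?thesis by blast
  qed
  then obtain x where x: "x \<in> X" and lim: "(\<lambda>k. nm (u k - x)) \<longlonglongrightarrow> 0"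
    using complete[of u] u by blast
  have re: "Re (ip y (A x)) = Re (l y)" if y: "y \<in> X" for y
  proof -
    have "(\<lambda>k. (L (u k) y)\<^sup>2) \<longlonglongrightarrow> 0"
    proof (rule Lim_null_comparison)
      show "\<forall>\<^sub>F k in sequentially. norm ((L (u k) y)\<^sup>2) \<le> 4 * d k * q y"
        using L y by simp
      show "(\<lambda>k. 4 * d k * q y) \<longlonglongrightarrow> 0"
        using tendsto_mult_right[OF tendsto_mult_left[OF d(2), of 4], of "q y"] by simp
    qed
    moreover have "(\<lambda>k. (L (u k) y)\<^sup>2) \<longlonglongrightarrow> (L x y)\<^sup>2"
    proof -
      \<comment> \<open>Symmetry moves \<open>A\<close> onto the fixed vector, where the convergence
        of \<open>u k\<close> can be used.\<close>
      have "(\<lambda>k. ip (u k) (A y)) \<longlonglongrightarrow> ip x (A y)"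
        by (rule tendsto_ip_left) (use u x y AX lim in auto)
      then have "(\<lambda>k. ip (A (u k)) y) \<longlonglongrightarrow> ip (A x) y"
        using A_sym u x y by simp
      then show ?thesis unfolding L_def by (intro tendsto_intros)
    qed
    ultimately have "(L x y)\<^sup>2 = 0" using LIMSEQ_unique by blast
    then show ?thesis unfolding L_def using x y AX Re_ip_commute by simp
  qed
  \<comment> \<open>The real part of the identity at \<open>\<i> y\<close> is its imaginary part at
    \<open>y\<close>, up to sign.\<close>
  have "l y = ip y (A x)" if y: "y \<in> X" for y
    using re[OF y] re[of "sc \<i> y"] y x AX by (simp add: l_scale ip_simps complex_eq_iff)
  then show ?thesis using that x by blast
qed

lemma riesz:
  assumes "\<And>x y. x \<in> X \<Longrightarrow> y \<in> X \<Longrightarrow> l (x + y) = l x + l y"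
    and "\<And>c x. x \<in> X \<Longrightarrow> l (sc c x) = c * l x"
    and "\<And>x. x \<in> X \<Longrightarrow> cmod (l x) \<le> C * nm x"
  obtains x where "x \<in> X" "\<And>y. y \<in> X \<Longrightarrow> l y = ip y x"
  by (rule lax_milgram[of "\<lambda>x. x" 1 l C]) (use assms in \<open>auto simp: nm_sq\<close>)

definition closed_subspace :: "'v set \<Rightarrow> bool" where
  "closed_subspace W \<longleftrightarrow> vs.subspace W \<and> W \<subseteq> X \<and>
     (\<forall>u x. (\<forall>k::nat. u k \<in> W) \<and> x \<in> X \<and> (\<lambda>k. nm (u k - x)) \<longlonglongrightarrow> 0 \<longrightarrow> x \<in> W)"

text \<open>A closed subspace is a Hilbert space in its own right, and the projection of
  \<open>p\<close> is the Riesz vector of \<open>y \<mapsto> ip y p\<close> there.\<close>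

lemma projection:
  assumes W: "closed_subspace W" and p: "p \<in> X"
  shows "\<exists>w\<in>W. \<forall>y\<in>W. ip y (p - w) = 0"
proof -
  let ?H = "H\<lparr>carrier := W\<rparr>"
  have WX: "W \<subseteq> X" and sub: "vs.subspace W" using W unfolding closed_subspace_def by auto
  have nm': "hnorm ?H = nm" by (simp add: hnorm_def fun_eq_iff)
  have "hilbert_space ?H"
    unfolding hilbert_space_def nm'
  proof (intro conjI allI ballI impI)
    fix u :: "nat \<Rightarrow> 'v"
    assume *: "(\<forall>k. u k \<in> carrier ?H) \<and> (\<forall>e>0. \<exists>N. \<forall>j\<ge>N. \<forall>k\<ge>N. nm (u j - u k) < e)"
    then obtain x where "x \<in> X" "(\<lambda>k. nm (u k - x)) \<longlonglongrightarrow> 0"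
      using complete[of u] WX by auto
    then show "\<exists>x\<in>carrier ?H. (\<lambda>k. nm (u k - x)) \<longlonglongrightarrow> 0"
      using W * unfolding closed_subspace_def by auto
  next
    show "iprod ?H y x = cnj (iprod ?H x y)" if "x \<in> carrier ?H" "y \<in> carrier ?H" for x y
      using ip_commute[of x y] that WX by auto
  qed (use WX sub vs.vector_space_axioms ip_self ip_self_eq0 in \<open>auto simp: subset_iff ip_simps\<close>)
  then interpret W: hilb ?H by unfold_locales
  obtain w where "w \<in> W" "\<And>y. y \<in> W \<Longrightarrow> ip y p = ip y w"
    by (rule W.riesz[of "\<lambda>y. ip y p" "nm p"])
      (use WX p Cauchy_Schwarz in \<open>auto simp: nm' subset_iff ip_simps mult.commute\<close>)
  then show ?thesis using p WX by (intro bexI[of _ w]) (auto simp: ip_simps subset_iff)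
qed

text \<open>The density principle: a property that defines a closed subspace extends to all vectors
  once no nonzero vector is orthogonal to that subspace.\<close>

lemma closed_subspace_eq_X:
  assumes W: "closed_subspace W" and orth: "\<And>p. p \<in> X \<Longrightarrow> (\<And>y. y \<in> W \<Longrightarrow> ip y p = 0) \<Longrightarrow> p = 0"
  shows "W = X"
proof
  show WX: "W \<subseteq> X" using W unfolding closed_subspace_def by auto
  show "X \<subseteq> W"
  proof
    fix p assume p: "p \<in> X"
    obtain w where w: "w \<in> W" "\<And>y. y \<in> W \<Longrightarrow> ip y (p - w) = 0" using projection[OF W p] by blast
    then have "p - w = 0" using orth[of "p - w"] p WX by auto
    then show "p \<in> W" using w by simp
  qed
qed

end

lemma square_le_mult_imp_le:
  fixes a b :: real
  assumes "a\<^sup>2 \<le> a * b" "0 \<le> a" "0 \<le> b"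
  shows "a \<le> b"
proof (cases "a = 0")
  case False
  then show ?thesis using assms by (simp add: power2_eq_square)
qed (use assms in simp)

context hilb
begin

section \<open>Bounded operators\<close>

abbreviation "bops \<equiv> bounded_ops H"

lemma
  assumes "T \<in> bops"
  shows op_in [simp]: "x \<in> X \<Longrightarrow> T x \<in> X"
    and op_add: "x \<in> X \<Longrightarrow> y \<in> X \<Longrightarrow> T (x + y) = T x + T y"
    and op_scale: "x \<in> X \<Longrightarrow> T (sc c x) = sc c (T x)"
    and op_ext: "T \<in> extensional X"
  using assms unfolding bounded_ops_def by (auto simp: PiE_def)

lemma op_bound:
  assumes "T \<in> bops"
  obtains K where "0 \<le> K" "\<And>x. x \<in> X \<Longrightarrow> nm (T x) \<le> K * nm x"
proof -
  obtain K where K: "\<forall>x\<in>X. nm (T x) \<le> K * nm x"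
    using assms unfolding bounded_ops_def by auto
  have "nm (T x) \<le> max K 0 * nm x" if "x \<in> X" for x
    using K that by (meson max.cobounded1 mult_right_mono nm_ge0 order_trans)
  then show ?thesis using that[of "max K 0"] by simp
qed

lemma op_minus': "T \<in> bops \<Longrightarrow> x \<in> X \<Longrightarrow> T (- x) = - T x"
  using op_scale[of T x "-1"] by simp

lemma op_diff: "T \<in> bops \<Longrightarrow> x \<in> X \<Longrightarrow> y \<in> X \<Longrightarrow> T (x - y) = T x - T y"
  using op_add[of T x "- y"] op_minus'[of T y] by simp

lemma op_zero: "T \<in> bops \<Longrightarrow> T 0 = 0"
  using op_diff[of T 0 0] by simp

lemma op_sum: "T \<in> bops \<Longrightarrow> (\<And>i. i \<in> I \<Longrightarrow> f i \<in> X) \<Longrightarrow> T (\<Sum>i\<in>I. f i) = (\<Sum>i\<in>I. T (f i))"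
proof (induction I rule: infinite_finite_induct)
  case (insert i I)
  then show ?case by (simp add: op_add sum_in)
qed (auto simp: op_zero)

lemma op_eqI: "S \<in> bops \<Longrightarrow> T \<in> bops \<Longrightarrow> (\<And>x. x \<in> X \<Longrightarrow> S x = T x) \<Longrightarrow> S = T"
  by (rule extensionalityI[OF op_ext op_ext])

lemma bopsI:
  assumes "T \<in> extensional X" "\<And>x. x \<in> X \<Longrightarrow> T x \<in> X"
    and "\<And>x y. x \<in> X \<Longrightarrow> y \<in> X \<Longrightarrow> T (x + y) = T x + T y"
    and "\<And>c x. x \<in> X \<Longrightarrow> T (sc c x) = sc c (T x)"
    and "\<And>x. x \<in> X \<Longrightarrow> nm (T x) \<le> K * nm x"
  shows "T \<in> bops"
  unfolding bounded_ops_def using assms by (auto simp: PiE_def intro!: exI[of _ K])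

lemma compose_apply [simp]: "x \<in> X \<Longrightarrow> compose X S T x = S (T x)"
  by (simp add: compose_def)

lemma scalar_op_apply [simp]: "x \<in> X \<Longrightarrow> scalar_op H c x = sc c x"
  by (simp add: scalar_op_def)

lemma op_plus_apply [simp]: "x \<in> X \<Longrightarrow> op_plus H S T x = S x + T x"
  by (simp add: op_plus_def)

lemma op_minus_apply [simp]: "x \<in> X \<Longrightarrow> op_minus H S T x = S x - T x"
  by (simp add: op_minus_def)

lemma scalar_op_in [simp, intro]: "scalar_op H c \<in> bops"
  by (rule bopsI[where K = "cmod c"])
    (auto simp: vs.scale_right_distrib nm_scale mult.commute scalar_op_def)

lemma compose_in [simp, intro]:
  assumes "S \<in> bops" "T \<in> bops"
  shows "compose X S T \<in> bops"
proof -
  obtain K L where K: "0 \<le> K" "\<And>x. x \<in> X \<Longrightarrow> nm (S x) \<le> K * nm x"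
    and L: "0 \<le> L" "\<And>x. x \<in> X \<Longrightarrow> nm (T x) \<le> L * nm x"
    using op_bound assms by metis
  have "nm (compose X S T x) \<le> (K * L) * nm x" if x: "x \<in> X" for x
  proof -
    have "nm (S (T x)) \<le> K * nm (T x)" using K op_in[OF assms(2) x] by blast
    also have "\<dots> \<le> K * (L * nm x)" using K L x by (intro mult_left_mono) auto
    finally show ?thesis using x by (simp add: mult.assoc)
  qed
  then show ?thesis
    using assms by (intro bopsI[where K = "K * L"]) (auto simp: op_add op_scale op_in compose_def)
qed

lemma op_plus_in [simp, intro]:
  assumes "S \<in> bops" "T \<in> bops"
  shows "op_plus H S T \<in> bops"
proof -
  obtain K L where K: "0 \<le> K" "\<And>x. x \<in> X \<Longrightarrow> nm (S x) \<le> K * nm x"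
    and L: "0 \<le> L" "\<And>x. x \<in> X \<Longrightarrow> nm (T x) \<le> L * nm x"
    using op_bound assms by metis
  have "nm (op_plus H S T x) \<le> (K + L) * nm x" if x: "x \<in> X" for x
    using nm_triangle[of "S x" "T x"] K(2)[OF x] L(2)[OF x] x assms
    by (simp add: op_in distrib_right)
  then show ?thesis
    using assms by (intro bopsI[where K = "K + L"])
      (auto simp: op_add op_scale op_in op_plus_def vs.scale_right_distrib)
qed

lemma op_minus_eq_plus:
  assumes "S \<in> bops" "T \<in> bops"
  shows "op_minus H S T = op_plus H S (compose X (scalar_op H (-1)) T)"
  using assms by (auto simp: op_minus_def op_plus_def fun_eq_iff op_in restrict_def)

lemma op_minus_in [simp, intro]: "S \<in> bops \<Longrightarrow> T \<in> bops \<Longrightarrow> op_minus H S T \<in> bops"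
  unfolding op_minus_eq_plus by blast

lemma adjoint_exists:
  assumes T: "T \<in> bops"
  shows "\<exists>S\<in>bops. adjoint_pair H T S"
proof -
  obtain K where K: "0 \<le> K" "\<And>x. x \<in> X \<Longrightarrow> nm (T x) \<le> K * nm x"
    using op_bound[OF T] by metis
  have "\<exists>z\<in>X. \<forall>x\<in>X. ip (T x) y = ip x z" if y: "y \<in> X" for y
  proof -
    obtain z where "z \<in> X" "\<And>x. x \<in> X \<Longrightarrow> ip (T x) y = ip x z"
    proof (rule riesz[of "\<lambda>x. ip (T x) y" "K * nm y"])
      show "cmod (ip (T x) y) \<le> K * nm y * nm x" if x: "x \<in> X" for x
      proof -
        have "cmod (ip (T x) y) \<le> nm (T x) * nm y" by (rule Cauchy_Schwarz) (use T x y in auto)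
        also have "\<dots> \<le> (K * nm x) * nm y" using K x y by (intro mult_right_mono) auto
        finally show ?thesis by (simp add: mult_ac)
      qed
    qed (use T y in \<open>auto simp: op_add op_scale ip_simps op_in\<close>)
    then show ?thesis by blast
  qed
  then obtain f where f: "\<And>y. y \<in> X \<Longrightarrow> f y \<in> X" "\<And>x y. x \<in> X \<Longrightarrow> y \<in> X \<Longrightarrow> ip (T x) y = ip x (f y)"
    by metis
  have f': "ip (f y) x = ip y (T x)" if "x \<in> X" "y \<in> X" for x y
    using f(2)[OF that] ip_commute[of "T x" y] ip_commute[of x "f y"] f(1) that op_in[OF T] by simp
  have "restrict f X \<in> bops"
  proof (rule bopsI[where K = K])
    fix x y assume xy: "x \<in> X" "y \<in> X"
    have "f (x + y) = f x + f y"
      by (rule eq_if_ip_eq) (use f f' xy T in \<open>auto simp: ip_simps op_in\<close>)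
    then show "restrict f X (x + y) = restrict f X x + restrict f X y" using xy by simp
  next
    fix c x assume x: "x \<in> X"
    have "f (sc c x) = sc c (f x)"
      by (rule eq_if_ip_eq) (use f f' x T in \<open>auto simp: ip_simps op_in\<close>)
    then show "restrict f X (sc c x) = sc c (restrict f X x)" using x by simp
  next
    fix x assume x: "x \<in> X"
    have "nm (f x) \<le> K * nm x"
    proof (rule nm_le_if_ip_le)
      fix y assume y: "y \<in> X"
      have "cmod (ip (f x) y) \<le> nm x * nm (T y)"
        unfolding f'[OF y x] by (rule Cauchy_Schwarz) (use T x y in auto)
      also have "\<dots> \<le> nm x * (K * nm y)" using K x y by (intro mult_left_mono) auto
      finally show "cmod (ip (f x) y) \<le> K * nm x * nm y" by (simp add: mult_ac)
    qed (use f K x in auto)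
    then show "nm (restrict f X x) \<le> K * nm x" using x by simp
  qed (use f in auto)
  then show ?thesis
    using f by (intro bexI[of _ "restrict f X"]) (auto simp: adjoint_pair_def)
qed

text \<open>Being in \<open>bops\<close>, the chosen operator is extensional, hence unique.\<close>

definition adj :: "('v \<Rightarrow> 'v) \<Rightarrow> 'v \<Rightarrow> 'v" where
  "adj T = (SOME S. S \<in> bops \<and> adjoint_pair H T S)"

lemma
  assumes "T \<in> bops"
  shows adj_in [simp, intro]: "adj T \<in> bops" and adj_pair: "adjoint_pair H T (adj T)"
  using someI_ex[of "\<lambda>S. S \<in> bops \<and> adjoint_pair H T S"] adjoint_exists[OF assms]
  unfolding adj_def by auto

lemma ip_adj_right: "T \<in> bops \<Longrightarrow> x \<in> X \<Longrightarrow> y \<in> X \<Longrightarrow> ip x (adj T y) = ip (T x) y"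
  using adj_pair[of T] unfolding adjoint_pair_def by simp

lemma ip_adj_left: "T \<in> bops \<Longrightarrow> x \<in> X \<Longrightarrow> y \<in> X \<Longrightarrow> ip (adj T x) y = ip x (T y)"
  using ip_adj_right[of T y x] ip_commute[of y "adj T x"] ip_commute[of "T y" x] by (auto simp: op_in adj_in)

lemma adj_unique:
  assumes "T \<in> bops" "S \<in> bops" "\<And>x y. x \<in> X \<Longrightarrow> y \<in> X \<Longrightarrow> ip (T x) y = ip x (S y)"
  shows "adj T = S"
proof (rule op_eqI)
  fix y assume y: "y \<in> X"
  show "adj T y = S y"
  proof (rule eq_if_ip_eq)
    fix z assume z: "z \<in> X"
    show "ip (adj T y) z = ip (S y) z"
      using ip_adj_left[OF assms(1) y z] assms(3)[OF z y] ip_commute[of "S y" z] ip_commute[of "T z" y]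
        op_in[OF assms(1) z] op_in[OF assms(2) y] y z by simp
  qed (use assms y in auto)
qed (use assms in auto)

lemma adj_pair_eq: "T \<in> bops \<Longrightarrow> S \<in> bops \<Longrightarrow> adjoint_pair H T S \<Longrightarrow> adj T = S"
  by (rule adj_unique) (auto simp: adjoint_pair_def)

lemma adj_adj: "T \<in> bops \<Longrightarrow> adj (adj T) = T"
  by (rule adj_unique) (auto simp: ip_adj_left)

section \<open>Commutants\<close>

abbreviation "comm \<equiv> commutant H"

lemma comm_bops: "T \<in> comm Y \<Longrightarrow> T \<in> bops"
  by (simp add: commutant_def)

lemma comm_apply: "T \<in> comm Y \<Longrightarrow> S \<in> Y \<Longrightarrow> x \<in> X \<Longrightarrow> T (S x) = S (T x)"
proof -
  assume T: "T \<in> comm Y" and S: "S \<in> Y" and x: "x \<in> X"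
  then have "compose X T S = compose X S T" unfolding commutant_def by blast
  then have "compose X T S x = compose X S T x" by (rule fun_cong)
  then show ?thesis using x by simp
qed

lemma comm_in: "T \<in> comm Y \<Longrightarrow> x \<in> X \<Longrightarrow> T x \<in> X"
  using comm_bops op_in by blast

lemma commI: "T \<in> bops \<Longrightarrow> (\<And>S x. S \<in> Y \<Longrightarrow> x \<in> X \<Longrightarrow> T (S x) = S (T x)) \<Longrightarrow> T \<in> comm Y"
  unfolding commutant_def by (auto simp: compose_def fun_eq_iff restrict_def)

lemma comm_plus: "S \<in> comm Y \<Longrightarrow> T \<in> comm Y \<Longrightarrow> Y \<subseteq> bops \<Longrightarrow> op_plus H S T \<in> comm Y"
  by (rule commI) (auto dest: comm_bops simp: comm_apply comm_in op_in subset_iff op_add)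

lemma comm_compose: "S \<in> comm Y \<Longrightarrow> T \<in> comm Y \<Longrightarrow> Y \<subseteq> bops \<Longrightarrow> compose X S T \<in> comm Y"
  by (rule commI) (auto dest: comm_bops simp: comm_apply op_in subset_iff)

lemma comm_scalar: "Y \<subseteq> bops \<Longrightarrow> scalar_op H c \<in> comm Y"
  by (rule commI) (auto simp: op_in subset_iff op_scale)

lemma comm_minus: "S \<in> comm Y \<Longrightarrow> T \<in> comm Y \<Longrightarrow> Y \<subseteq> bops \<Longrightarrow> op_minus H S T \<in> comm Y"
  by (rule commI) (auto dest: comm_bops simp: comm_apply comm_in op_in subset_iff op_diff)

lemma comm_subset: "comm Y \<subseteq> bops"
  using comm_bops by blast

lemma subset_comm_comm: "Y \<subseteq> bops \<Longrightarrow> Y \<subseteq> comm (comm Y)"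
  by (auto intro!: commI simp: comm_apply subset_iff)

lemma comm_antimono: "Y \<subseteq> Z \<Longrightarrow> comm Z \<subseteq> comm Y"
  unfolding commutant_def by blast

lemma comm_comm_comm: "Y \<subseteq> bops \<Longrightarrow> comm (comm (comm Y)) = comm Y"
  using comm_antimono[OF subset_comm_comm] subset_comm_comm[OF comm_subset] by blast

lemma comm_adj:
  assumes Y: "Y \<subseteq> bops" "\<And>S. S \<in> Y \<Longrightarrow> adj S \<in> Y" and T: "T \<in> comm Y"
  shows "adj T \<in> comm Y"
proof (rule commI)
  note Tb = comm_bops[OF T]
  fix S x assume S: "S \<in> Y" and x: "x \<in> X"
  have Sb: "S \<in> bops" using S Y by blast
  show "adj T (S x) = S (adj T x)"
  proof (rule eq_if_ip_eq)
    fix y assume y: "y \<in> X"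
    have "ip (adj T (S x)) y = ip (S x) (T y)"
      by (rule ip_adj_left) (use Tb Sb x y in auto)
    also have "\<dots> = ip x (adj S (T y))"
      by (rule ip_adj_right[symmetric]) (use Tb Sb x y in auto)
    also have "adj S (T y) = T (adj S y)"
      using comm_apply[OF T Y(2)[OF S] y] by simp
    also have "ip x (T (adj S y)) = ip (adj T x) (adj S y)"
      by (rule ip_adj_left[symmetric]) (use Tb Sb x y in auto)
    also have "\<dots> = ip (S (adj T x)) y"
      by (rule ip_adj_right) (use Tb Sb x y in auto)
    finally show "ip (adj T (S x)) y = ip (S (adj T x)) y" .
  qed (use Tb Sb x in auto)
qed (use comm_bops[OF T] in auto)

lemma von_neumann_algebra_comm:
  assumes "Y \<subseteq> bops" "\<And>S. S \<in> Y \<Longrightarrow> adj S \<in> Y"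
  shows "von_neumann_algebra H (comm Y)"
  unfolding von_neumann_algebra_def
proof (intro conjI ballI)
  fix T assume T: "T \<in> comm Y"
  show "\<exists>S\<in>comm Y. adjoint_pair H T S"
    using comm_adj[OF assms T] adj_pair[OF comm_bops[OF T]] by blast
qed (rule comm_subset comm_comm_comm[OF assms(1)])+

lemma vna_adj: "von_neumann_algebra H M \<Longrightarrow> T \<in> M \<Longrightarrow> adj T \<in> M"
proof -
  assume M: "von_neumann_algebra H M" and T: "T \<in> M"
  then obtain S where S: "S \<in> M" "adjoint_pair H T S"
    unfolding von_neumann_algebra_def by blast
  moreover have "T \<in> bops" "S \<in> bops" using M T S unfolding von_neumann_algebra_def by blast+
  ultimately show ?thesis using adj_pair_eq by simp
qed

section \<open>Projections\<close>

lemma orthogonal_projection_unique: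
  assumes sub: "vs.subspace W" and WX: "W \<subseteq> X" and x: "x \<in> X"
    and v: "v \<in> W" "\<forall>y\<in>W. ip y (x - v) = 0" and w: "w \<in> W" "\<forall>y\<in>W. ip y (x - w) = 0"
  shows "v = w"
proof -
  have d: "v - w \<in> W" using v w vs.subspace_diff[OF sub] by blast
  have "ip (v - w) (x - w) - ip (v - w) (x - v) = 0"
    using w(2) v(2) d by simp
  moreover have "ip (v - w) (x - w) - ip (v - w) (x - v) = ip (v - w) (v - w)"
    using d x w(1) v(1) WX by (simp add: ip_simps subset_iff)
  ultimately show ?thesis using ip_self_eq0[of "v - w"] d WX by auto
qed

definition projects_onto :: "('v \<Rightarrow> 'v) \<Rightarrow> 'v set \<Rightarrow> bool" where
  "projects_onto P W \<longleftrightarrow> P \<in> bops \<and> (\<forall>x\<in>X. P x \<in> W \<and> (\<forall>y\<in>W. ip y (x - P x) = 0))"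

lemma projects_ontoD:
  assumes "projects_onto P W"
  shows "P \<in> bops" "x \<in> X \<Longrightarrow> P x \<in> W" "x \<in> X \<Longrightarrow> y \<in> W \<Longrightarrow> ip y (x - P x) = 0"
  using assms unfolding projects_onto_def by auto

lemma projection_op:
  assumes W: "closed_subspace W"
  obtains P where "projects_onto P W"
proof -
  have WX: "W \<subseteq> X" and sub: "vs.subspace W" using W unfolding closed_subspace_def by auto
  have "\<forall>x. \<exists>w. x \<in> X \<longrightarrow> w \<in> W \<and> (\<forall>y\<in>W. ip y (x - w) = 0)"
    using projection[OF W] by blast
  from choice[OF this] obtain f where f0: "\<forall>x. x \<in> X \<longrightarrow> f x \<in> W \<and> (\<forall>y\<in>W. ip y (x - f x) = 0)"
    by blast
  then have f: "\<And>x. x \<in> X \<Longrightarrow> f x \<in> W" and orth: "\<And>x y. x \<in> X \<Longrightarrow> y \<in> W \<Longrightarrow> ip y (x - f x) = 0"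
    by simp_all
  have fX: "f x \<in> X" if "x \<in> X" for x using f[OF that] WX by blast
  have uniq: "f x = w" if x: "x \<in> X" and w: "w \<in> W" "\<forall>y\<in>W. ip y (x - w) = 0" for x w
    by (rule orthogonal_projection_unique[OF sub WX x]) (use f orth x w in auto)
  have "restrict f X \<in> bops"
  proof (rule bopsI[where K = 1])
    fix x y assume xy: "x \<in> X" "y \<in> X"
    have "f (x + y) = f x + f y"
    proof (rule uniq, simp_all add: xy f vs.subspace_add[OF sub], rule ballI)
      fix z assume z: "z \<in> W"
      then have zX: "z \<in> X" using WX by blast
      have "ip z (x - f x) + ip z (y - f y) = 0" using orth xy z by simp
      then show "ip z (x + y - (f x + f y)) = 0"
        using xy fX zX by (simp add: ip_simps algebra_simps)
    qed
    then show "restrict f X (x + y) = restrict f X x + restrict f X y" using xy by simp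
  next
    fix c x assume x: "x \<in> X"
    have "f (sc c x) = sc c (f x)"
    proof (rule uniq, simp_all add: x f vs.subspace_scale[OF sub], rule ballI)
      fix z assume z: "z \<in> W"
      then have zX: "z \<in> X" using WX by blast
      have "cnj c * ip z (x - f x) = 0" using orth x z by simp
      then show "ip z (sc c x - sc c (f x)) = 0"
        using x fX zX by (simp add: ip_simps algebra_simps)
    qed
    then show "restrict f X (sc c x) = sc c (restrict f X x)" using x by simp
  next
    fix x assume x: "x \<in> X"
    have "(nm (f x))\<^sup>2 = Re (ip (f x) x)"
      using orth[OF x f[OF x]] x fX[OF x] by (simp add: ip_simps nm_sq)
    also have "\<dots> \<le> nm (f x) * nm x" by (rule Re_ip_le) (use x fX in auto)
    finally have "nm (f x) \<le> nm x"
      using x fX[OF x] by - (rule square_le_mult_imp_le; auto)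
    then show "nm (restrict f X x) \<le> 1 * nm x" using x by simp
  qed (use fX in auto)
  then have "projects_onto (restrict f X) W"
    unfolding projects_onto_def using f orth by simp
  then show ?thesis using that by blast
qed

lemma projects_onto_eq:
  assumes W: "closed_subspace W" and P: "projects_onto P W"
    and x: "x \<in> X" and w: "w \<in> W" "\<forall>y\<in>W. ip y (x - w) = 0"
  shows "P x = w"
  by (rule orthogonal_projection_unique[of W x])
    (use W P x w in \<open>auto simp: closed_subspace_def projects_onto_def\<close>)

lemma projects_onto_fix:
  "closed_subspace W \<Longrightarrow> projects_onto P W \<Longrightarrow> w \<in> W \<Longrightarrow> P w = w"
  by (rule projects_onto_eq) (auto simp: closed_subspace_def)

lemma projects_onto_form:
  assumes W: "closed_subspace W" and P: "projects_onto P W" and x: "x \<in> X"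
  shows "ip (P x) x = complex_of_real ((nm (P x))\<^sup>2)"
proof -
  have Px: "P x \<in> X" "P x \<in> W" using projects_ontoD[OF P] x by auto
  have "ip (P x) (x - P x) = 0" by (rule projects_ontoD[OF P]) fact+
  then show ?thesis using Px x by (simp add: ip_simps ip_nm_sq)
qed

lemma projects_onto_positive:
  assumes "closed_subspace W" "projects_onto P W"
  shows "positive_op H P"
  unfolding positive_op_def using projects_onto_form[OF assms] projects_ontoD(1)[OF assms(2)] by simp

text \<open>\<open>T\<close> preserves the orthogonal complement of \<open>W\<close> because its
  adjoint preserves \<open>W\<close>; so \<open>T (P x)\<close> has the defining property of the
  projection of \<open>T x\<close>.\<close>

lemma projects_onto_comm:
  assumes W: "closed_subspace W" and P: "projects_onto P W" and T: "T \<in> bops"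
    and inv: "\<And>x. x \<in> W \<Longrightarrow> T x \<in> W" "\<And>x. x \<in> W \<Longrightarrow> adj T x \<in> W"
    and x: "x \<in> X"
  shows "P (T x) = T (P x)"
proof (rule projects_onto_eq[OF W P])
  have WX: "W \<subseteq> X" using W unfolding closed_subspace_def by auto
  note Pb = projects_ontoD(1)[OF P]
  show "\<forall>y\<in>W. ip y (T x - T (P x)) = 0"
  proof
    fix y assume y: "y \<in> W"
    have "ip y (T x - T (P x)) = ip y (T (x - P x))"
      using op_diff[OF T x op_in[OF Pb x]] by simp
    also have "\<dots> = ip (adj T y) (x - P x)"
      by (rule ip_adj_left[symmetric]) (use T y WX x Pb in auto)
    also have "\<dots> = 0" using projects_ontoD(3)[OF P] inv y x by blast
    finally show "ip y (T x - T (P x)) = 0" .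
  qed
qed (use T projects_ontoD[OF P] inv x in auto)

definition hclosure :: "'v set \<Rightarrow> 'v set" where
  "hclosure W = {x \<in> X. \<forall>e>0. \<exists>w\<in>W. nm (x - w) < e}"

lemma hclosureD: "x \<in> hclosure W \<Longrightarrow> 0 < e \<Longrightarrow> \<exists>w\<in>W. nm (x - w) < e"
  unfolding hclosure_def by blast

lemma hclosure_in: "x \<in> hclosure W \<Longrightarrow> x \<in> X"
  unfolding hclosure_def by blast

lemma hclosure_superset: "W \<subseteq> X \<Longrightarrow> W \<subseteq> hclosure W"
proof
  fix x assume "W \<subseteq> X" "x \<in> W"
  then show "x \<in> hclosure W" unfolding hclosure_def by (auto intro!: bexI[of _ x])
qed

lemma closed_subspace_hclosure:
  assumes sub: "vs.subspace W" and WX: "W \<subseteq> X"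
  shows "closed_subspace (hclosure W)"
  unfolding closed_subspace_def
proof (intro conjI allI impI)
  show "hclosure W \<subseteq> X" unfolding hclosure_def by blast
  show "vs.subspace (hclosure W)"
  proof (rule vs.subspaceI)
    show "0 \<in> hclosure W" using hclosure_superset[OF WX] vs.subspace_0[OF sub] by blast
  next
    fix x y assume xy: "x \<in> hclosure W" "y \<in> hclosure W"
    have "\<exists>w\<in>W. nm (x + y - w) < e" if e: "e > 0" for e
    proof -
      obtain v w where vw: "v \<in> W" "w \<in> W" "nm (x - v) < e/2" "nm (y - w) < e/2"
        using hclosureD[OF xy(1), of "e/2"] hclosureD[OF xy(2), of "e/2"] e by auto
      have "nm ((x - v) + (y - w)) \<le> nm (x - v) + nm (y - w)"
        by (rule nm_triangle) (use xy vw WX in \<open>auto dest: hclosure_in\<close>)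
      then show ?thesis
        using vw vs.subspace_add[OF sub vw(1,2)] by - (rule bexI[of _ "v + w"]; simp add: algebra_simps)
    qed
    then show "x + y \<in> hclosure W" using xy unfolding hclosure_def by auto
  next
    fix c x assume x: "x \<in> hclosure W"
    have "\<exists>w\<in>W. nm (sc c x - w) < e" if e: "e > 0" for e
    proof -
      have "e / (cmod c + 1) > 0" using e by (simp add: add_nonneg_pos)
      then obtain w where w: "w \<in> W" "nm (x - w) < e / (cmod c + 1)"
        using x unfolding hclosure_def by blast
      have xw: "x - w \<in> X" using x w WX unfolding hclosure_def by auto
      have "nm (sc c x - sc c w) = cmod c * nm (x - w)"
        using nm_scale[OF xw] by (simp add: vs.scale_right_diff_distrib)
      also have "\<dots> \<le> (cmod c + 1) * nm (x - w)" using xw by (intro mult_right_mono) auto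
      also have "\<dots> < e" using w(2) by (simp add: pos_less_divide_eq add_nonneg_pos mult.commute)
      finally show ?thesis using vs.subspace_scale[OF sub w(1)] by blast
    qed
    then show "sc c x \<in> hclosure W" using x unfolding hclosure_def by auto
  qed
next
  fix u x assume *: "(\<forall>k::nat. u k \<in> hclosure W) \<and> x \<in> X \<and> (\<lambda>k. nm (u k - x)) \<longlonglongrightarrow> 0"
  have "\<exists>w\<in>W. nm (x - w) < e" if e: "e > 0" for e
  proof -
    have "\<forall>\<^sub>F k in sequentially. nm (u k - x) < e/2"
      using * e by (intro order_tendstoD(2)[of _ 0]) auto
    then obtain k where k: "nm (u k - x) < e/2" by (auto simp: eventually_sequentially)
    obtain w where w: "w \<in> W" "nm (u k - w) < e/2"
      using hclosureD[of "u k" W "e/2"] * e by auto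
    have uk: "u k \<in> X" using * unfolding hclosure_def by blast
    have "nm (x - w) \<le> nm (x - u k) + nm (u k - w)"
      by (rule nm_triangle_via) (use uk w WX * in auto)
    also have "\<dots> < e" using k w nm_diff_commute[of x "u k"] uk * by simp
    finally show ?thesis using w by blast
  qed
  then show "x \<in> hclosure W" using * unfolding hclosure_def by blast
qed

section \<open>Positive operators\<close>

abbreviation form :: "('v \<Rightarrow> 'v) \<Rightarrow> 'v \<Rightarrow> real" where
  "form T x \<equiv> Re (ip (T x) x)"

lemma positive_op_bops: "positive_op H T \<Longrightarrow> T \<in> bops"
  unfolding positive_op_def by blast

lemma positive_op_form:
  assumes "positive_op H T" "x \<in> X"
  shows "0 \<le> form T x" "ip (T x) x = complex_of_real (form T x)"
  using assms unfolding positive_op_def by (auto simp: complex_nonneg_Reals_iff complex_eq_iff)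

lemma positive_op_Im: "positive_op H T \<Longrightarrow> x \<in> X \<Longrightarrow> Im (ip (T x) x) = 0"
  unfolding positive_op_def by (simp add: complex_nonneg_Reals_iff)

lemma positive_opI:
  assumes "T \<in> bops" "\<And>x. x \<in> X \<Longrightarrow> \<exists>r\<ge>0. ip (T x) x = complex_of_real r"
  shows "positive_op H T"
  unfolding positive_op_def
proof (intro conjI ballI)
  fix x assume "x \<in> X"
  then obtain r where "r \<ge> 0" "ip (T x) x = complex_of_real r" using assms(2) by blast
  then show "ip (T x) x \<in> \<real>\<^sub>\<ge>\<^sub>0" by simp
qed (rule assms)

text \<open>Polarization: the diagonal values at \<open>x + y\<close> and at
  \<open>x + \<i> y\<close> are real, which settles the imaginary and the real part.\<close>

lemma positive_op_sym:
  assumes T: "positive_op H T" and x: "x \<in> X" and y: "y \<in> X"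
  shows "ip (T x) y = ip x (T y)"
proof -
  note Tb = positive_op_bops[OF T]
  have 0: "Im (ip (T z) z) = 0" if "z \<in> X" for z
    using positive_op_Im[OF T that] .
  have 1: "Im (ip (T x) y) + Im (ip (T y) x) = 0"
    using 0[of "x + y"] 0[of x] 0[of y] x y Tb by (simp add: ip_simps op_add op_in)
  have "Im (cnj \<i> * ip (T x) y + \<i> * ip (T y) x) = 0"
    using 0[of "x + sc \<i> y"] 0[of x] 0[of y] x y Tb by (simp add: ip_simps op_add op_scale op_in)
  with 1 have "ip (T x) y = cnj (ip (T y) x)" by (simp add: complex_eq_iff)
  then show ?thesis using ip_commute[OF op_in[OF Tb y] x] by simp
qed

lemma op_leI:
  assumes "positive_op H S" "positive_op H T" "\<And>x. x \<in> X \<Longrightarrow> form S x \<le> form T x"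
  shows "op_le H S T"
  unfolding op_le_def
proof (rule positive_opI)
  note b = assms(1,2)[THEN positive_op_bops]
  fix x assume x: "x \<in> X"
  have "ip (op_minus H T S x) x = complex_of_real (form T x - form S x)"
    using x b positive_op_Im[OF assms(1) x] positive_op_Im[OF assms(2) x]
    by (simp add: ip_simps complex_eq_iff)
  then show "\<exists>r\<ge>0. ip (op_minus H T S x) x = complex_of_real r"
    using assms(3)[OF x] by (metis diff_ge_0_iff_ge)
qed (use assms positive_op_bops in auto)

lemma op_leD: "op_le H S T \<Longrightarrow> S \<in> bops \<Longrightarrow> T \<in> bops \<Longrightarrow> x \<in> X \<Longrightarrow> form S x \<le> form T x"
  unfolding op_le_def using positive_op_form(1)[of "op_minus H T S" x] by (simp add: ip_simps op_in)

text \<open>Lax-Milgram for \<open>1 + s\<close>, whose inverse is \<open>r\<close>. The clause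
  about \<open>Y\<close>, taken at the commutant of a von Neumann algebra that contains
  \<open>s\<close>, puts \<open>r\<close> into that algebra.\<close>

lemma resolvent:
  assumes s: "positive_op H s"
  shows "\<exists>r\<in>bops. (\<forall>x\<in>X. r x + s (r x) = x) \<and> (\<forall>Y. s \<in> comm Y \<longrightarrow> Y \<subseteq> bops \<longrightarrow> r \<in> comm Y)"
proof -
  note sb = positive_op_bops[OF s]
  let ?A = "\<lambda>x. x + s x"
  have ge: "(nm x)\<^sup>2 \<le> Re (ip (?A x) x)" if "x \<in> X" for x
    using positive_op_form(1)[OF s that] that sb by (simp add: ip_simps nm_sq op_in)
  have inj: "x = y" if "x \<in> X" "y \<in> X" "?A x = ?A y" for x y
  proof -
    have "?A (x - y) = 0" using that sb by (simp add: op_diff algebra_simps)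
    then show ?thesis using ge[of "x - y"] that by simp
  qed
  have ex: "\<exists>y\<in>X. ?A y = x" if x: "x \<in> X" for x
  proof -
    obtain K where K: "0 \<le> K" "\<And>x. x \<in> X \<Longrightarrow> nm (s x) \<le> K * nm x"
      using op_bound[OF sb] by metis
    have bd: "nm (y + s y) \<le> (1 + K) * nm y" if "y \<in> X" for y
      using nm_triangle[of y "s y"] K(2)[OF that] that sb by (simp add: op_in distrib_right)
    obtain y where y: "y \<in> X" "\<And>z. z \<in> X \<Longrightarrow> ip z x = ip z (?A y)"
    proof (rule lax_milgram[of ?A "1 + K" "\<lambda>z. ip z x" "nm x"])
      show "cmod (ip z x) \<le> nm x * nm z" if "z \<in> X" for z
        using Cauchy_Schwarz[OF that x] by (simp add: mult.commute)
      show "ip (?A y) z = ip y (?A z)" if "y \<in> X" "z \<in> X" for y z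
        using that sb positive_op_sym[OF s that] by (simp add: ip_simps)
    qed (use x sb bd ge in \<open>simp_all add: op_add op_scale vs.scale_right_distrib ip_simps\<close>)
    have "x = ?A y"
    proof (rule eq_if_ip_eq)
      fix z assume z: "z \<in> X"
      show "ip x z = ip (?A y) z" 
        using y(2)[OF z] y(1) z x sb ip_commute[of z x] ip_commute[of z "?A y"] by (simp add: op_in)
    qed (use x y sb in auto)
    then show ?thesis using y by auto
  qed
  then have "\<forall>x\<in>X. \<exists>y. y \<in> X \<and> ?A y = x" by blast
  from bchoice[OF this] obtain f where "\<forall>x\<in>X. f x \<in> X \<and> ?A (f x) = x" by blast
  then have f: "\<And>x. x \<in> X \<Longrightarrow> f x \<in> X" "\<And>x. x \<in> X \<Longrightarrow> ?A (f x) = x" by simp_all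
  define r where "r = restrict f X"
  have r: "\<And>x. x \<in> X \<Longrightarrow> r x \<in> X" "\<And>x. x \<in> X \<Longrightarrow> r x + s (r x) = x" using f r_def by auto
  have "nm (r x) \<le> nm x" if x: "x \<in> X" for x
  proof -
    have "(nm (r x))\<^sup>2 \<le> nm (r x) * nm x"
      using ge[of "r x"] Re_ip_le[of x "r x"] r x by (simp add: mult.commute)
    then show ?thesis
      using x r(1)[OF x] by - (rule square_le_mult_imp_le; auto)
  qed
  then have "r \<in> bops"
  proof (intro bopsI[where K = 1])
    fix x y assume xy: "x \<in> X" "y \<in> X"
    have "?A (r x + r y) = (r x + s (r x)) + (r y + s (r y))"
      using xy r(1) op_add[OF sb, of "r x" "r y"] by (simp add: algebra_simps)
    then show "r (x + y) = r x + r y"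
      using xy r by - (rule inj; auto)
  next
    fix c x assume x: "x \<in> X"
    have "?A (sc c (r x)) = sc c (r x + s (r x))"
      using x r(1) op_scale[OF sb, of "r x"] by (simp add: vs.scale_right_distrib)
    then show "r (sc c x) = sc c (r x)"
      using x r by - (rule inj; auto)
  qed (use r in \<open>auto simp: r_def\<close>)
  moreover have "r \<in> comm Y" if sY: "s \<in> comm Y" and Y: "Y \<subseteq> bops" for Y
  proof (rule commI)
    fix S x assume S: "S \<in> Y" and x: "x \<in> X"
    have Sb: "S \<in> bops" using S Y by blast
    have "?A (S (r x)) = S (r x + s (r x))"
      using x r(1) comm_apply[OF sY S, of "r x"] op_add[OF Sb, of "r x" "s (r x)"] sb by simp
    then show "r (S x) = S (r x)"
      using x r Sb by - (rule inj; auto)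
  qed fact
  ultimately show ?thesis using r(2) by (intro bexI[of _ r]) auto
qed

text \<open>The quadratic form of \<open>(1 + s)\<^sup>-\<^sup>1\<close> is the maximum over \<open>z\<close> of the left hand side below,
  which makes \<open>s \<mapsto> (1 + s)\<^sup>-\<^sup>1\<close> antitone.\<close>

lemma resolvent_form_ge:
  assumes s: "positive_op H s" and r: "r \<in> bops" "\<And>x. x \<in> X \<Longrightarrow> r x + s (r x) = x"
    and x: "x \<in> X" and z: "z \<in> X"
  shows "2 * Re (ip x z) - (nm z)\<^sup>2 - form s z \<le> form r x"
proof -
  note sb = positive_op_bops[OF s]
  define y where "y = r x"
  have y: "y \<in> X" "x = y + s y" using r x unfolding y_def by auto
  have "0 \<le> (nm (y - z))\<^sup>2 + form s (y - z)"
    using positive_op_form(1)[OF s, of "y - z"] y z by simp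
  also have "\<dots> = ((nm y)\<^sup>2 + form s y) - (2 * Re (ip y z) + 2 * Re (ip (s y) z) - (nm z)\<^sup>2 - form s z)"
    using y(1) z sb Re_ip_commute[of "s z" y] positive_op_sym[OF s z y(1)] Re_ip_commute[of "s y" z]
    by (simp add: nm_diff_sq op_diff ip_simps op_in)
  also have "(nm y)\<^sup>2 + form s y = Re (ip y (y + s y))"
    using y(1) sb Re_ip_commute[of "s y" y] by (simp add: ip_simps nm_sq)
  also have "\<dots> = form r x" by (simp flip: y(2)) (simp add: y_def)
  finally show ?thesis using y sb z by (simp add: ip_simps op_in)
qed

lemma resolvent_form:
  assumes s: "positive_op H s" and r: "r \<in> bops" "\<And>x. x \<in> X \<Longrightarrow> r x + s (r x) = x" and x: "x \<in> X"
  shows "ip (r x) x = complex_of_real ((nm (r x))\<^sup>2 + form s (r x))"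
proof -
  define y where "y = r x"
  have y: "y \<in> X" "x = y + s y" using r x unfolding y_def by auto
  have "ip y (s y) = complex_of_real (form s y)"
    by (rule trans[OF positive_op_sym[OF s y(1) y(1), symmetric] positive_op_form(2)[OF s y(1)]])
  then have "ip y (y + s y) = complex_of_real ((nm y)\<^sup>2 + form s y)"
    using y(1) positive_op_bops[OF s] by (simp add: ip_simps ip_nm_sq)
  then show ?thesis by (simp flip: y(2)) (simp add: y_def)
qed

lemma resolvent_positive:
  assumes s: "positive_op H s" and r: "r \<in> bops" "\<And>x. x \<in> X \<Longrightarrow> r x + s (r x) = x"
  shows "positive_op H r"
proof (rule positive_opI[OF r(1)])
  fix x assume x: "x \<in> X"
  have "0 \<le> (nm (r x))\<^sup>2 + form s (r x)"
    using positive_op_form(1)[OF s, of "r x"] r(1) x by auto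
  then show "\<exists>t\<ge>0. ip (r x) x = complex_of_real t"
    using resolvent_form[OF s r x] by blast
qed

text \<open>The variational bound for \<open>s'\<close> is attained at \<open>z = r' x\<close>;
  replacing \<open>s'\<close> by the smaller \<open>s\<close> at this \<open>z\<close> can only
  raise the left hand side.\<close>

lemma resolvent_antitone:
  assumes s: "positive_op H s" and r: "r \<in> bops" "\<And>x. x \<in> X \<Longrightarrow> r x + s (r x) = x"
    and s': "positive_op H s'" and r': "r' \<in> bops" "\<And>x. x \<in> X \<Longrightarrow> r' x + s' (r' x) = x"
    and le: "\<And>x. x \<in> X \<Longrightarrow> form s x \<le> form s' x" and x: "x \<in> X"
  shows "form r' x \<le> form r x"
proof -
  have y: "r' x \<in> X" using op_in[OF r'(1) x] .
  have "form r' x = 2 * Re (ip (r' x) x) - (nm (r' x))\<^sup>2 - form s' (r' x)"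
    using resolvent_form[OF s' r' x] by simp
  also have "\<dots> \<le> 2 * Re (ip x (r' x)) - (nm (r' x))\<^sup>2 - form s (r' x)"
    using le[OF y] Re_ip_commute[OF x y] by simp
  also have "\<dots> \<le> form r x" by (rule resolvent_form_ge[OF s r x y])
  finally show ?thesis .
qed

end

section \<open>Finite traces\<close>

context hilb
begin

lemma adj_compose:
  assumes "S \<in> bops" "T \<in> bops"
  shows "adj (compose X S T) = compose X (adj T) (adj S)"
  by (rule adj_unique) (use assms in \<open>simp_all add: ip_adj_right compose_in\<close>)

lemma form_adj_compose:
  assumes "T \<in> bops" "x \<in> X"
  shows "ip (compose X (adj T) T x) x = complex_of_real ((nm (T x))\<^sup>2)"
  using assms by (simp add: ip_adj_left ip_nm_sq)

lemma adj_compose_positive: "T \<in> bops \<Longrightarrow> positive_op H (compose X (adj T) T)"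
proof (rule positive_opI)
  fix x assume "T \<in> bops" "x \<in> X"
  then show "\<exists>r\<ge>0. ip (compose X (adj T) T x) x = complex_of_real r"
    using form_adj_compose by (intro exI[of _ "(nm (T x))\<^sup>2"]) simp
qed auto

lemma resolvent_norm_le:
  assumes s: "positive_op H s" and r: "r \<in> bops" "\<And>x. x \<in> X \<Longrightarrow> r x + s (r x) = x" and x: "x \<in> X"
  shows "(nm (r x))\<^sup>2 \<le> form r x" "form r x \<le> nm (r x) * nm x" "nm (r x) \<le> nm x"
proof -
  have rx: "r x \<in> X" using op_in[OF r(1) x] .
  show 1: "(nm (r x))\<^sup>2 \<le> form r x"
    using resolvent_form[OF s r x] positive_op_form(1)[OF s rx] by simp
  show 2: "form r x \<le> nm (r x) * nm x" by (rule Re_ip_le[OF rx x])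
  have "(nm (r x))\<^sup>2 \<le> nm (r x) * nm x" using 1 2 by linarith
  then show "nm (r x) \<le> nm x" by (rule square_le_mult_imp_le) (use rx x in auto)
qed

end

section \<open>Von Neumann algebras and cyclic projections\<close>

locale vn_algebra = hilb H for H :: "'v::ab_group_add hspace" +
  fixes M :: "('v \<Rightarrow> 'v) set"
  assumes vna: "von_neumann_algebra H M"
begin

lemma M_bops: "T \<in> M \<Longrightarrow> T \<in> bops"
  using vna unfolding von_neumann_algebra_def by auto

lemma M_comm: "M = comm (comm M)"
  using vna unfolding von_neumann_algebra_def by simp

lemma M_compose: "S \<in> M \<Longrightarrow> T \<in> M \<Longrightarrow> compose X S T \<in> M"
  using comm_compose[OF _ _ comm_subset, of S M T] M_comm by simp

lemma M_plus: "S \<in> M \<Longrightarrow> T \<in> M \<Longrightarrow> op_plus H S T \<in> M"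
  using comm_plus[OF _ _ comm_subset, of S M T] M_comm by simp

lemma M_minus: "S \<in> M \<Longrightarrow> T \<in> M \<Longrightarrow> op_minus H S T \<in> M"
  using comm_minus[OF _ _ comm_subset, of S M T] M_comm by simp

lemma M_scalar: "scalar_op H c \<in> M"
  using comm_scalar[OF comm_subset, of c M] M_comm by simp

lemma M_adj: "T \<in> M \<Longrightarrow> adj T \<in> M"
  using vna_adj[OF vna] .

lemma pos_partI: "T \<in> M \<Longrightarrow> positive_op H T \<Longrightarrow> T \<in> pos_part H M"
  unfolding pos_part_def by simp

lemma pos_partD: "T \<in> pos_part H M \<Longrightarrow> T \<in> M" "T \<in> pos_part H M \<Longrightarrow> positive_op H T"
  unfolding pos_part_def by simp_all

text \<open>Its closure is the cyclic subspace of \<open>p\<close> under the commutant; the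
  projection onto it is the smallest projection of \<open>M\<close> that fixes
  \<open>p\<close>.\<close>

definition orbit :: "'v \<Rightarrow> 'v set" where
  "orbit p = (\<lambda>T. T p) ` comm M"

lemma M_subset: "M \<subseteq> bops"
  using M_bops by blast

lemma orbit_subset: "p \<in> X \<Longrightarrow> orbit p \<subseteq> X"
  unfolding orbit_def using comm_in by blast

lemma subspace_orbit:
  assumes p: "p \<in> X"
  shows "vs.subspace (orbit p)"
  proof (rule vs.subspaceI)
    show "0 \<in> orbit p" unfolding orbit_def
      by (rule image_eqI[of _ _ "scalar_op H 0"]) (use p comm_scalar[OF M_subset] in auto)
    show "x + y \<in> orbit p" if x: "x \<in> orbit p" and y: "y \<in> orbit p" for x y
    proof -
      obtain S where S: "x = S p" "S \<in> comm M" using x unfolding orbit_def by (rule imageE)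
      obtain T where T: "y = T p" "T \<in> comm M" using y unfolding orbit_def by (rule imageE)
      show ?thesis using S T unfolding orbit_def
        by (intro image_eqI[of _ _ "op_plus H S T"]) (use p comm_plus[OF _ _ M_subset] in auto)
    qed
    show "sc c x \<in> orbit p" if x: "x \<in> orbit p" for c x
    proof -
      obtain S where S: "x = S p" "S \<in> comm M" using x unfolding orbit_def by (rule imageE)
      then show ?thesis unfolding orbit_def
        by (intro image_eqI[of _ _ "compose X (scalar_op H c) S"])
          (use p comm_compose[OF comm_scalar[OF M_subset] S(2) M_subset] comm_in[OF S(2) p] in auto)
    qed
  qed

lemma closed_subspace_orbit: "p \<in> X \<Longrightarrow> closed_subspace (hclosure (orbit p))"
  by (rule closed_subspace_hclosure[OF subspace_orbit orbit_subset])

text \<open>The cyclic subspace is invariant under the commutant, which is closed under adjoints. So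
  the projection commutes with the commutant and lies in \<open>M\<close> by the bicommutant
  property.\<close>

lemma orbit_projection:
  assumes p: "p \<in> X" and e: "projects_onto e (hclosure (orbit p))"
  shows "e \<in> pos_part H M" "e p = p"
proof -
  note W = closed_subspace_orbit[OF p] and eb = projects_ontoD(1)[OF e]
  have inv: "T x \<in> hclosure (orbit p)" if T: "T \<in> comm M" and x: "x \<in> hclosure (orbit p)" for T x
  proof -
    have Tb: "T \<in> bops" using comm_bops[OF T] .
    obtain K where K: "0 \<le> K" "\<And>x. x \<in> X \<Longrightarrow> nm (T x) \<le> K * nm x"
      using op_bound[OF Tb] by metis
    have xX: "x \<in> X" using hclosure_in[OF x] .
    have "\<exists>w\<in>orbit p. nm (T x - w) < d" if d: "d > 0" for d
    proof -
      have "0 < d / (K + 1)" using d K by simp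
      then obtain w where w: "w \<in> orbit p" "nm (x - w) < d / (K + 1)" using hclosureD[OF x] by blast
      have wX: "w \<in> X" using w orbit_subset[OF p] by blast
      obtain S where S: "w = S p" "S \<in> comm M" using w(1) unfolding orbit_def by (rule imageE)
      have "T w \<in> orbit p" unfolding orbit_def S(1)
        by (rule image_eqI[of _ _ "compose X T S"]) (use comm_compose[OF T S(2) M_subset] p in auto)
      moreover have "nm (T x - T w) \<le> K * nm (x - w)"
        using K(2)[of "x - w"] op_diff[OF Tb xX wX] xX wX by simp
      moreover have "K * nm (x - w) \<le> (K + 1) * nm (x - w)"
        using xX wX by (intro mult_right_mono) auto
      moreover have "(K + 1) * nm (x - w) < d"
        using w(2) K(1) by (simp add: pos_less_divide_eq mult.commute)
      ultimately show ?thesis by (intro bexI[of _ "T w"]) linarith+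
    qed
    then show ?thesis unfolding hclosure_def using Tb xX by auto
  qed
  have adjM: "adj T \<in> comm M" if "T \<in> comm M" for T
    by (rule comm_adj[OF M_subset _ that]) (rule M_adj)
  have "e \<in> comm (comm M)"
    by (rule commI[OF eb])
      (rule projects_onto_comm[OF W e], use inv adjM comm_bops in auto)
  then have eM: "e \<in> M" using M_comm by simp
  show "e \<in> pos_part H M"
    using pos_partI[OF eM projects_onto_positive[OF W e]] .
  have "p \<in> orbit p" unfolding orbit_def
    by (rule image_eqI[of _ _ "scalar_op H 1"]) (use p comm_scalar[OF M_subset] in auto)
  then show "e p = p"
    using projects_onto_fix[OF W e] hclosure_superset[OF orbit_subset[OF p]] by blast
qed

end

section \<open>The seminorm given by a finite trace\<close>

locale traced = vn_algebra H M for H :: "'v::ab_group_add hspace" and M +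
  fixes \<phi> :: "('v \<Rightarrow> 'v) \<Rightarrow> real"
  assumes trace: "finite_trace H M \<phi>"
begin

lemma
  shows trace_ge0: "T \<in> pos_part H M \<Longrightarrow> 0 \<le> \<phi> T"
    and trace_plus: "S \<in> pos_part H M \<Longrightarrow> T \<in> pos_part H M \<Longrightarrow> \<phi> (op_plus H S T) = \<phi> S + \<phi> T"
    and trace_scale: "0 \<le> c \<Longrightarrow> T \<in> pos_part H M \<Longrightarrow>
      \<phi> (compose X (scalar_op H (complex_of_real c)) T) = c * \<phi> T"
    and trace_commute: "T \<in> M \<Longrightarrow> S \<in> M \<Longrightarrow> adjoint_pair H T S \<Longrightarrow>
      \<phi> (compose X S T) = \<phi> (compose X T S)"
proof -
  note t = trace[unfolded finite_trace_def]
  show "T \<in> pos_part H M \<Longrightarrow> 0 \<le> \<phi> T"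
    using t[THEN conjunct1] by blast
  show "S \<in> pos_part H M \<Longrightarrow> T \<in> pos_part H M \<Longrightarrow> \<phi> (op_plus H S T) = \<phi> S + \<phi> T"
    using t[THEN conjunct2, THEN conjunct1] by blast
  show "0 \<le> c \<Longrightarrow> T \<in> pos_part H M \<Longrightarrow>
      \<phi> (compose X (scalar_op H (complex_of_real c)) T) = c * \<phi> T"
    using t[THEN conjunct2, THEN conjunct2, THEN conjunct1] by blast
  show "T \<in> M \<Longrightarrow> S \<in> M \<Longrightarrow> adjoint_pair H T S \<Longrightarrow> \<phi> (compose X S T) = \<phi> (compose X T S)"
    using t[THEN conjunct2, THEN conjunct2, THEN conjunct2] by blast
qed

text \<open>The square of the 2-seminorm of the trace. \<open>\<phi>\<close> is not assumed
  faithful, so it may vanish on nonzero operators.\<close>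

definition trace_norm2 :: "('v \<Rightarrow> 'v) \<Rightarrow> real" where
  "trace_norm2 T = \<phi> (compose X (adj T) T)"

lemma adj_compose_pos_part: "T \<in> M \<Longrightarrow> compose X (adj T) T \<in> pos_part H M"
  by (intro pos_partI M_compose M_adj adj_compose_positive M_bops)

lemma trace_norm2_ge0: "T \<in> M \<Longrightarrow> 0 \<le> trace_norm2 T"
  unfolding trace_norm2_def by (intro trace_ge0 adj_compose_pos_part)

lemma trace_norm2_adj: "T \<in> M \<Longrightarrow> trace_norm2 (adj T) = trace_norm2 T"
  unfolding trace_norm2_def
  using trace_commute[OF _ M_adj adj_pair] adj_adj M_bops by simp

text \<open>\<open>\<phi>\<close> is governed by its axioms on the positive part only and is not
  extended linearly. Collecting weighted terms \<open>T\<^sup>* T\<close> into a single positive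
  operator with known quadratic form is what turns inequalities between vector norms into
  inequalities between traces.\<close>

lemma gram_operator:
  assumes "finite I" "\<And>i. i \<in> I \<Longrightarrow> T i \<in> M" "\<And>i. i \<in> I \<Longrightarrow> 0 \<le> c i"
  shows "\<exists>Q\<in>pos_part H M. (\<forall>x\<in>X. form Q x = (\<Sum>i\<in>I. c i * (nm (T i x))\<^sup>2)) \<and>
    \<phi> Q = (\<Sum>i\<in>I. c i * trace_norm2 (T i))"
  using assms
proof (induction I rule: finite_induct)
  case empty
  let ?Z = "scalar_op H 0"
  have pos: "?Z \<in> pos_part H M" by (intro pos_partI M_scalar positive_opI) auto
  have "compose X (scalar_op H (complex_of_real 0)) ?Z = ?Z"
    by (rule op_eqI) auto
  \<comment> \<open>Homogeneity with factor 0 determines the value at the zero operator.\<close>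
  then have "\<phi> ?Z = 0" using trace_scale[of 0 ?Z] pos by simp
  then show ?case using pos by (intro bexI[of _ ?Z]) auto
next
  case (insert i I)
  obtain Q where Q: "Q \<in> pos_part H M" "\<forall>x\<in>X. form Q x = (\<Sum>i\<in>I. c i * (nm (T i x))\<^sup>2)"
    "\<phi> Q = (\<Sum>i\<in>I. c i * trace_norm2 (T i))"
    using insert.IH insert.prems by auto
  have T: "T i \<in> M" "0 \<le> c i" using insert.prems by auto
  note Tb = M_bops[OF T(1)] and Qb = M_bops[OF pos_partD(1)[OF Q(1)]]
  let ?A = "compose X (adj (T i)) (T i)"
  let ?P = "compose X (scalar_op H (complex_of_real (c i))) ?A"
  have A: "?A \<in> pos_part H M" by (rule adj_compose_pos_part[OF T(1)])
  have fP: "ip (?P x) x = complex_of_real (c i * (nm (T i x))\<^sup>2)" if x: "x \<in> X" for x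
    using x Tb by (simp add: ip_scale_left ip_adj_left ip_nm_sq)
  have P: "?P \<in> pos_part H M"
  proof (intro pos_partI M_compose M_scalar M_adj T(1) positive_opI)
    show "\<exists>r\<ge>0. ip (?P x) x = complex_of_real r" if "x \<in> X" for x
      using fP[OF that] T(2) by (intro exI[of _ "c i * (nm (T i x))\<^sup>2"]) simp
  qed (use Tb in auto)
  have "op_plus H ?P Q \<in> pos_part H M"
  proof (intro pos_partI M_plus positive_opI)
    show "\<exists>r\<ge>0. ip (op_plus H ?P Q x) x = complex_of_real r" if x: "x \<in> X" for x
    proof (intro exI conjI)
      show "ip (op_plus H ?P Q x) x = complex_of_real (c i * (nm (T i x))\<^sup>2 + form Q x)"
        using x Qb Tb fP[OF x] positive_op_Im[OF pos_partD(2)[OF Q(1)] x]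
        by (simp add: ip_add_left complex_eq_iff)
      show "0 \<le> c i * (nm (T i x))\<^sup>2 + form Q x"
        using positive_op_form(1)[OF pos_partD(2)[OF Q(1)] x] T(2) by simp
    qed
  qed (use P Q pos_partD Qb Tb in auto)
  moreover have "form (op_plus H ?P Q) x = (\<Sum>i\<in>insert i I. c i * (nm (T i x))\<^sup>2)" if x: "x \<in> X" for x
  proof -
    have "form (op_plus H ?P Q) x = Re (ip (?P x) x) + form Q x"
      using x Qb Tb by (simp add: ip_add_left)
    also have "\<dots> = c i * (nm (T i x))\<^sup>2 + form Q x" unfolding fP[OF x] by simp
    finally show ?thesis using Q(2) x insert.hyps by simp
  qed
  moreover have "\<phi> (op_plus H ?P Q) = (\<Sum>i\<in>insert i I. c i * trace_norm2 (T i))"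
    using trace_plus[OF P Q(1)] trace_scale[OF T(2) A] Q(3) insert.hyps unfolding trace_norm2_def by simp
  ultimately show ?case by blast
qed

lemma trace_mono:
  assumes S: "S \<in> pos_part H M" and T: "T \<in> pos_part H M"
    and le: "\<And>x. x \<in> X \<Longrightarrow> form S x \<le> form T x"
  shows "\<phi> S \<le> \<phi> T"
proof -
  note b = M_bops[OF pos_partD(1)[OF S]] M_bops[OF pos_partD(1)[OF T]]
  have D: "op_minus H T S \<in> pos_part H M"
    using op_leI[OF pos_partD(2)[OF S] pos_partD(2)[OF T] le] S T pos_partD(1)
    unfolding op_le_def by (intro pos_partI M_minus) auto
  have "op_plus H S (op_minus H T S) = T"
    by (rule op_eqI) (use b in auto)
  then show ?thesis using trace_plus[OF S D] trace_ge0[OF D] by simp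
qed

text \<open>The transfer principle: an inequality between weighted sums of squared norms is checked
  vector by vector and then passes to the trace by monotonicity. The weights are nonnegative so that
  both sides are quadratic forms of positive operators.\<close>

lemma trace_norm2_combination_le:
  assumes T: "finite I" "\<And>i. i \<in> I \<Longrightarrow> T i \<in> M" "\<And>i. i \<in> I \<Longrightarrow> 0 \<le> c i"
    and S: "finite J" "\<And>j. j \<in> J \<Longrightarrow> S j \<in> M" "\<And>j. j \<in> J \<Longrightarrow> 0 \<le> d j"
    and le: "\<And>x. x \<in> X \<Longrightarrow> (\<Sum>i\<in>I. c i * (nm (T i x))\<^sup>2) \<le> (\<Sum>j\<in>J. d j * (nm (S j x))\<^sup>2)"
  shows "(\<Sum>i\<in>I. c i * trace_norm2 (T i)) \<le> (\<Sum>j\<in>J. d j * trace_norm2 (S j))"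
proof -
  obtain P where P: "P \<in> pos_part H M" "\<forall>x\<in>X. form P x = (\<Sum>i\<in>I. c i * (nm (T i x))\<^sup>2)"
    "\<phi> P = (\<Sum>i\<in>I. c i * trace_norm2 (T i))"
    using gram_operator[of I T c] T by auto
  obtain Q where Q: "Q \<in> pos_part H M" "\<forall>x\<in>X. form Q x = (\<Sum>i\<in>J. d i * (nm (S i x))\<^sup>2)"
    "\<phi> Q = (\<Sum>i\<in>J. d i * trace_norm2 (S i))"
    using gram_operator[of J S d] S by auto
  show ?thesis
    using trace_mono[OF P(1) Q(1)] P(2,3) Q(2,3) le by simp
qed

lemma trace_norm2_mono:
  assumes "S \<in> M" "T \<in> M" "\<And>x. x \<in> X \<Longrightarrow> nm (S x) \<le> nm (T x)"
  shows "trace_norm2 S \<le> trace_norm2 T"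
  using trace_norm2_combination_le[of "{()}" "\<lambda>_. S" "\<lambda>_. 1" "{()}" "\<lambda>_. T" "\<lambda>_. 1"] assms
  by (simp add: power_mono M_bops)

text \<open>Transfer in both directions. An identity with negative terms has to be rearranged first
  so that all coefficients are nonnegative.\<close>

lemma trace_norm2_two:
  assumes M: "A \<in> M" "B \<in> M" "C \<in> M" "D \<in> M" and pos: "0 \<le> a" "0 \<le> b" "0 \<le> c" "0 \<le> d"
    and eq: "\<And>x. x \<in> X \<Longrightarrow>
      a * (nm (A x))\<^sup>2 + b * (nm (B x))\<^sup>2 = c * (nm (C x))\<^sup>2 + d * (nm (D x))\<^sup>2"
  shows "a * trace_norm2 A + b * trace_norm2 B = c * trace_norm2 C + d * trace_norm2 D"
proof (rule antisym)
  have le: "a * trace_norm2 A + b * trace_norm2 B \<le> c * trace_norm2 C + d * trace_norm2 D"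
    if "A \<in> M" "B \<in> M" "C \<in> M" "D \<in> M" "0 \<le> a" "0 \<le> b" "0 \<le> c" "0 \<le> d"
      "\<And>x. x \<in> X \<Longrightarrow> a * (nm (A x))\<^sup>2 + b * (nm (B x))\<^sup>2 \<le> c * (nm (C x))\<^sup>2 + d * (nm (D x))\<^sup>2"
    for A B C D a b c d
  proof -
    have "(\<Sum>i\<in>{True, False}. (if i then a else b) * trace_norm2 (if i then A else B)) \<le>
        (\<Sum>i\<in>{True, False}. (if i then c else d) * trace_norm2 (if i then C else D))"
      by (rule trace_norm2_combination_le) (use that in auto)
    then show ?thesis by simp
  qed
  show "a * trace_norm2 A + b * trace_norm2 B \<le> c * trace_norm2 C + d * trace_norm2 D"
    by (rule le) (use M pos eq in auto)
  show "c * trace_norm2 C + d * trace_norm2 D \<le> a * trace_norm2 A + b * trace_norm2 B"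
    by (rule le) (use M pos eq in auto)
qed

lemma trace_norm2_isometry:
  assumes T: "T \<in> M" and U: "U \<in> M" "\<And>x. x \<in> X \<Longrightarrow> nm (U x) = nm x"
  shows "trace_norm2 (compose X U T) = trace_norm2 T"
proof (rule antisym)
  have 1: "compose X U T \<in> M" using M_compose U(1) T by blast
  show "trace_norm2 (compose X U T) \<le> trace_norm2 T" "trace_norm2 T \<le> trace_norm2 (compose X U T)"
    by (rule trace_norm2_mono; use 1 T U M_bops[OF T] in simp)+
qed

text \<open>The trace property allows passing to adjoints, which turns right multiplication into
  left multiplication; there the claim is visible on vectors.\<close>

lemma trace_norm2_isometry_right:
  assumes T: "T \<in> M" and U: "U \<in> M" "\<And>x. x \<in> X \<Longrightarrow> nm (adj U x) = nm x"
  shows "trace_norm2 (compose X T U) = trace_norm2 T"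
proof -
  have "trace_norm2 (compose X T U) = trace_norm2 (compose X (adj U) (adj T))"
    using trace_norm2_adj[OF M_compose[OF T U(1)]] adj_compose[OF M_bops[OF T] M_bops[OF U(1)]] by simp
  also have "\<dots> = trace_norm2 T"
    using trace_norm2_isometry[OF M_adj[OF T] M_adj[OF U(1)] U(2)] trace_norm2_adj[OF T] by simp
  finally show ?thesis .
qed

text \<open>A trace inner product is not at hand, so the linear coefficient is expressed by
  polarization through \<open>op_minus H B C\<close>. This is the expansion needed to minimize a
  functional that contains the trace norm.\<close>

lemma trace_norm2_line:
  assumes B: "B \<in> M" and C: "C \<in> M"
  shows "trace_norm2 (op_plus H B (compose X (scalar_op H (complex_of_real r)) C)) =
    trace_norm2 B + r * (trace_norm2 B + trace_norm2 C - trace_norm2 (op_minus H B C)) +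
    r\<^sup>2 * trace_norm2 C"
proof -
  note b = M_bops[OF B] M_bops[OF C]
  have rC: "compose X (scalar_op H (complex_of_real t)) C \<in> M" for t
    by (intro M_compose M_scalar C)
  define P where "P t = op_plus H B (compose X (scalar_op H (complex_of_real t)) C)" for t
  have P: "P t \<in> M" for t unfolding P_def by (intro M_plus rC B)
  have nmP: "(nm (P t x))\<^sup>2 = (nm (B x))\<^sup>2 + t * (2 * Re (ip (B x) (C x))) + t\<^sup>2 * (nm (C x))\<^sup>2"
    if x: "x \<in> X" for t x
    using x b nm_add_scale_sq[of "B x" "C x" t] by (simp add: P_def)
  have P1: "P (-1) = op_minus H B C" unfolding P_def by (rule op_eqI) (use b in auto)
  \<comment> \<open>Adding \<open>t\<close> times the form of \<open>P (-1)\<close> cancels the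
    mixed terms, and for \<open>t \<ge> 0\<close> all coefficients are nonnegative.\<close>
  have nonneg: "1 * trace_norm2 (P t) + t * trace_norm2 (P (-1)) =
      (1 + t) * trace_norm2 B + (t + t\<^sup>2) * trace_norm2 C" if t: "0 \<le> t" for t
  proof (rule trace_norm2_two)
    show "1 * (nm (P t x))\<^sup>2 + t * (nm (P (-1) x))\<^sup>2 =
        (1 + t) * (nm (B x))\<^sup>2 + (t + t\<^sup>2) * (nm (C x))\<^sup>2" if "x \<in> X" for x
      unfolding nmP[OF that] by (simp add: algebra_simps)
  qed (use t P B C in auto)
  \<comment> \<open>The mirror identity for negative parameters, with \<open>P 1\<close> in the role
    of \<open>P (-1)\<close>.\<close>
  have neg: "1 * trace_norm2 (P (-t)) + t * trace_norm2 (P 1) =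
      (1 + t) * trace_norm2 B + (t + t\<^sup>2) * trace_norm2 C" if t: "0 \<le> t" for t
  proof (rule trace_norm2_two)
    show "1 * (nm (P (-t) x))\<^sup>2 + t * (nm (P 1 x))\<^sup>2 =
        (1 + t) * (nm (B x))\<^sup>2 + (t + t\<^sup>2) * (nm (C x))\<^sup>2" if "x \<in> X" for x
      unfolding nmP[OF that] by (simp add: algebra_simps)
  qed (use t P B C in auto)
  \<comment> \<open>The parallelogram law, which will eliminate \<open>P 1\<close>.\<close>
  have par: "trace_norm2 (P 1) = 2 * trace_norm2 B + 2 * trace_norm2 C - trace_norm2 (op_minus H B C)"
    using nonneg[of 1] unfolding P1 by simp
  have "trace_norm2 (P r) = trace_norm2 B +
      r * (trace_norm2 B + trace_norm2 C - trace_norm2 (op_minus H B C)) + r\<^sup>2 * trace_norm2 C"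
  proof (cases "0 \<le> r")
    case True
    show ?thesis using nonneg[OF True] unfolding P1 by (simp add: algebra_simps)
  next
    case False
    then have "trace_norm2 (P r) = r * trace_norm2 (P 1) + (1 - r) * trace_norm2 B + (r\<^sup>2 - r) * trace_norm2 C"
      using neg[of "- r"] by (simp add: algebra_simps)
    then show ?thesis unfolding par by (simp add: algebra_simps)
  qed
  then show ?thesis unfolding P_def .
qed

text \<open>If \<open>b\<^sub>k \<rightarrow> 0\<close> in the trace norm while \<open>b\<^sub>k v \<rightarrow> p\<close>, then the projection \<open>e\<close> onto the closure of
  \<open>M' p\<close> is the supremum of operators \<open>e (1 - (1 + s)\<^sup>-\<^sup>1) e\<close> with \<open>s\<close> a partial sum of
  \<open>\<Sum> 4\<^sup>k b\<^sub>k b\<^sub>k\<^sup>*\<close>, all of which have small trace; normality gives \<open>\<phi> e = 0\<close>.\<close>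

lemma normal_trace_closable:
  assumes normal: "normal_trace H M \<phi>"
    and b: "\<And>k::nat. b k \<in> M" and lim0: "(\<lambda>k. trace_norm2 (b k)) \<longlonglongrightarrow> 0"
    and v: "v \<in> X" and p: "p \<in> X" and limp: "(\<lambda>k. nm (p - b k v)) \<longlonglongrightarrow> 0"
    and e: "projects_onto e (hclosure (orbit p))"
  shows "\<phi> e = 0"
proof -
  note W = closed_subspace_orbit[OF p] and eb = projects_ontoD(1)[OF e]
  note e_pos = orbit_projection(1)[OF p e]
  note eM = pos_partD(1)[OF e_pos]
  have eW: "e x \<in> hclosure (orbit p)" if "x \<in> X" for x using projects_ontoD(2)[OF e that] .
  have ee: "e (e x) = e x" if "x \<in> X" for x using projects_onto_fix[OF W e eW[OF that]] .
  have esym: "ip (e x) y = ip x (e y)" if "x \<in> X" "y \<in> X" for x y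
    using positive_op_sym[OF pos_partD(2)[OF e_pos] that] .
  have "\<phi> e \<le> d" if d: "d > 0" for d
  proof -
    \<comment> \<open>A subsequence so sparse that its traces still sum to at most \<open>d\<close>
      after weighting with \<open>4 ^ k\<close>.\<close>
    have "\<exists>c\<in>M. 4 ^ k * trace_norm2 c \<le> d * (1/2) ^ Suc k \<and> nm (p - c v) \<le> (1/2) ^ k" for k :: nat
    proof -
      have "\<forall>\<^sub>F j in sequentially. trace_norm2 (b j) < d * (1/2) ^ Suc k / 4 ^ k"
        by (rule order_tendstoD(2)[OF lim0]) (use d in simp)
      moreover have "\<forall>\<^sub>F j in sequentially. nm (p - b j v) < (1/2) ^ k"
        by (rule order_tendstoD(2)[OF limp]) simp
      ultimately have "\<forall>\<^sub>F j in sequentially. trace_norm2 (b j) < d * (1/2) ^ Suc k / 4 ^ k \<and>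
          nm (p - b j v) < (1/2) ^ k"
        by (rule eventually_conj)
      then obtain j where "trace_norm2 (b j) < d * (1/2) ^ Suc k / 4 ^ k" "nm (p - b j v) < (1/2) ^ k"
        by (auto simp: eventually_sequentially)
      then show ?thesis using b by (intro bexI[of _ "b j"]) (auto simp: field_simps)
    qed
    then have "\<forall>k. \<exists>c. c \<in> M \<and> 4 ^ k * trace_norm2 c \<le> d * (1/2) ^ Suc k \<and> nm (p - c v) \<le> (1/2) ^ k"
      by blast
    from choice[OF this] obtain c where "\<forall>k. c k \<in> M \<and> 4 ^ k * trace_norm2 (c k) \<le> d * (1/2) ^ Suc k \<and>
        nm (p - c k v) \<le> (1/2) ^ k" by blast
    then have c: "\<And>k. c k \<in> M" and c_tr: "\<And>k. 4 ^ k * trace_norm2 (c k) \<le> d * (1/2) ^ Suc k"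
      and c_lim: "\<And>k. nm (p - c k v) \<le> (1/2) ^ k" by simp_all
    note cb = M_bops[OF c] and ac = M_adj[OF c] and acb = M_bops[OF M_adj[OF c]]
    have "\<forall>L. \<exists>Q. Q \<in> pos_part H M \<and> (\<forall>x\<in>X. form Q x = (\<Sum>i<L. 4 ^ i * (nm (adj (c i) x))\<^sup>2))"
    proof
      fix L :: nat
      show "\<exists>Q. Q \<in> pos_part H M \<and> (\<forall>x\<in>X. form Q x = (\<Sum>i<L. 4 ^ i * (nm (adj (c i) x))\<^sup>2))"
        using gram_operator[of "{..<L}" "\<lambda>i. adj (c i)" "\<lambda>i. 4 ^ i"] ac by auto
    qed
    from choice[OF this] obtain s where "\<forall>L. s L \<in> pos_part H M \<and>
        (\<forall>x\<in>X. form (s L) x = (\<Sum>i<L. 4 ^ i * (nm (adj (c i) x))\<^sup>2))" by blast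
    then have s: "\<And>L. s L \<in> pos_part H M"
      and s_form: "\<And>L x. x \<in> X \<Longrightarrow> form (s L) x = (\<Sum>i<L. 4 ^ i * (nm (adj (c i) x))\<^sup>2)"
      by simp_all
    note s_pos = pos_partD(2)[OF s]
    have "\<forall>L. \<exists>r. r \<in> M \<and> (\<forall>x\<in>X. r x + s L (r x) = x)"
    proof
      fix L
      obtain r where r: "r \<in> bops" "\<forall>x\<in>X. r x + s L (r x) = x"
        "\<forall>Y. s L \<in> comm Y \<longrightarrow> Y \<subseteq> bops \<longrightarrow> r \<in> comm Y"
        using resolvent[OF s_pos[of L]] by blast
      have "s L \<in> comm (comm M)" using pos_partD(1)[OF s] M_comm by simp
      then have "r \<in> comm (comm M)" using r(3) comm_subset by blast
      then show "\<exists>r. r \<in> M \<and> (\<forall>x\<in>X. r x + s L (r x) = x)" using r(2) M_comm by auto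
    qed
    from choice[OF this] obtain r where "\<forall>L. r L \<in> M \<and> (\<forall>x\<in>X. r L x + s L (r L x) = x)" by blast
    then have r: "\<And>L. r L \<in> M" and r_eq: "\<And>L x. x \<in> X \<Longrightarrow> r L x + s L (r L x) = x"
      by simp_all
    note rb = M_bops[OF r]
    \<comment> \<open>Compression by \<open>e\<close> is needed because the resolvents
      \<open>r L\<close> are shown to tend to 0 on the range of \<open>e\<close> only.\<close>
    define G where "G L = compose X e (compose X (op_minus H (scalar_op H 1) (r L)) e)" for L
    have GM: "G L \<in> M" for L unfolding G_def by (intro M_compose M_minus M_scalar r eM)
    have G_ip: "ip (G L x) x = ip (e x) (e x) - ip (r L (e x)) (e x)" if x: "x \<in> X" for L x
    proof -
      have "ip (G L x) x = ip (e (e x - r L (e x))) x"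
        unfolding G_def using x eb by simp
      also have "\<dots> = ip (e x - r L (e x)) (e x)"
        using x eb rb by (intro esym) auto
      finally show ?thesis using x eb rb by (simp add: ip_diff_left)
    qed
    have G_form: "form (G L) x = (nm (e x))\<^sup>2 - form (r L) (e x)" if x: "x \<in> X" for L x
      using G_ip[OF x] x eb by (simp add: nm_sq)
    have r_le: "form (r L) y \<le> (nm y)\<^sup>2" if y: "y \<in> X" for L y
    proof -
      have "form (r L) y \<le> nm (r L y) * nm y"
        by (rule resolvent_norm_le(2)[OF s_pos rb r_eq y])
      also have "\<dots> \<le> nm y * nm y"
        by (rule mult_right_mono[OF resolvent_norm_le(3)[OF s_pos rb r_eq y]]) (use y in auto)
      finally show ?thesis by (simp add: power2_eq_square)
    qed
    have r_pos: "positive_op H (r L)" for L by (rule resolvent_positive[OF s_pos rb r_eq])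
    have G_pos: "G L \<in> pos_part H M" for L
    proof (rule pos_partI[OF GM positive_opI])
      fix x assume x: "x \<in> X"
      have "ip (G L x) x = complex_of_real ((nm (e x))\<^sup>2 - form (r L) (e x))"
        using G_form[OF x, of L] G_ip[OF x, of L] positive_op_Im[OF r_pos, of "e x" L] x eb
        by (simp add: complex_eq_iff ip_nm_sq)
      then show "\<exists>t\<ge>0. ip (G L x) x = complex_of_real t"
        using r_le[of "e x" L] x eb by (intro exI[of _ "(nm (e x))\<^sup>2 - form (r L) (e x)"]) simp
    qed (rule M_bops[OF GM])
    have e_form: "form e x = (nm (e x))\<^sup>2" if "x \<in> X" for x
      using projects_onto_form[OF W e that] by simp
    \<comment> \<open>The variational bound at \<open>z = x\<close> reads
      \<open>1 - r L \<le> s L\<close>, so the trace of \<open>G L\<close> is at most that of the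
      compression of \<open>s L\<close> by \<open>e\<close>.\<close>
    have small: "\<phi> (G L) \<le> d" for L
    proof -
      obtain Q where Q: "Q \<in> pos_part H M"
        "\<forall>x\<in>X. form Q x = (\<Sum>i<L. 4 ^ i * (nm (compose X (adj (c i)) e x))\<^sup>2)"
        "\<phi> Q = (\<Sum>i<L. 4 ^ i * trace_norm2 (compose X (adj (c i)) e))"
        using gram_operator[of "{..<L}" "\<lambda>i. compose X (adj (c i)) e" "\<lambda>i. 4 ^ i"] M_compose[OF ac eM]
        by auto
      have "\<phi> (G L) \<le> \<phi> Q"
      proof (rule trace_mono[OF G_pos Q(1)])
        fix x assume x: "x \<in> X"
        have ex: "e x \<in> X" using x eb by simp
        have "(nm (e x))\<^sup>2 - form (s L) (e x) \<le> form (r L) (e x)"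
          using resolvent_form_ge[OF s_pos rb r_eq ex ex, of L] ex by (simp add: nm_sq)
        then show "form (G L) x \<le> form Q x"
          using G_form[OF x] Q(2) s_form[OF ex] x by simp
      qed
      also have "\<phi> Q \<le> (\<Sum>i<L. d * (1/2) ^ Suc i)"
        unfolding Q(3)
      proof (rule sum_mono)
        fix i
        \<comment> \<open>The trace property moves \<open>e\<close> to the left of
          \<open>c i\<close>, where it only decreases norms of vectors.\<close>
        have "trace_norm2 (compose X (adj (c i)) e) = trace_norm2 (compose X (adj e) (c i))"
          using trace_norm2_adj[OF M_compose[OF ac eM], of i] adj_compose[OF acb eb, of i] adj_adj[OF cb, of i]
          by simp
        also have "adj e = e" by (rule adj_unique) (use eb esym in auto)
        also have "trace_norm2 (compose X e (c i)) \<le> trace_norm2 (c i)"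
        proof (rule trace_norm2_mono)
          fix x assume x: "x \<in> X"
          then have cx: "c i x \<in> X" using cb by simp
          have "(nm (e (c i x)))\<^sup>2 \<le> nm (e (c i x)) * nm (c i x)"
            using e_form[OF cx] Re_ip_le[of "e (c i x)" "c i x"] cx eb by simp
          then have "nm (e (c i x)) \<le> nm (c i x)"
            by (rule square_le_mult_imp_le) (use cx eb in auto)
          then show "nm (compose X e (c i) x) \<le> nm (c i x)" using x by simp
        qed (use M_compose[OF eM c] c in auto)
        finally have "4 ^ i * trace_norm2 (compose X (adj (c i)) e) \<le> 4 ^ i * trace_norm2 (c i)"
          by simp
        with c_tr[of i] show "4 ^ i * trace_norm2 (compose X (adj (c i)) e) \<le> d * (1/2) ^ Suc i"
          by linarith
      qed
      also have "\<dots> = d * (1 - (1/2) ^ L)"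
        by (induction L) (simp_all add: algebra_simps)
      also have "\<dots> \<le> d" using d by simp
      finally show ?thesis .
    qed
    have r_lim_p: "(\<lambda>L. nm (r L p)) \<longlonglongrightarrow> 0"
    proof -
      \<comment> \<open>Split \<open>p\<close> into \<open>p - c i v\<close> and
        \<open>c i v\<close>. The first part is small by the choice of \<open>c i\<close>. For the
        second, \<open>s (Suc i)\<close> is the first partial sum that contains the term of
        \<open>c i\<close>, and its weight \<open>4 ^ i\<close> bounds
        \<open>adj (c i) (r (Suc i) p)\<close> by \<open>(1/2) ^ i * nm p\<close>.\<close>
      define C where "C = nm v * nm p + nm p"
      have "(nm (r (Suc i) p))\<^sup>2 \<le> (1/2) ^ i * C" for i
      proof -
        let ?x = "r (Suc i) p"
        have x: "?x \<in> X" using rb p by simp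
        have q1: "(nm ?x)\<^sup>2 \<le> form (r (Suc i)) p"
          by (rule resolvent_norm_le(1)[OF s_pos rb r_eq p])
        have xp: "nm ?x \<le> nm p"
          by (rule resolvent_norm_le(3)[OF s_pos rb r_eq p])
        have "form (s (Suc i)) ?x \<le> form (r (Suc i)) p"
          using resolvent_form[OF s_pos[of "Suc i"] rb r_eq p] x by simp
        then have "4 ^ i * (nm (adj (c i) ?x))\<^sup>2 \<le> form (r (Suc i)) p"
          using s_form[OF x, of "Suc i"] sum_nonneg[of "{..<i}" "\<lambda>i. 4 ^ i * (nm (adj (c i) ?x))\<^sup>2"] by simp
        also have "\<dots> \<le> (nm p)\<^sup>2" by (rule r_le[OF p])
        finally have "(2 ^ i * nm (adj (c i) ?x))\<^sup>2 \<le> (nm p)\<^sup>2"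
          by (simp add: power_mult_distrib power2_eq_square[of "2 ^ i"] flip: power_mult_distrib[of 2 2 i])
        then have "2 ^ i * nm (adj (c i) ?x) \<le> nm p"
          by (rule power2_le_imp_le) (use p in simp)
        then have ax: "nm (adj (c i) ?x) \<le> (1/2) ^ i * nm p" by (simp add: field_simps power_one_over)
        have "form (r (Suc i)) p = Re (ip p ?x)" by (rule Re_ip_commute[OF p x])
        also have "\<dots> = Re (ip (p - c i v) ?x) + Re (ip v (adj (c i) ?x))"
          using p x v cb by (simp add: ip_diff_left ip_adj_right)
        also have "\<dots> \<le> nm (p - c i v) * nm ?x + nm v * nm (adj (c i) ?x)"
          using p x v cb acb by (intro add_mono Re_ip_le) auto
        also have "\<dots> \<le> (1/2) ^ i * nm p + nm v * ((1/2) ^ i * nm p)"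
          using p x v cb acb c_lim[of i] xp ax by (intro add_mono mult_mono mult_left_mono) auto
        finally show ?thesis using q1 unfolding C_def by (simp add: algebra_simps)
      qed
      moreover have "(\<lambda>i. (1/2::real) ^ i * C) \<longlonglongrightarrow> 0"
        using tendsto_mult_right[OF LIMSEQ_power_zero[of "1/2::real"], of C] by simp
      ultimately have "(\<lambda>i. (nm (r (Suc i) p))\<^sup>2) \<longlonglongrightarrow> 0"
        by (intro Lim_null_comparison[of "\<lambda>i. (nm (r (Suc i) p))\<^sup>2" "\<lambda>i. (1/2) ^ i * C"]) auto
      then have "(\<lambda>i. sqrt ((nm (r (Suc i) p))\<^sup>2)) \<longlonglongrightarrow> sqrt 0" by (rule tendsto_real_sqrt)
      then have "(\<lambda>i. nm (r (Suc i) p)) \<longlonglongrightarrow> 0" using rb p by simp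
      then show ?thesis by (rule LIMSEQ_imp_Suc)
    qed
    \<comment> \<open>Operators of the commutant commute with \<open>r L\<close> and so carry the
      limit from \<open>p\<close> to its orbit.\<close>
    have r_lim_orbit: "(\<lambda>L. nm (r L w)) \<longlonglongrightarrow> 0" if w: "w \<in> orbit p" for w
    proof -
      obtain T where T: "w = T p" "T \<in> comm M" using w unfolding orbit_def by (rule imageE)
      obtain K where K: "0 \<le> K" "\<And>x. x \<in> X \<Longrightarrow> nm (T x) \<le> K * nm x"
        using op_bound[OF comm_bops[OF T(2)]] by metis
      have "nm (r L w) \<le> K * nm (r L p)" for L
        using K(2)[of "r L p"] comm_apply[OF T(2) r p, of L] rb p T(1) by simp
      then show ?thesis
        using tendsto_mult_left[OF r_lim_p, of K] rb w orbit_subset[OF p]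
        by (intro Lim_null_comparison[of "\<lambda>L. nm (r L w)" "\<lambda>L. K * nm (r L p)"]) auto
    qed
    \<comment> \<open>The \<open>r L\<close> are contractions, so convergence on the orbit extends
      to its closure.\<close>
    have r_lim: "(\<lambda>L. form (r L) y) \<longlonglongrightarrow> 0" if y: "y \<in> hclosure (orbit p)" for y
    proof -
      have yX: "y \<in> X" using hclosure_in[OF y] .
      have "(\<lambda>L. nm (r L y)) \<longlonglongrightarrow> 0"
      proof (rule LIMSEQ_I)
        fix a :: real assume a: "0 < a"
        obtain w where w: "w \<in> orbit p" "nm (y - w) < a / 2" using hclosureD[OF y, of "a / 2"] a by auto
        have wX: "w \<in> X" using w orbit_subset[OF p] by blast
        obtain N where N: "\<And>L. L \<ge> N \<Longrightarrow> nm (r L w) < a / 2"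
          using order_tendstoD(2)[OF r_lim_orbit[OF w(1)], of "a / 2"] a by (auto simp: eventually_sequentially)
        have "norm (nm (r L y) - 0) < a" if L: "L \<ge> N" for L
        proof -
          have "nm (r L y) \<le> nm (r L (y - w)) + nm (r L w)"
            using nm_triangle[of "r L (y - w)" "r L w"] rb yX wX by (simp add: op_diff)
          moreover have "nm (r L (y - w)) \<le> nm (y - w)"
            by (rule resolvent_norm_le(3)[OF s_pos rb r_eq]) (use yX wX in auto)
          ultimately show ?thesis using N[OF L] w(2) rb yX by simp
        qed
        then show "\<exists>N. \<forall>L\<ge>N. norm (nm (r L y) - 0) < a" by blast
      qed
      then have "(\<lambda>L. nm (r L y) * nm y) \<longlonglongrightarrow> 0" using tendsto_mult_right[of _ 0 _ "nm y"] by simp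
      then show ?thesis
      proof (rule Lim_null_comparison[rotated])
        show "\<forall>\<^sub>F L in sequentially. norm (form (r L) y) \<le> nm (r L y) * nm y"
          using positive_op_form(1)[OF r_pos yX] resolvent_norm_le(2)[OF s_pos rb r_eq yX] by simp
      qed
    qed
    have mono: "form (G L) x \<le> form (G L') x" if L: "L \<le> L'" and x: "x \<in> X" for L L' x
    proof -
      have "form (r L') (e x) \<le> form (r L) (e x)"
      proof (rule resolvent_antitone[OF s_pos rb r_eq s_pos rb r_eq])
        show "form (s L) y \<le> form (s L') y" if "y \<in> X" for y
          unfolding s_form[OF that] using L by (intro sum_mono2) auto
      qed (use x eb in auto)
      then show ?thesis using G_form[OF x] by simp
    qed
    have "\<phi> e = (SUP T\<in>range G. \<phi> T)"
    proof (rule normal[unfolded normal_trace_def, rule_format], intro conjI ballI impI)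
      show "range G \<subseteq> pos_part H M" using G_pos by blast
      show "range G \<noteq> {}" by blast
      show "e \<in> pos_part H M" by (rule e_pos)
    next
      fix T1 T2 assume "T1 \<in> range G" "T2 \<in> range G"
      then obtain K L where KL: "T1 = G K" "T2 = G L" by blast
      have "op_le H (G K) (G (max K L))" "op_le H (G L) (G (max K L))"
        by (rule op_leI; use G_pos pos_partD(2) mono in simp)+
      then show "\<exists>T\<in>range G. op_le H T1 T \<and> op_le H T2 T" unfolding KL by blast
    next
      fix T assume "T \<in> range G"
      then obtain L where L: "T = G L" by blast
      show "op_le H T e" unfolding L
      proof (rule op_leI)
        fix x assume x: "x \<in> X"
        show "form (G L) x \<le> form e x"
          using positive_op_form(1)[OF r_pos, of "e x" L] eb x G_form[OF x] e_form[OF x] by simp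
      qed (use G_pos e_pos pos_partD(2) in auto)
    next
      fix R assume R: "R \<in> pos_part H M" and "\<forall>T\<in>range G. op_le H T R"
      then have le: "op_le H (G L) R" for L by blast
      show "op_le H e R"
      proof (rule op_leI)
        fix x assume x: "x \<in> X"
        have "(\<lambda>L. form (G L) x) \<longlonglongrightarrow> (nm (e x))\<^sup>2 - 0"
          unfolding G_form[OF x] by (intro tendsto_intros r_lim[OF eW[OF x]])
        moreover have "form (G L) x \<le> form R x" for L
          by (rule op_leD[OF le M_bops[OF GM] M_bops[OF pos_partD(1)[OF R]] x])
        ultimately show "form e x \<le> form R x"
          unfolding e_form[OF x] using LIMSEQ_le_const2 by fastforce
      qed (use R e_pos pos_partD(2) in auto)
    qed
    also have "\<dots> \<le> d" by (rule cSUP_least) (use small in auto)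
    finally show ?thesis .
  qed
  then have "\<phi> e \<le> 0" by - (rule field_le_epsilon, simp)
  then show ?thesis using trace_ge0[OF e_pos] by simp
qed

end

section \<open>Unitary representations\<close>

locale urep = hilb H + G: group G
  for H :: "'v::ab_group_add hspace" and G :: "'g monoid" +
  fixes \<pi> :: "'g \<Rightarrow> 'v \<Rightarrow> 'v"
  assumes \<pi>_hom: "\<pi> \<in> hom G (unitary_group H)"

lemma unitary_rep_iff: "unitary_rep G H \<pi> \<longleftrightarrow> urep H G \<pi>"
  unfolding unitary_rep_def urep_def urep_axioms_def hilb_def by blast

context urep
begin

lemma \<pi>_carrier: "g \<in> carrier G \<Longrightarrow> \<pi> g \<in> carrier (unitary_group H)"
  using \<pi>_hom unfolding hom_def by auto

lemma \<pi>_bops [simp]: "g \<in> carrier G \<Longrightarrow> \<pi> g \<in> bops"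
  and \<pi>_Bij: "g \<in> carrier G \<Longrightarrow> \<pi> g \<in> Bij X"
  and \<pi>_ip: "g \<in> carrier G \<Longrightarrow> x \<in> X \<Longrightarrow> y \<in> X \<Longrightarrow> ip (\<pi> g x) (\<pi> g y) = ip x y"
  using \<pi>_carrier unfolding unitary_group_def by auto

lemma \<pi>_in [simp]: "g \<in> carrier G \<Longrightarrow> x \<in> X \<Longrightarrow> \<pi> g x \<in> X"
  by simp

lemma \<pi>_mult:
  assumes "g \<in> carrier G" "h \<in> carrier G" "x \<in> X"
  shows "\<pi> (g \<otimes>\<^bsub>G\<^esub> h) x = \<pi> g (\<pi> h x)"
proof -
  have "\<pi> (g \<otimes>\<^bsub>G\<^esub> h) = \<pi> g \<otimes>\<^bsub>unitary_group H\<^esub> \<pi> h"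
    using \<pi>_hom assms unfolding hom_def by auto
  then show ?thesis
    using \<pi>_Bij assms unfolding unitary_group_def BijGroup_def by simp
qed

text \<open>\<open>hom\<close> yields multiplicativity only; an injective idempotent map is the
  identity.\<close>

lemma \<pi>_one: assumes "x \<in> X" shows "\<pi> \<one>\<^bsub>G\<^esub> x = x"
proof -
  have "\<pi> \<one>\<^bsub>G\<^esub> (\<pi> \<one>\<^bsub>G\<^esub> x) = \<pi> \<one>\<^bsub>G\<^esub> x"
    using \<pi>_mult[of "\<one>\<^bsub>G\<^esub>" "\<one>\<^bsub>G\<^esub>" x] assms by simp
  moreover have "inj_on (\<pi> \<one>\<^bsub>G\<^esub>) X"
    using \<pi>_Bij[of "\<one>\<^bsub>G\<^esub>"] unfolding Bij_def bij_betw_def by auto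
  ultimately show ?thesis using assms by (auto dest: inj_onD)
qed

lemma \<pi>_inv1: "g \<in> carrier G \<Longrightarrow> x \<in> X \<Longrightarrow> \<pi> (inv\<^bsub>G\<^esub> g) (\<pi> g x) = x"
  using \<pi>_mult[of "inv\<^bsub>G\<^esub> g" g x] \<pi>_one by simp

lemma \<pi>_inv2: "g \<in> carrier G \<Longrightarrow> x \<in> X \<Longrightarrow> \<pi> g (\<pi> (inv\<^bsub>G\<^esub> g) x) = x"
  using \<pi>_mult[of g "inv\<^bsub>G\<^esub> g" x] \<pi>_one by simp

lemma nm_\<pi> [simp]: "g \<in> carrier G \<Longrightarrow> x \<in> X \<Longrightarrow> nm (\<pi> g x) = nm x"
  unfolding hnorm_def by (simp add: \<pi>_ip)

lemma ip_\<pi>_left: "g \<in> carrier G \<Longrightarrow> x \<in> X \<Longrightarrow> y \<in> X \<Longrightarrow> ip (\<pi> g x) y = ip x (\<pi> (inv\<^bsub>G\<^esub> g) y)"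
  using \<pi>_ip[of g x "\<pi> (inv\<^bsub>G\<^esub> g) y"] \<pi>_inv2 by simp

lemma adj_\<pi>: "g \<in> carrier G \<Longrightarrow> adj (\<pi> g) = \<pi> (inv\<^bsub>G\<^esub> g)"
  by (rule adj_unique) (auto simp: ip_\<pi>_left)

abbreviation "U \<equiv> \<pi> ` carrier G"
abbreviation "N \<equiv> rep_vna G H \<pi>"

lemma U_bops: "U \<subseteq> bops"
  by auto

lemma U_adj: "S \<in> U \<Longrightarrow> adj S \<in> U"
  by (auto simp: adj_\<pi>)

lemma N_eq: "N = comm (comm U)"
  by (simp add: rep_vna_def)

lemma comm_N: "comm N = comm U"
  unfolding N_eq by (rule comm_comm_comm[OF U_bops])

lemma \<pi>_in_N: "g \<in> carrier G \<Longrightarrow> \<pi> g \<in> N"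
  unfolding N_eq using subset_comm_comm[OF U_bops] by blast

lemma von_neumann_algebra_N: "von_neumann_algebra H N"
  unfolding N_eq
  by (rule von_neumann_algebra_comm[OF comm_subset]) (rule comm_adj[OF U_bops U_adj])

lemma comm_\<pi>: "T \<in> comm U \<Longrightarrow> g \<in> carrier G \<Longrightarrow> x \<in> X \<Longrightarrow> T (\<pi> g x) = \<pi> g (T x)"
  by (rule comm_apply) auto

section \<open>Group algebra operators and almost invariant functionals\<close>

definition rop :: "('g \<Rightarrow> complex) \<Rightarrow> 'v \<Rightarrow> 'v" where
  "rop a = (\<lambda>x\<in>X. \<Sum>g | a g \<noteq> 0. sc (a g) (\<pi> g x))"

lemma group_algD: "a \<in> group_alg G \<Longrightarrow> finite {g. a g \<noteq> 0}" "a \<in> group_alg G \<Longrightarrow> a g \<noteq> 0 \<Longrightarrow> g \<in> carrier G"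
  unfolding group_alg_def by auto

lemma rop_apply: "x \<in> X \<Longrightarrow> rop a x = (\<Sum>g | a g \<noteq> 0. sc (a g) (\<pi> g x))"
  by (simp add: rop_def)

lemma rop_bops [simp]:
  assumes a: "a \<in> group_alg G"
  shows "rop a \<in> bops"
proof (rule bopsI[where K = "\<Sum>g | a g \<noteq> 0. cmod (a g)"])
  note g = group_algD(2)[OF a]
  show "rop a x \<in> X" if "x \<in> X" for x unfolding rop_apply[OF that] by (rule sum_in) (use g that in auto)
  show "rop a (x + y) = rop a x + rop a y" if "x \<in> X" "y \<in> X" for x y
    using that g by (simp add: rop_apply sum.distrib[symmetric] op_add vs.scale_right_distrib)
  show "rop a (sc c x) = sc c (rop a x)" if "x \<in> X" for c x
    using that g by (simp add: rop_apply vs.scale_sum_right op_scale mult.commute)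
  show "nm (rop a x) \<le> (\<Sum>g | a g \<noteq> 0. cmod (a g)) * nm x" if x: "x \<in> X" for x
  proof -
    have "nm (rop a x) \<le> (\<Sum>g | a g \<noteq> 0. nm (sc (a g) (\<pi> g x)))"
      unfolding rop_apply[OF x] by (rule nm_sum_le) (use g x in auto)
    also have "\<dots> = (\<Sum>g | a g \<noteq> 0. cmod (a g) * nm x)"
      using g x by (intro sum.cong) (auto simp: nm_scale)
    finally show ?thesis by (simp add: sum_distrib_right)
  qed
qed (simp add: rop_def)

lemma rop_in_N: "a \<in> group_alg G \<Longrightarrow> rop a \<in> N"
  unfolding N_eq
proof (rule commI)
  fix S x assume a: "a \<in> group_alg G" and S: "S \<in> comm U" and x: "x \<in> X"
  note g = group_algD(2)[OF a]
  have "S (rop a x) = (\<Sum>g | a g \<noteq> 0. S (sc (a g) (\<pi> g x)))"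
    unfolding rop_apply[OF x] by (rule op_sum[OF comm_bops[OF S]]) (use g x in auto)
  also have "\<dots> = rop a (S x)"
    unfolding rop_apply[OF comm_in[OF S x]]
    by (intro sum.cong) (use g x comm_bops[OF S] in \<open>auto simp: op_scale comm_\<pi>[OF S]\<close>)
  finally show "rop a (S x) = S (rop a x)" by simp
qed simp

text \<open>Contractivity in the given representation rather than in the norm of the enveloping
  algebra: the condition is weaker, thus the estimates cover the whole unit ball, and it passes from
  an induced representation to the inducing one by compression.\<close>

definition contractive :: "('g \<Rightarrow> complex) \<Rightarrow> bool" where
  "contractive a \<longleftrightarrow> a \<in> group_alg G \<and> (\<forall>x\<in>X. nm (rop a x) \<le> nm x)"

definition centralizer :: "'g set \<Rightarrow> 'g set" where
  "centralizer F = {g \<in> carrier G. \<forall>f\<in>F. g \<otimes>\<^bsub>G\<^esub> f = f \<otimes>\<^bsub>G\<^esub> g}"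

text \<open>The change of the functional \<open>a \<mapsto> ip (rop a v) y\<close> when
  \<open>a\<close> is conjugated by the inverse of \<open>g\<close>.\<close>

definition variation :: "'g \<Rightarrow> ('g \<Rightarrow> complex) \<Rightarrow> 'v \<Rightarrow> 'v \<Rightarrow> complex" where
  "variation g a v y = ip (rop a (\<pi> g v)) (\<pi> g y) - ip (rop a v) y"

text \<open>Centralizers of finite sets correspond to neighbourhoods of the identity among the inner
  automorphisms, and uniformity in \<open>a\<close> is closeness in the dual norm. Stability
  concerns \<open>v = y\<close>; two separate vectors are kept because the condition is then linear
  or conjugate linear in each of them, which makes density arguments possible.\<close>

definition almost_invariant :: "'v \<Rightarrow> 'v \<Rightarrow> bool" where
  "almost_invariant v y \<longleftrightarrow> (\<forall>e>0. \<exists>F. finite F \<and> F \<subseteq> carrier G \<and>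
     (\<forall>g\<in>centralizer F. \<forall>a. contractive a \<longrightarrow> cmod (variation g a v y) \<le> e))"

lemma contractive_alg: "contractive a \<Longrightarrow> a \<in> group_alg G"
  unfolding contractive_def by blast

lemma contractive_nm: "contractive a \<Longrightarrow> x \<in> X \<Longrightarrow> nm (rop a x) \<le> nm x"
  unfolding contractive_def by blast

lemma contractive_ip:
  assumes "contractive a" "v \<in> X" "y \<in> X"
  shows "cmod (ip (rop a v) y) \<le> nm v * nm y"
proof -
  have "cmod (ip (rop a v) y) \<le> nm (rop a v) * nm y"
    by (rule Cauchy_Schwarz) (use assms contractive_alg in auto)
  also have "\<dots> \<le> nm v * nm y" by (intro mult_right_mono contractive_nm) (use assms in auto)
  finally show ?thesis .
qed

lemma centralizerD: "g \<in> centralizer F \<Longrightarrow> g \<in> carrier G"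
  unfolding centralizer_def by blast

lemma centralizer_antimono: "F \<subseteq> F' \<Longrightarrow> centralizer F' \<subseteq> centralizer F"
  unfolding centralizer_def by blast

lemma variation_le:
  assumes "g \<in> carrier G" "contractive a" "v \<in> X" "y \<in> X"
  shows "cmod (variation g a v y) \<le> 2 * nm v * nm y"
  using contractive_ip[of a "\<pi> g v" "\<pi> g y"] contractive_ip[of a v y] assms
    norm_triangle_ineq4[of "ip (rop a (\<pi> g v)) (\<pi> g y)" "ip (rop a v) y"]
  unfolding variation_def by simp

lemma variation_add_right:
  "g \<in> carrier G \<Longrightarrow> contractive a \<Longrightarrow> v \<in> X \<Longrightarrow> y \<in> X \<Longrightarrow> z \<in> X \<Longrightarrow>
    variation g a v (y + z) = variation g a v y + variation g a v z"
  using contractive_alg[of a] unfolding variation_def by (simp add: op_add ip_add_right)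

text \<open>\<open>D\<close> stands for \<open>variation\<close> as a function of either argument.
  Scaling is required for the modulus only, since the second argument enters conjugate linearly.
  Finite sets are united for sums, and the uniform bound \<open>K\<close> carries the property to
  limits.\<close>

lemma closed_subspace_small:
  fixes D :: "'g \<Rightarrow> ('g \<Rightarrow> complex) \<Rightarrow> 'v \<Rightarrow> complex"
  assumes add: "\<And>g a v w. g \<in> carrier G \<Longrightarrow> contractive a \<Longrightarrow> v \<in> X \<Longrightarrow> w \<in> X \<Longrightarrow> D g a (v + w) = D g a v + D g a w"
    and scale: "\<And>g a v c. g \<in> carrier G \<Longrightarrow> contractive a \<Longrightarrow> v \<in> X \<Longrightarrow> cmod (D g a (sc c v)) = cmod c * cmod (D g a v)"
    and le: "\<And>g a v. g \<in> carrier G \<Longrightarrow> contractive a \<Longrightarrow> v \<in> X \<Longrightarrow> cmod (D g a v) \<le> K * nm v"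
  shows "closed_subspace {v \<in> X. \<forall>e>0. \<exists>F. finite F \<and> F \<subseteq> carrier G \<and>
     (\<forall>g\<in>centralizer F. \<forall>a. contractive a \<longrightarrow> cmod (D g a v) \<le> e)}" (is "closed_subspace ?W")
proof -
  have zero: "D g a 0 = 0" if "g \<in> carrier G" "contractive a" for g a
    using add[OF that zero_in zero_in] by simp
  have W_in: "v \<in> X" if "v \<in> ?W" for v using that by blast
  have W_D: "\<exists>F. finite F \<and> F \<subseteq> carrier G \<and>
      (\<forall>g\<in>centralizer F. \<forall>a. contractive a \<longrightarrow> cmod (D g a v) \<le> e)" if "v \<in> ?W" "e > 0" for v e
    using that by blast
  have "vs.subspace ?W"
  proof (rule vs.subspaceI)
    show "0 \<in> ?W" using zero centralizerD by (auto intro!: exI[of _ "{}"])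
  next
    fix v w assume vw: "v \<in> ?W" "w \<in> ?W"
    have "\<exists>F. finite F \<and> F \<subseteq> carrier G \<and>
      (\<forall>g\<in>centralizer F. \<forall>a. contractive a \<longrightarrow> cmod (D g a (v + w)) \<le> e)" if e: "e > 0" for e
    proof -
      obtain F where F: "finite F" "F \<subseteq> carrier G"
        "\<forall>g\<in>centralizer F. \<forall>a. contractive a \<longrightarrow> cmod (D g a v) \<le> e/2"
        using W_D[OF vw(1), of "e/2"] e by auto
      obtain F' where F': "finite F'" "F' \<subseteq> carrier G"
        "\<forall>g\<in>centralizer F'. \<forall>a. contractive a \<longrightarrow> cmod (D g a w) \<le> e/2"
        using W_D[OF vw(2), of "e/2"] e by auto
      have "cmod (D g a (v + w)) \<le> e" if g: "g \<in> centralizer (F \<union> F')" and a: "contractive a" for g a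
      proof -
        have "g \<in> centralizer F" "g \<in> centralizer F'"
          using g centralizer_antimono[of F "F \<union> F'"] centralizer_antimono[of F' "F \<union> F'"] by auto
        then have "cmod (D g a v) \<le> e/2" "cmod (D g a w) \<le> e/2" using F(3) F'(3) a by auto
        then show ?thesis
          using add[OF centralizerD[OF g] a W_in[OF vw(1)] W_in[OF vw(2)]]
            norm_triangle_ineq[of "D g a v" "D g a w"] by simp
      qed
      then show ?thesis using F F' by (intro exI[of _ "F \<union> F'"]) auto
    qed
    then show "v + w \<in> ?W" using W_in[OF vw(1)] W_in[OF vw(2)] by simp
  next
    fix c v assume v: "v \<in> ?W"
    have "\<exists>F. finite F \<and> F \<subseteq> carrier G \<and>
      (\<forall>g\<in>centralizer F. \<forall>a. contractive a \<longrightarrow> cmod (D g a (sc c v)) \<le> e)" if e: "e > 0" for e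
    proof -
      have e': "e / (cmod c + 1) > 0" using e by (simp add: add_nonneg_pos)
      obtain F where F: "finite F" "F \<subseteq> carrier G"
        "\<forall>g\<in>centralizer F. \<forall>a. contractive a \<longrightarrow> cmod (D g a v) \<le> e / (cmod c + 1)"
        using W_D[OF v e'] by auto
      have "cmod (D g a (sc c v)) \<le> e" if g: "g \<in> centralizer F" and a: "contractive a" for g a
      proof -
        have "cmod c * cmod (D g a v) \<le> (cmod c + 1) * (e / (cmod c + 1))"
          using F(3) g a by (intro mult_mono) auto
        also have "\<dots> = e" using norm_ge_zero[of c] by (simp add: add_nonneg_eq_0_iff)
        finally show ?thesis using scale[OF centralizerD[OF g] a W_in[OF v]] by simp
      qed
      then show ?thesis using F by (intro exI[of _ F]) auto
    qed
    then show "sc c v \<in> ?W" using W_in[OF v] by simp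
  qed
  moreover have "x \<in> ?W" if u: "\<And>k::nat. u k \<in> ?W" and x: "x \<in> X" and lim: "(\<lambda>k. nm (u k - x)) \<longlonglongrightarrow> 0" for u x
  proof -
    have "\<exists>F. finite F \<and> F \<subseteq> carrier G \<and>
      (\<forall>g\<in>centralizer F. \<forall>a. contractive a \<longrightarrow> cmod (D g a x) \<le> e)" if e: "e > 0" for e
    proof -
      have "(\<lambda>k. K * nm (u k - x)) \<longlonglongrightarrow> 0" using tendsto_mult_left[OF lim, of K] by simp
      then have "\<forall>\<^sub>F k in sequentially. K * nm (u k - x) < e/2"
        by (rule order_tendstoD) (use e in simp)
      then obtain k where k: "K * nm (u k - x) < e/2" by (auto simp: eventually_sequentially)
      have uk: "u k \<in> X" using W_in[OF u] .
      obtain F where F: "finite F" "F \<subseteq> carrier G"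
        "\<forall>g\<in>centralizer F. \<forall>a. contractive a \<longrightarrow> cmod (D g a (u k)) \<le> e/2"
        using W_D[OF u, of "e/2" k] e by auto
      have "cmod (D g a x) \<le> e" if g: "g \<in> centralizer F" and a: "contractive a" for g a
      proof -
        note gG = centralizerD[OF g]
        have "D g a x = D g a (u k) + D g a (x - u k)"
          using add[OF gG a uk, of "x - u k"] x uk by simp
        moreover have "cmod (D g a (x - u k)) \<le> e/2"
          using le[OF gG a, of "x - u k"] x uk k nm_diff_commute[of x "u k"] by simp
        moreover have "cmod (D g a (u k)) \<le> e/2" using F(3) g a by auto
        ultimately show ?thesis using norm_triangle_ineq[of "D g a (u k)" "D g a (x - u k)"] by simp
      qed
      then show ?thesis using F by (intro exI[of _ F]) auto
    qed
    then show ?thesis using x by simp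
  qed
  ultimately show ?thesis unfolding closed_subspace_def by auto
qed

lemma closed_subspace_almost_invariant_left:
  assumes y: "y \<in> X"
  shows "closed_subspace {v \<in> X. almost_invariant v y}"
  unfolding almost_invariant_def
proof (rule closed_subspace_small[where K = "2 * nm y"])
  fix g a v w c assume g: "g \<in> carrier G" and "contractive a" and v: "v \<in> X"
  then have a: "a \<in> group_alg G" and c: "contractive a" using contractive_alg by auto
  show "variation g a (v + w) y = variation g a v y + variation g a w y" if "w \<in> X"
    unfolding variation_def using g a v y that by (simp add: op_add ip_add_left)
  have "variation g a (sc c v) y = c * variation g a v y"
    unfolding variation_def using g a v y by (simp add: op_scale ip_scale_left algebra_simps)
  then show "cmod (variation g a (sc c v) y) = cmod c * cmod (variation g a v y)"
    by (simp add: norm_mult)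
  show "cmod (variation g a v y) \<le> 2 * nm y * nm v"
    using variation_le[OF g c v y] by (simp add: mult_ac)
qed

lemma closed_subspace_almost_invariant_right:
  assumes y: "y \<in> X"
  shows "closed_subspace {v \<in> X. almost_invariant y v}"
  unfolding almost_invariant_def
proof (rule closed_subspace_small[where K = "2 * nm y"])
  fix g a v w c assume g: "g \<in> carrier G" and "contractive a" and v: "v \<in> X"
  then have a: "a \<in> group_alg G" and c: "contractive a" using contractive_alg by auto
  show "variation g a y (v + w) = variation g a y v + variation g a y w" if "w \<in> X"
    using variation_add_right[OF g c y v that] .
  have "variation g a y (sc c v) = cnj c * variation g a y v"
    unfolding variation_def using g a v y by (simp add: op_scale ip_scale_right algebra_simps)
  then show "cmod (variation g a y (sc c v)) = cmod c * cmod (variation g a y v)"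
    by (simp add: norm_mult)
  show "cmod (variation g a y v) \<le> 2 * nm y * nm v"
    using variation_le[OF g c y v] by (simp add: mult_ac)
qed

end

section \<open>Almost invariance in finite von Neumann algebras\<close>

lemma abs_half_diff_le:
  fixes a b A B s :: real
  assumes "A - B = 2 * (b - a)" "\<bar>A\<bar> \<le> s" "\<bar>B\<bar> \<le> s"
  shows "\<bar>b - a\<bar> \<le> s"
  using assms unfolding abs_le_iff by argo

context urep
begin

lemma rop_commutes:
  assumes a: "a \<in> group_alg G" and g: "g \<in> centralizer {h. a h \<noteq> 0}" and x: "x \<in> X"
  shows "\<pi> g (rop a x) = rop a (\<pi> g x)"
proof -
  note ga = group_algD(2)[OF a] and gG = centralizerD[OF g]
  have "\<pi> g (rop a x) = (\<Sum>h | a h \<noteq> 0. \<pi> g (sc (a h) (\<pi> h x)))"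
    unfolding rop_apply[OF x] by (rule op_sum) (use ga gG x in auto)
  also have "\<dots> = rop a (\<pi> g x)"
    unfolding rop_apply[OF \<pi>_in[OF gG x]]
  proof (rule sum.cong[OF refl])
    fix h assume h: "h \<in> {h. a h \<noteq> 0}"
    then have hG: "h \<in> carrier G" using ga by auto
    have "g \<otimes>\<^bsub>G\<^esub> h = h \<otimes>\<^bsub>G\<^esub> g" using g h unfolding centralizer_def by auto
    then have "\<pi> g (\<pi> h x) = \<pi> h (\<pi> g x)"
      using \<pi>_mult[OF gG hG x] \<pi>_mult[OF hG gG x] by simp
    then show "\<pi> g (sc (a h) (\<pi> h x)) = sc (a h) (\<pi> h (\<pi> g x))"
      using gG hG x by (simp add: op_scale)
  qed
  finally show ?thesis .
qed

lemma almost_invariantI: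
  assumes "\<And>e. e > 0 \<Longrightarrow> \<exists>F. finite F \<and> F \<subseteq> carrier G \<and>
     (\<forall>g\<in>centralizer F. \<forall>a. contractive a \<longrightarrow> cmod (variation g a v y) \<le> e)"
  shows "almost_invariant v y"
  unfolding almost_invariant_def using assms by blast

text \<open>The operators over which the functional is minimized. They include \<open>rop a\<close>,
  the support of \<open>a\<close> being finite, and are stable under linear operations and under
  conjugation by \<open>\<pi> g\<close>; these are the directions in which the Euler equation gets
  tested.\<close>

definition finitely_centralized :: "('v \<Rightarrow> 'v) set" where
  "finitely_centralized = {b \<in> N. \<exists>F. finite F \<and> F \<subseteq> carrier G \<and>
     (\<forall>g\<in>centralizer F. \<forall>x\<in>X. \<pi> g (b x) = b (\<pi> g x))}"

lemma finitely_centralized_N: "b \<in> finitely_centralized \<Longrightarrow> b \<in> N"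
  unfolding finitely_centralized_def by blast

lemma finitely_centralizedE:
  assumes "b \<in> finitely_centralized"
  obtains F where "finite F" "F \<subseteq> carrier G" "\<forall>g\<in>centralizer F. \<forall>x\<in>X. \<pi> g (b x) = b (\<pi> g x)"
  using assms unfolding finitely_centralized_def by blast

lemma finitely_centralized_binary:
  assumes b: "b \<in> finitely_centralized" and c: "c \<in> finitely_centralized" and d: "d \<in> N"
    and comb: "\<And>g x. g \<in> carrier G \<Longrightarrow> x \<in> X \<Longrightarrow> \<forall>x\<in>X. \<pi> g (b x) = b (\<pi> g x) \<Longrightarrow>
      \<forall>x\<in>X. \<pi> g (c x) = c (\<pi> g x) \<Longrightarrow> \<pi> g (d x) = d (\<pi> g x)"
  shows "d \<in> finitely_centralized"
proof -
  obtain F where F: "finite F" "F \<subseteq> carrier G" "\<forall>g\<in>centralizer F. \<forall>x\<in>X. \<pi> g (b x) = b (\<pi> g x)"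
    using b by (rule finitely_centralizedE)
  obtain F' where F': "finite F'" "F' \<subseteq> carrier G" "\<forall>g\<in>centralizer F'. \<forall>x\<in>X. \<pi> g (c x) = c (\<pi> g x)"
    using c by (rule finitely_centralizedE)
  have "\<pi> g (d x) = d (\<pi> g x)" if g: "g \<in> centralizer (F \<union> F')" and x: "x \<in> X" for g x
  proof (rule comb[OF centralizerD[OF g] x])
    have "g \<in> centralizer F" "g \<in> centralizer F'"
      using g centralizer_antimono[of F "F \<union> F'"] centralizer_antimono[of F' "F \<union> F'"] by auto
    then show "\<forall>x\<in>X. \<pi> g (b x) = b (\<pi> g x)" "\<forall>x\<in>X. \<pi> g (c x) = c (\<pi> g x)" using F(3) F'(3) by auto
  qed
  then show ?thesis
    unfolding finitely_centralized_def using d F F' by (auto intro!: exI[of _ "F \<union> F'"])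
qed

lemma rop_finitely_centralized: "a \<in> group_alg G \<Longrightarrow> rop a \<in> finitely_centralized"
  unfolding finitely_centralized_def
  using rop_in_N[of a] rop_commutes[of a] group_algD[of a] by (auto intro!: exI[of _ "{h. a h \<noteq> 0}"])

theorem almost_invariant_of_finite:
  assumes fin: "finite_vna H N" and v: "v \<in> X" and y: "y \<in> X"
  shows "almost_invariant v y"
proof -
  interpret vn_algebra H N by unfold_locales (rule von_neumann_algebra_N)
  note Nb = M_bops
  let ?A = finitely_centralized
  note AN = finitely_centralized_N
  note Ab = Nb[OF AN]
  have A_plus: "op_plus H b c \<in> ?A" if "b \<in> ?A" "c \<in> ?A" for b c
    by (rule finitely_centralized_binary[OF that M_plus[OF AN[OF that(1)] AN[OF that(2)]]])
      (use that Ab in \<open>simp add: op_add\<close>)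
  have A_minus: "op_minus H b c \<in> ?A" if "b \<in> ?A" "c \<in> ?A" for b c
    by (rule finitely_centralized_binary[OF that M_minus[OF AN[OF that(1)] AN[OF that(2)]]])
      (use that Ab in \<open>simp add: op_diff\<close>)
  have A_scale: "compose X (scalar_op H t) c \<in> ?A" if "c \<in> ?A" for t c
    by (rule finitely_centralized_binary[OF that that M_compose[OF M_scalar AN[OF that]]])
      (use that Ab in \<open>simp add: op_scale\<close>)
  have A_zero: "scalar_op H t \<in> ?A" for t
    unfolding finitely_centralized_def
    using M_scalar centralizerD by (auto intro!: exI[of _ "{}"] simp: op_scale)
  \<comment> \<open>An element that also commutes with \<open>g\<close> commutes with the conjugate,
    so one more element in the finite set suffices.\<close>
  have conj: "compose X (\<pi> (inv\<^bsub>G\<^esub> g)) (compose X c (\<pi> g)) \<in> ?A" if c: "c \<in> ?A" and g: "g \<in> carrier G" for c g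
  proof -
    note cb = Ab[OF c]
    obtain F where F: "finite F" "F \<subseteq> carrier G" "\<forall>g\<in>centralizer F. \<forall>x\<in>X. \<pi> g (c x) = c (\<pi> g x)"
      using c by (rule finitely_centralizedE)
    have "\<pi> h (\<pi> (inv\<^bsub>G\<^esub> g) (c (\<pi> g x))) = \<pi> (inv\<^bsub>G\<^esub> g) (c (\<pi> g (\<pi> h x)))"
      if h: "h \<in> centralizer (insert g F)" and x: "x \<in> X" for h x
    proof -
      have hG: "h \<in> carrier G" and hF: "h \<in> centralizer F" and hg: "h \<otimes>\<^bsub>G\<^esub> g = g \<otimes>\<^bsub>G\<^esub> h"
        using h unfolding centralizer_def by auto
      have comm: "\<pi> h (\<pi> g z) = \<pi> g (\<pi> h z)" if "z \<in> X" for z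
        using \<pi>_mult[OF hG g that] \<pi>_mult[OF g hG that] hg by simp
      have comm': "\<pi> h (\<pi> (inv\<^bsub>G\<^esub> g) z) = \<pi> (inv\<^bsub>G\<^esub> g) (\<pi> h z)" if z: "z \<in> X" for z
      proof -
        have "\<pi> (inv\<^bsub>G\<^esub> g) (\<pi> h (\<pi> g (\<pi> (inv\<^bsub>G\<^esub> g) z))) = \<pi> (inv\<^bsub>G\<^esub> g) (\<pi> g (\<pi> h (\<pi> (inv\<^bsub>G\<^esub> g) z)))"
          using comm[of "\<pi> (inv\<^bsub>G\<^esub> g) z"] z g by simp
        then show ?thesis using z g hG by (simp add: \<pi>_inv1 \<pi>_inv2)
      qed
      show ?thesis using comm'[of "c (\<pi> g x)"] comm[OF x] F(3) hF x g cb by simp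
    qed
    then show ?thesis
      unfolding finitely_centralized_def using F g M_compose[OF \<pi>_in_N M_compose[OF AN[OF c] \<pi>_in_N]] centralizerD
      by (auto intro!: exI[of _ "insert g F"])
  qed
  have W: "closed_subspace {y \<in> X. almost_invariant v y}"
    by (rule closed_subspace_almost_invariant_right[OF v])
  have "{y \<in> X. almost_invariant v y} = X"
  proof (rule closed_subspace_eq_X[OF W], rule ccontr)
    fix p assume p: "p \<in> X" and orth: "\<And>y. y \<in> {y \<in> X. almost_invariant v y} \<Longrightarrow> ip y p = 0" and p0: "p \<noteq> 0"
    obtain e where e: "projects_onto e (hclosure (orbit p))"
      using projection_op[OF closed_subspace_orbit[OF p]] by blast
    note e_pos = orbit_projection(1)[OF p e] and ep = orbit_projection(2)[OF p e]
    \<comment> \<open>Finiteness supplies a trace adapted to \<open>e\<close>; the contradiction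
      will be \<open>\<phi> e = 0\<close>.\<close>
    have "e \<noteq> scalar_op H 0" using ep p0 p by auto
    then obtain \<phi> where \<phi>: "finite_trace H N \<phi>" "normal_trace H N \<phi>" "\<phi> e \<noteq> 0"
      using fin e_pos unfolding finite_vna_def by blast
    interpret traced H N \<phi> by unfold_locales (rule \<phi>(1))
    let ?tn = trace_norm2
    define J where "J b = (nm (p - b v))\<^sup>2 + ?tn b" for b
    \<comment> \<open>The trace part is twice the real part of the trace of
      \<open>c\<^sup>* b\<close>, in the polarized form of \<open>trace_norm2_line\<close>.\<close>
    define L where "L b c = - 2 * Re (ip (p - b v) (c v)) + (?tn b + ?tn c - ?tn (op_minus H b c))" for b c
    define q where "q c = (nm (c v))\<^sup>2 + ?tn c" for c
    obtain u d where u: "\<And>k::nat. u k \<in> ?A" and d: "\<And>k. 0 \<le> d k" "d \<longlonglongrightarrow> (0::real)"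
      and Lq: "\<And>k c. c \<in> ?A \<Longrightarrow> (L (u k) c)\<^sup>2 \<le> 4 * d k * q c"
      and Q: "\<And>j k. q (op_minus H (u j) (u k)) \<le> 2 * (d j + d k)"
    proof (rule quadratic_minimizing_sequence[of ?A 0 J
          "\<lambda>r b c. op_plus H b (compose X (scalar_op H (complex_of_real r)) c)" L q "op_minus H"])
      show "?A \<noteq> {}" using A_zero by blast
      show "0 \<le> J b" if "b \<in> ?A" for b unfolding J_def using trace_norm2_ge0[OF AN[OF that]] by simp
      show "0 \<le> q b" if "b \<in> ?A" for b unfolding q_def using trace_norm2_ge0[OF AN[OF that]] by simp
      show "op_plus H b (compose X (scalar_op H (complex_of_real r)) c) \<in> ?A" if "b \<in> ?A" "c \<in> ?A" for r b c
        using A_plus A_scale that by blast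
      show "op_minus H b c \<in> ?A" if "b \<in> ?A" "c \<in> ?A" for b c using A_minus that by blast
      show "op_plus H c (compose X (scalar_op H (complex_of_real 1)) (op_minus H b c)) = b"
        if "b \<in> ?A" "c \<in> ?A" for b c
        by (rule op_eqI) (use that Ab in auto)
      show "J (op_plus H b (compose X (scalar_op H (complex_of_real r)) c)) = J b + r * L b c + r\<^sup>2 * q c"
        if bc: "b \<in> ?A" "c \<in> ?A" for r b c
      proof -
        note bb = Ab[OF bc(1)] and cb = Ab[OF bc(2)]
        have "p - op_plus H b (compose X (scalar_op H (complex_of_real r)) c) v
            = (p - b v) + sc (complex_of_real (- r)) (c v)"
          using v p bb cb by (simp add: diff_diff_eq)
        then have "(nm (p - op_plus H b (compose X (scalar_op H (complex_of_real r)) c) v))\<^sup>2 =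
            (nm (p - b v))\<^sup>2 + (- r) * (2 * Re (ip (p - b v) (c v))) + (- r)\<^sup>2 * (nm (c v))\<^sup>2"
          by (simp only: nm_add_scale_sq[OF diff_in[OF p op_in[OF bb v]] op_in[OF cb v]])
        then show ?thesis
          unfolding J_def L_def q_def trace_norm2_line[OF AN[OF bc(1)] AN[OF bc(2)]]
          by (simp add: algebra_simps)
      qed
    qed (rule that)
    note ub = Ab[OF u]
    define z where "z k = p - u k v" for k
    have zX: "z k \<in> X" for k unfolding z_def using p v ub by simp
    have "\<exists>N. \<forall>j\<ge>N. \<forall>k\<ge>N. nm (z j - z k) < a" if a: "a > 0" for a
    proof -
      have "\<forall>\<^sub>F k in sequentially. d k < a\<^sup>2 / 4"
        by (rule order_tendstoD(2)[OF d(2)]) (use a in simp)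
      then obtain N where N: "\<And>k. k \<ge> N \<Longrightarrow> d k < a\<^sup>2 / 4" unfolding eventually_sequentially by blast
      have "nm (z j - z k) < a" if "j \<ge> N" "k \<ge> N" for j k
      proof (rule power2_less_imp_less)
        have "nm (z j - z k) = nm (u j v - u k v)"
          using nm_diff_commute[of "u j v" "u k v"] ub v unfolding z_def by simp
        moreover have "(nm (u j v - u k v))\<^sup>2 \<le> q (op_minus H (u j) (u k))"
          unfolding q_def using v trace_norm2_ge0[OF AN[OF A_minus[OF u u]]] by simp
        ultimately show "(nm (z j - z k))\<^sup>2 < a\<^sup>2"
          using Q[of j k] N[OF that(1)] N[OF that(2)] by simp
      qed (use a in simp)
      then show ?thesis by blast
    qed
    then obtain y where y: "y \<in> X" and lim: "(\<lambda>k. nm (z k - y)) \<longlonglongrightarrow> 0"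
      using complete[of z] zX by blast
    \<comment> \<open>Bounds \<open>q c\<close> for every contraction \<open>c\<close> at once; the
      uniformity in the group algebra element rests on this.\<close>
    define C where "C = (nm v)\<^sup>2 + ?tn (scalar_op H 1)"
    have C0: "0 \<le> C" unfolding C_def using trace_norm2_ge0[OF M_scalar] by simp
    have L_le: "\<bar>L (u k) c\<bar> \<le> 2 * sqrt (d k * C)"
      if c: "c \<in> ?A" and cc: "\<And>x. x \<in> X \<Longrightarrow> nm (c x) \<le> nm x" for k c
    proof -
      have "?tn c \<le> ?tn (scalar_op H 1)"
        by (rule trace_norm2_mono) (use AN[OF c] M_scalar cc in auto)
      moreover have "(nm (c v))\<^sup>2 \<le> (nm v)\<^sup>2"
        by (rule power_mono) (use cc v Ab[OF c] in auto)
      ultimately have "q c \<le> C" unfolding q_def C_def by simp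
      then have "4 * d k * q c \<le> 4 * d k * C" using d(1)[of k] by (intro mult_left_mono) auto
      then have "(L (u k) c)\<^sup>2 \<le> 4 * d k * C" using Lq[OF c, of k] by linarith
      then have "sqrt ((L (u k) c)\<^sup>2) \<le> sqrt (4 * d k * C)" by (rule real_sqrt_le_mono)
      then show ?thesis by (simp add: real_sqrt_mult)
    qed
    \<comment> \<open>The Euler equation is used at \<open>c\<close> and at its conjugate by
      \<open>\<pi> g\<close>. As \<open>u k\<close> commutes with \<open>\<pi> g\<close>, the trace
      parts agree and cancel, which leaves the two inner products.\<close>
    have re: "\<bar>Re (ip (c (\<pi> g v)) (\<pi> g (z k)) - ip (c v) (z k))\<bar> \<le> 2 * sqrt (d k * C)"
      if c: "c \<in> ?A" and cc: "\<And>x. x \<in> X \<Longrightarrow> nm (c x) \<le> nm x"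
        and g: "g \<in> carrier G" and gu: "\<forall>x\<in>X. \<pi> g (u k x) = u k (\<pi> g x)" for k c g
    proof -
      let ?conj = "\<lambda>T. compose X (\<pi> (inv\<^bsub>G\<^esub> g)) (compose X T (\<pi> g))"
      note cb = Ab[OF c]
      have gi: "inv\<^bsub>G\<^esub> g \<in> carrier G" using g by simp
      have tn: "?tn (?conj T) = ?tn T" if T: "T \<in> N" for T
        using trace_norm2_isometry[OF M_compose[OF T \<pi>_in_N[OF g]] \<pi>_in_N[OF gi]] gi
          trace_norm2_isometry_right[OF T \<pi>_in_N[OF g]] g adj_\<pi>[OF g] by simp
      have "op_minus H (u k) (?conj c) = ?conj (op_minus H (u k) c)"
      proof (rule op_eqI)
        fix x assume x: "x \<in> X"
        have "\<pi> (inv\<^bsub>G\<^esub> g) (u k (\<pi> g x)) = u k x"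
          using gu x g ub[of k] \<pi>_inv1[OF g, of "u k x"] by simp
        then show "op_minus H (u k) (?conj c) x = ?conj (op_minus H (u k) c) x"
          using x g gi cb ub[of k] by (simp add: op_diff)
      qed (use g gi cb ub in auto)
      then have "?tn (op_minus H (u k) (?conj c)) = ?tn (op_minus H (u k) c)"
        using tn[OF M_minus[OF AN[OF u] AN[OF c]]] by simp
      then have "L (u k) c - L (u k) (?conj c) =
          2 * (Re (ip (z k) (?conj c v)) - Re (ip (z k) (c v)))"
        unfolding L_def z_def using tn[OF AN[OF c]] by simp
      moreover have "\<bar>L (u k) c\<bar> \<le> 2 * sqrt (d k * C)" by (rule L_le[OF c cc])
      moreover have "\<bar>L (u k) (?conj c)\<bar> \<le> 2 * sqrt (d k * C)"
      proof (rule L_le[OF conj[OF c g]])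
        fix x assume "x \<in> X"
        then show "nm (?conj c x) \<le> nm x" using g gi cb cc[of "\<pi> g x"] by simp
      qed
      ultimately have "\<bar>Re (ip (z k) (?conj c v)) - Re (ip (z k) (c v))\<bar> \<le> 2 * sqrt (d k * C)"
        by (rule abs_half_diff_le)
      moreover have "Re (ip (z k) (?conj c v)) = Re (ip (c (\<pi> g v)) (\<pi> g (z k)))"
        using Re_ip_commute[of "?conj c v" "z k"] ip_\<pi>_left[OF gi, of "c (\<pi> g v)" "z k"] g gi cb v zX[of k] by simp
      moreover have "Re (ip (z k) (c v)) = Re (ip (c v) (z k))"
        by (rule Re_ip_commute) (use cb v zX in auto)
      ultimately show ?thesis by simp
    qed
    have var: "cmod (variation g a v (z k)) \<le> 4 * sqrt (d k * C)"
      if a: "contractive a" and g: "g \<in> carrier G" and gu: "\<forall>x\<in>X. \<pi> g (u k x) = u k (\<pi> g x)" for k a g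
    proof -
      have aA: "rop a \<in> ?A" using rop_finitely_centralized contractive_alg[OF a] by blast
      note ab = Ab[OF aA]
      have 1: "\<bar>Re (variation g a v (z k))\<bar> \<le> 2 * sqrt (d k * C)"
        unfolding variation_def by (rule re[OF aA contractive_nm[OF a] g gu])
      \<comment> \<open>The same bound for \<open>\<i>\<close> times the operator controls the
        imaginary part.\<close>
      have "\<bar>Re (ip (compose X (scalar_op H \<i>) (rop a) (\<pi> g v)) (\<pi> g (z k)) -
          ip (compose X (scalar_op H \<i>) (rop a) v) (z k))\<bar> \<le> 2 * sqrt (d k * C)"
      proof (rule re[OF A_scale[OF aA] _ g gu])
        fix x assume "x \<in> X"
        then show "nm (compose X (scalar_op H \<i>) (rop a) x) \<le> nm x"
          using contractive_nm[OF a, of x] ab by (simp add: nm_scale)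
      qed
      then have 2: "\<bar>Im (variation g a v (z k))\<bar> \<le> 2 * sqrt (d k * C)"
        unfolding variation_def using v g zX[of k] ab by (simp add: ip_scale_left abs_minus_commute)
      show ?thesis using cmod_le[of "variation g a v (z k)"] 1 2 by linarith
    qed
    have "almost_invariant v y"
    proof (rule almost_invariantI)
      fix a :: real assume a: "a > 0"
      have "(\<lambda>k. 4 * sqrt (d k * C)) \<longlonglongrightarrow> 4 * sqrt (0 * C)"
        by (intro tendsto_intros d)
      then have "\<forall>\<^sub>F k in sequentially. 4 * sqrt (d k * C) < a / 2"
        by (rule order_tendstoD(2)) (use a in simp)
      moreover have "(\<lambda>k. 2 * nm v * nm (z k - y)) \<longlonglongrightarrow> 0"
        using tendsto_mult_left[OF lim, of "2 * nm v"] by simp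
      then have "\<forall>\<^sub>F k in sequentially. 2 * nm v * nm (z k - y) < a / 2"
        by (rule order_tendstoD(2)) (use a in simp)
      ultimately have "\<forall>\<^sub>F k in sequentially. 4 * sqrt (d k * C) < a / 2 \<and> 2 * nm v * nm (z k - y) < a / 2"
        by (rule eventually_conj)
      \<comment> \<open>\<open>k\<close> is fixed by the two error terms before the finite set is
        chosen, because that set depends on \<open>u k\<close>.\<close>
      then obtain k where k: "4 * sqrt (d k * C) < a / 2" "2 * nm v * nm (z k - y) < a / 2"
        by (auto simp: eventually_sequentially)
      obtain F where F: "finite F" "F \<subseteq> carrier G" "\<forall>g\<in>centralizer F. \<forall>x\<in>X. \<pi> g (u k x) = u k (\<pi> g x)"
        using u[of k] by (rule finitely_centralizedE)
      have "cmod (variation g b v y) \<le> a" if g: "g \<in> centralizer F" and b: "contractive b" for g b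
      proof -
        note gG = centralizerD[OF g]
        note bb = rop_bops[OF contractive_alg[OF b]]
        have "variation g b v y = variation g b v (z k) + variation g b v (y - z k)"
          using variation_add_right[OF gG b v zX[of k], of "y - z k"] y zX[of k] by simp
        moreover have "cmod (variation g b v (z k)) \<le> a / 2"
          using var[OF b gG, of k] F(3) g k(1) by force
        moreover have "cmod (variation g b v (y - z k)) \<le> a / 2"
          using variation_le[OF gG b v, of "y - z k"] y zX[of k] nm_diff_commute[of y "z k"] k(2) by simp
        ultimately show ?thesis
          using norm_triangle_ineq[of "variation g b v (z k)" "variation g b v (y - z k)"] by simp
      qed
      then show "\<exists>F. finite F \<and> F \<subseteq> carrier G \<and>
          (\<forall>g\<in>centralizer F. \<forall>b. contractive b \<longrightarrow> cmod (variation g b v y) \<le> a)"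
        using F by blast
    qed
    then have yp: "ip y p = 0" using orth[of y] y by blast
    \<comment> \<open>Half the derivative at \<open>u k\<close> in the direction of
      \<open>u k\<close> itself.\<close>
    define h where "h k = L (u k) (u k) / 2" for k
    have L_self: "h k = ?tn (u k) - Re (ip (z k) (u k v))" for k
    proof -
      have "op_minus H (u k) (u k) = scalar_op H 0" by (rule op_eqI) (use ub in auto)
      moreover have "?tn (scalar_op H 0) = 0"
        using trace_norm2_two[of "scalar_op H 0" "scalar_op H 0" "scalar_op H 0" "scalar_op H 0" 1 0 0 0] M_scalar
        by simp
      ultimately show ?thesis unfolding h_def L_def z_def by simp
    qed
    \<comment> \<open>Since \<open>p = z k + u k v\<close>, the value of \<open>J\<close> at
      \<open>u k\<close> equals an expression whose main term tends to \<open>Re (ip y p)\<close>,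
      which is 0.\<close>
    have key: "(nm (z k))\<^sup>2 + ?tn (u k) = Re (ip (z k) p) + h k" for k
    proof -
      have "Re (ip (z k) p) = Re (ip (z k) (z k)) + Re (ip (z k) (u k v))"
        using zX[of k] ub v p unfolding z_def by (simp add: ip_diff_right)
      then show ?thesis using L_self[of k] nm_sq[OF zX] by simp
    qed
    have h_sq: "(h k)\<^sup>2 \<le> d k * ((nm (u k v))\<^sup>2 + ?tn (u k))" for k
      using Lq[OF u, of k k] unfolding h_def q_def by (simp add: power_divide)
    obtain B where B: "\<And>k. nm (z k) \<le> B" "0 \<le> B"
    proof -
      have "(\<lambda>k. nm (z k)) \<longlonglongrightarrow> nm y" by (rule tendsto_nm[OF zX y lim])
      then have "Bseq (\<lambda>k. nm (z k))" by (intro convergent_imp_Bseq convergentI)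
      then obtain B where "0 < B" "\<forall>k. norm (nm (z k)) \<le> B" by (rule BseqE)
      then show ?thesis using that[of B] abs_le_D1 by fastforce
    qed
    obtain D where D: "\<And>k. d k \<le> D" "0 \<le> D"
    proof -
      have "Bseq d" by (intro convergent_imp_Bseq convergentI[OF d(2)])
      then obtain B where "0 < B" "\<forall>k. norm (d k) \<le> B" by (rule BseqE)
      then show ?thesis using that[of B] abs_le_D1 by fastforce
    qed
    \<comment> \<open>The constant comes from absorption: \<open>h k\<close> is at most half of
      \<open>d k + (nm (u k v))\<^sup>2 + ?tn (u k)\<close>, so half of the trace norm moves to the
      left hand side of \<open>key\<close>.\<close>
    define E where "E = 2 * (B * nm p) + D + (nm p + B)\<^sup>2"
    have uv: "(nm (u k v))\<^sup>2 \<le> (nm p + B)\<^sup>2" for k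
    proof (rule power_mono)
      have "u k v = p - z k" unfolding z_def by simp
      then have "nm (u k v) \<le> nm p + nm (z k)" using nm_triangle_diff[OF p zX[of k]] by simp
      then show "nm (u k v) \<le> nm p + B" using B(1)[of k] by simp
    qed (use ub v in simp)
    have tn_le: "?tn (u k) \<le> E" for k
    proof -
      let ?m = "(nm (u k v))\<^sup>2 + ?tn (u k)"
      have m: "0 \<le> ?m" using trace_norm2_ge0[OF AN[OF u]] by simp
      have "(2 * h k)\<^sup>2 \<le> (d k + ?m)\<^sup>2"
        using h_sq[of k] zero_le_power2[of "d k - ?m"] by (simp add: power2_eq_square algebra_simps)
      then have "2 * h k \<le> d k + ?m" by (rule power2_le_imp_le) (use d(1)[of k] m in simp)
      moreover have "Re (ip (z k) p) \<le> B * nm p"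
        using Re_ip_le[OF zX p, of k] mult_right_mono[OF B(1)[of k] nm_ge0[OF p]] by linarith
      ultimately show ?thesis
        using key[of k] zero_le_power2[of "nm (z k)"] uv[of k] D(1)[of k] unfolding E_def by argo
    qed
    have h_lim: "h \<longlonglongrightarrow> 0"
    proof -
      have "(h k)\<^sup>2 \<le> d k * ((nm p + B)\<^sup>2 + E)" for k
        using h_sq[of k] mult_left_mono[of "(nm (u k v))\<^sup>2 + ?tn (u k)" "(nm p + B)\<^sup>2 + E" "d k"]
          uv[of k] tn_le[of k] d(1)[of k] by linarith
      moreover have "(\<lambda>k. d k * ((nm p + B)\<^sup>2 + E)) \<longlonglongrightarrow> 0"
        using tendsto_mult_right[OF d(2), of "(nm p + B)\<^sup>2 + E"] by simp
      ultimately have "(\<lambda>k. (h k)\<^sup>2) \<longlonglongrightarrow> 0"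
        by (intro Lim_null_comparison[of "\<lambda>k. (h k)\<^sup>2" "\<lambda>k. d k * ((nm p + B)\<^sup>2 + E)"]) auto
      then show ?thesis by simp
    qed
    have "(\<lambda>k. Re (ip (z k) p) + h k) \<longlonglongrightarrow> Re (ip y p) + 0"
      by (intro tendsto_intros h_lim tendsto_ip_left[OF zX y p lim])
    then have sum_lim: "(\<lambda>k. (nm (z k))\<^sup>2 + ?tn (u k)) \<longlonglongrightarrow> 0" using yp key by simp
    have "(\<lambda>k. ?tn (u k)) \<longlonglongrightarrow> 0"
      by (rule Lim_null_comparison[OF _ sum_lim]) (use trace_norm2_ge0[OF AN[OF u]] in auto)
    moreover have "(\<lambda>k. (nm (z k))\<^sup>2) \<longlonglongrightarrow> 0"
      by (rule Lim_null_comparison[OF _ sum_lim]) (use trace_norm2_ge0[OF AN[OF u]] in auto)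
    then have "(\<lambda>k. nm (p - u k v)) \<longlonglongrightarrow> 0" unfolding z_def by simp
    ultimately have "\<phi> e = 0"
      by (intro normal_trace_closable[OF \<phi>(2) AN[OF u] _ v p _ e])
    then show False using \<phi>(3) by simp
  qed
  then show ?thesis using y by blast
qed

end

section \<open>Induced representations\<close>

locale induced = urep H "G\<lparr>carrier := K\<rparr>" \<pi> + BG: group G
  for G :: "'g monoid" and K :: "'g set" and H :: "'v::ab_group_add hspace" and \<pi> +
  assumes K_subset: "K \<subseteq> carrier G"
begin

lemma subgroup_K: "subgroup K G"
  by (rule BG.group_incl_imp_subgroup[OF K_subset G.is_group])

lemma K_carrier [simp]: "k \<in> K \<Longrightarrow> k \<in> carrier G"
  using K_subset by blast

lemma K_mult [simp]: "k \<in> K \<Longrightarrow> l \<in> K \<Longrightarrow> k \<otimes>\<^bsub>G\<^esub> l \<in> K"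
  and K_inv [simp]: "k \<in> K \<Longrightarrow> inv\<^bsub>G\<^esub> k \<in> K"
  and K_one [simp]: "\<one>\<^bsub>G\<^esub> \<in> K"
  using subgroup_K by (simp_all add: subgroup.m_closed subgroup.m_inv_closed subgroup.one_closed)

lemma \<pi>K_bops [simp]: "k \<in> K \<Longrightarrow> \<pi> k \<in> bops"
  and \<pi>K_nm [simp]: "k \<in> K \<Longrightarrow> x \<in> X \<Longrightarrow> nm (\<pi> k x) = nm x"
  and \<pi>K_ip: "k \<in> K \<Longrightarrow> x \<in> X \<Longrightarrow> y \<in> X \<Longrightarrow> ip (\<pi> k x) (\<pi> k y) = ip x y"
  and \<pi>K_mult: "k \<in> K \<Longrightarrow> l \<in> K \<Longrightarrow> x \<in> X \<Longrightarrow> \<pi> (k \<otimes>\<^bsub>G\<^esub> l) x = \<pi> k (\<pi> l x)"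
  and \<pi>K_one: "x \<in> X \<Longrightarrow> \<pi> \<one>\<^bsub>G\<^esub> x = x"
  using \<pi>_bops[of k] nm_\<pi>[of k x] \<pi>_ip[of k x y] \<pi>_mult[of k l x] \<pi>_one[of x] by simp_all

section \<open>Cosets and sums over them\<close>

abbreviation "R \<equiv> rcosets\<^bsub>G\<^esub> K"
abbreviation "I \<equiv> ind_space G K H \<pi>"
abbreviation "Y \<equiv> carrier I"

text \<open>The representative that \<open>ind_space\<close> picks, named so that its sums can be
  rewritten.\<close>

definition rep :: "'g set \<Rightarrow> 'g" where
  "rep C = (SOME x. x \<in> C)"

lemma coset_in_R [simp]: "x \<in> carrier G \<Longrightarrow> K #>\<^bsub>G\<^esub> x \<in> R"
  using BG.rcosetsI[OF K_subset] .

lemma R_E: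
  assumes "C \<in> R"
  obtains x where "x \<in> carrier G" "C = K #>\<^bsub>G\<^esub> x"
  using assms unfolding RCOSETS_def by auto

lemma rep_in: assumes "C \<in> R" shows "rep C \<in> C"
proof -
  obtain x where "x \<in> carrier G" "C = K #>\<^bsub>G\<^esub> x" using assms by (rule R_E)
  then have "x \<in> C" using BG.rcos_self[OF _ subgroup_K] by simp
  then show ?thesis unfolding rep_def by (rule someI)
qed

lemma rep_carrier [simp]: assumes "C \<in> R" shows "rep C \<in> carrier G"
proof -
  obtain x where x: "x \<in> carrier G" "C = K #>\<^bsub>G\<^esub> x" using assms by (rule R_E)
  then show ?thesis using rep_in[OF assms] BG.r_coset_subset_G[OF K_subset x(1)] by auto
qed

lemma rep_coset: assumes "C \<in> R" shows "K #>\<^bsub>G\<^esub> rep C = C"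
proof -
  obtain x where x: "x \<in> carrier G" "C = K #>\<^bsub>G\<^esub> x" using assms by (rule R_E)
  then show ?thesis using BG.repr_independence[OF _ x(1) subgroup_K, of "rep C"] rep_in[OF assms] by simp
qed

lemma in_coset_iff:
  "x \<in> carrier G \<Longrightarrow> y \<in> carrier G \<Longrightarrow> y \<in> K #>\<^bsub>G\<^esub> x \<longleftrightarrow> y \<otimes>\<^bsub>G\<^esub> inv\<^bsub>G\<^esub> x \<in> K"
  using subgroup.rcos_module[OF subgroup_K BG.is_group] by blast

lemma coset_eq_iff:
  assumes "x \<in> carrier G" "y \<in> carrier G"
  shows "K #>\<^bsub>G\<^esub> y = K #>\<^bsub>G\<^esub> x \<longleftrightarrow> y \<otimes>\<^bsub>G\<^esub> inv\<^bsub>G\<^esub> x \<in> K"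
  using in_coset_iff[OF assms] BG.repr_independence[OF _ assms(1) subgroup_K, of y]
    BG.rcos_self[OF assms(2) subgroup_K] by auto

text \<open>Such functions live on the coset space, so their sums over \<open>R\<close> do not
  depend on the representatives.\<close>

definition K_invariant :: "('g \<Rightarrow> 'b) \<Rightarrow> bool" where
  "K_invariant F \<longleftrightarrow> (\<forall>k\<in>K. \<forall>x\<in>carrier G. F (k \<otimes>\<^bsub>G\<^esub> x) = F x)"

lemma K_invariant_rep:
  assumes F: "K_invariant F" and x: "x \<in> carrier G"
  shows "F (rep (K #>\<^bsub>G\<^esub> x)) = F x"
proof -
  have "rep (K #>\<^bsub>G\<^esub> x) \<in> K #>\<^bsub>G\<^esub> x" using rep_in[OF coset_in_R[OF x]] .
  then obtain k where "k \<in> K" "rep (K #>\<^bsub>G\<^esub> x) = k \<otimes>\<^bsub>G\<^esub> x" unfolding r_coset_def by auto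
  then show ?thesis using F x unfolding K_invariant_def by simp
qed

lemma bij_betw_translate:
  assumes g: "g \<in> carrier G"
  shows "bij_betw (\<lambda>C. C #>\<^bsub>G\<^esub> g) R R"
proof (rule bij_betw_byWitness[where f' = "\<lambda>C. C #>\<^bsub>G\<^esub> inv\<^bsub>G\<^esub> g"])
  have *: "(K #>\<^bsub>G\<^esub> x) #>\<^bsub>G\<^esub> h = K #>\<^bsub>G\<^esub> (x \<otimes>\<^bsub>G\<^esub> h)" if "x \<in> carrier G" "h \<in> carrier G" for x h
    using BG.coset_mult_assoc[OF K_subset that] .
  show "\<forall>C\<in>R. (C #>\<^bsub>G\<^esub> g) #>\<^bsub>G\<^esub> inv\<^bsub>G\<^esub> g = C" "\<forall>C\<in>R. (C #>\<^bsub>G\<^esub> inv\<^bsub>G\<^esub> g) #>\<^bsub>G\<^esub> g = C"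
    using g by (auto elim!: R_E simp: * BG.m_assoc)
  show "(\<lambda>C. C #>\<^bsub>G\<^esub> g) ` R \<subseteq> R" "(\<lambda>C. C #>\<^bsub>G\<^esub> inv\<^bsub>G\<^esub> g) ` R \<subseteq> R"
    using g by (auto elim!: R_E simp: *)
qed

lemma translate_rep:
  assumes F: "K_invariant F" and g: "g \<in> carrier G" and C: "C \<in> R"
  shows "F (rep C \<otimes>\<^bsub>G\<^esub> g) = F (rep (C #>\<^bsub>G\<^esub> g))"
proof -
  have "C #>\<^bsub>G\<^esub> g = K #>\<^bsub>G\<^esub> (rep C \<otimes>\<^bsub>G\<^esub> g)"
    using BG.coset_mult_assoc[OF K_subset rep_carrier[OF C] g] rep_coset[OF C] by simp
  then show ?thesis using K_invariant_rep[OF F] g C by simp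
qed

lemma summable_translate:
  fixes F :: "'g \<Rightarrow> 'b::{comm_monoid_add, topological_space}"
  assumes F: "K_invariant F" and g: "g \<in> carrier G"
  shows "(\<lambda>C. F (rep C \<otimes>\<^bsub>G\<^esub> g)) summable_on R \<longleftrightarrow> (\<lambda>C. F (rep C)) summable_on R"
proof -
  have "(\<lambda>C. F (rep C \<otimes>\<^bsub>G\<^esub> g)) summable_on R \<longleftrightarrow> (\<lambda>C. F (rep (C #>\<^bsub>G\<^esub> g))) summable_on R"
    by (rule summable_on_cong) (rule translate_rep[OF F g])
  then show ?thesis
    using summable_on_reindex_bij_betw[OF bij_betw_translate[OF g], of "\<lambda>C. F (rep C)"] by simp
qed

text \<open>Right translations permute the cosets. This change of variables is what makes them
  unitary.\<close>

lemma infsum_translate: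
  fixes F :: "'g \<Rightarrow> 'b::{comm_monoid_add, t2_space}"
  assumes F: "K_invariant F" and g: "g \<in> carrier G"
  shows "(\<Sum>\<^sub>\<infinity>C\<in>R. F (rep C \<otimes>\<^bsub>G\<^esub> g)) = (\<Sum>\<^sub>\<infinity>C\<in>R. F (rep C))"
proof -
  have "(\<Sum>\<^sub>\<infinity>C\<in>R. F (rep C \<otimes>\<^bsub>G\<^esub> g)) = (\<Sum>\<^sub>\<infinity>C\<in>R. F (rep (C #>\<^bsub>G\<^esub> g)))"
    by (rule infsum_cong) (rule translate_rep[OF F g])
  then show ?thesis
    using infsum_reindex_bij_betw[OF bij_betw_translate[OF g], of "\<lambda>C. F (rep C)"] by simp
qed

section \<open>The Hilbert space of the induced representation\<close>

definition equivariant :: "('g \<Rightarrow> 'v) \<Rightarrow> bool" where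
  "equivariant f \<longleftrightarrow> (\<forall>x\<in>carrier G. f x \<in> X) \<and> (\<forall>x. x \<notin> carrier G \<longrightarrow> f x = 0) \<and>
     (\<forall>k\<in>K. \<forall>x\<in>carrier G. f (k \<otimes>\<^bsub>G\<^esub> x) = \<pi> k (f x))"

lemma Y_iff: "f \<in> Y \<longleftrightarrow> equivariant f \<and> (\<lambda>C. (nm (f (rep C)))\<^sup>2) summable_on R"
  unfolding ind_space_def equivariant_def rep_def by auto

lemma I_sc [simp]: "scal I c f = (\<lambda>x. sc c (f x))"
  and I_ip: "iprod I f g = (\<Sum>\<^sub>\<infinity>C\<in>R. ip (f (rep C)) (g (rep C)))"
  unfolding ind_space_def rep_def by simp_all

lemma equivariantD:
  assumes "equivariant f"
  shows "x \<in> carrier G \<Longrightarrow> f x \<in> X" "x \<notin> carrier G \<Longrightarrow> f x = 0"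
    "k \<in> K \<Longrightarrow> x \<in> carrier G \<Longrightarrow> f (k \<otimes>\<^bsub>G\<^esub> x) = \<pi> k (f x)"
proof -
  note e = assms[unfolded equivariant_def]
  show "x \<in> carrier G \<Longrightarrow> f x \<in> X" using e[THEN conjunct1] by blast
  show "x \<notin> carrier G \<Longrightarrow> f x = 0" using e[THEN conjunct2, THEN conjunct1] by blast
  show "k \<in> K \<Longrightarrow> x \<in> carrier G \<Longrightarrow> f (k \<otimes>\<^bsub>G\<^esub> x) = \<pi> k (f x)"
    using e[THEN conjunct2, THEN conjunct2] by blast
qed

lemma Y_in [simp]: "f \<in> Y \<Longrightarrow> x \<in> carrier G \<Longrightarrow> f x \<in> X"
  and Y_out: "f \<in> Y \<Longrightarrow> x \<notin> carrier G \<Longrightarrow> f x = 0"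
  and Y_equivariant: "f \<in> Y \<Longrightarrow> k \<in> K \<Longrightarrow> x \<in> carrier G \<Longrightarrow> f (k \<otimes>\<^bsub>G\<^esub> x) = \<pi> k (f x)"
  and Y_summable: "f \<in> Y \<Longrightarrow> (\<lambda>C. (nm (f (rep C)))\<^sup>2) summable_on R"
  unfolding Y_iff by (simp_all add: equivariantD)

lemma Y_eqI:
  assumes "f \<in> Y" "g \<in> Y" "\<And>x. x \<in> carrier G \<Longrightarrow> f x = g x"
  shows "f = g"
proof
  show "f x = g x" for x
    by (cases "x \<in> carrier G") (simp_all add: assms(3) Y_out[OF assms(1)] Y_out[OF assms(2)])
qed

lemma K_invariant_nm: "equivariant f \<Longrightarrow> K_invariant (\<lambda>x. (nm (f x))\<^sup>2)"
  unfolding K_invariant_def by (simp add: equivariantD)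

lemma K_invariant_ip: "equivariant f \<Longrightarrow> equivariant g \<Longrightarrow> K_invariant (\<lambda>x. ip (f x) (g x))"
  unfolding K_invariant_def by (simp add: equivariantD \<pi>K_ip)

lemma Y_ip_abs_summable:
  assumes f: "f \<in> Y" and g: "g \<in> Y"
  shows "(\<lambda>C. ip (f (rep C)) (g (rep C))) summable_on R"
proof (rule Infinite_Sum.abs_summable_summable, rule Infinite_Sum.abs_summable_on_comparison_test)
  have "(\<lambda>C. (nm (f (rep C)))\<^sup>2 + (nm (g (rep C)))\<^sup>2) summable_on R"
    by (rule summable_on_add[OF Y_summable[OF f] Y_summable[OF g]])
  then show "(\<lambda>C. norm ((nm (f (rep C)))\<^sup>2 + (nm (g (rep C)))\<^sup>2)) summable_on R" by simp
  fix C assume C: "C \<in> R"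
  have "cmod (ip (f (rep C)) (g (rep C))) \<le> nm (f (rep C)) * nm (g (rep C))"
    by (rule Cauchy_Schwarz) (use f g C in auto)
  also have "\<dots> \<le> (nm (f (rep C)))\<^sup>2 + (nm (g (rep C)))\<^sup>2"
    using zero_le_power2[of "nm (f (rep C)) - nm (g (rep C))"]
      mult_nonneg_nonneg[OF nm_ge0[OF Y_in[OF f rep_carrier[OF C]]] nm_ge0[OF Y_in[OF g rep_carrier[OF C]]]]
    unfolding power2_diff by linarith
  finally show "cmod (ip (f (rep C)) (g (rep C))) \<le> norm ((nm (f (rep C)))\<^sup>2 + (nm (g (rep C)))\<^sup>2)"
    by simp
qed

lemma I_nm_sq: "f \<in> Y \<Longrightarrow> iprod I f f = complex_of_real (\<Sum>\<^sub>\<infinity>C\<in>R. (nm (f (rep C)))\<^sup>2)"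
proof -
  assume f: "f \<in> Y"
  have "iprod I f f = (\<Sum>\<^sub>\<infinity>C\<in>R. complex_of_real ((nm (f (rep C)))\<^sup>2))"
    unfolding I_ip by (rule infsum_cong) (rule ip_nm_sq, use f in simp)
  also have "\<dots> = complex_of_real (\<Sum>\<^sub>\<infinity>C\<in>R. (nm (f (rep C)))\<^sup>2)"
    by (rule infsumI[OF has_sum_bounded_linear[OF bounded_linear_of_real has_sum_infsum[OF Y_summable[OF f]]]])
  finally show ?thesis .
qed

lemma I_nm: "f \<in> Y \<Longrightarrow> (hnorm I f)\<^sup>2 = (\<Sum>\<^sub>\<infinity>C\<in>R. (nm (f (rep C)))\<^sup>2)"
  unfolding hnorm_def[of I f] using I_nm_sq[of f] by (simp add: infsum_nonneg)

lemma I_nm_ge0: "f \<in> Y \<Longrightarrow> 0 \<le> hnorm I f"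
  unfolding hnorm_def using I_nm_sq[of f] by (simp add: infsum_nonneg)

lemma Y_zero: "0 \<in> Y"
  unfolding Y_iff equivariant_def using op_zero[OF \<pi>K_bops] by simp

lemma Y_add: assumes f: "f \<in> Y" and g: "g \<in> Y" shows "f + g \<in> Y"
  unfolding Y_iff
proof
  show "equivariant (f + g)"
    unfolding equivariant_def
    using f g by (simp add: Y_out[OF f] Y_out[OF g] Y_equivariant[OF f] Y_equivariant[OF g] op_add[OF \<pi>K_bops])
  have le: "(nm ((f + g) (rep C)))\<^sup>2 \<le> 2 * (nm (f (rep C)))\<^sup>2 + 2 * (nm (g (rep C)))\<^sup>2" if C: "C \<in> R" for C
  proof -
    have x: "f (rep C) \<in> X" "g (rep C) \<in> X" using f g C by auto
    show ?thesis
      using nm_add_sq[OF x] nm_diff_sq[OF x] zero_le_power2[of "nm (f (rep C) - g (rep C))"] by simp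
  qed
  have "(\<lambda>C. 2 * (nm (f (rep C)))\<^sup>2 + 2 * (nm (g (rep C)))\<^sup>2) summable_on R"
    by (intro summable_on_add summable_on_cmult_right Y_summable f g)
  then have "(\<lambda>C. norm (2 * (nm (f (rep C)))\<^sup>2 + 2 * (nm (g (rep C)))\<^sup>2)) summable_on R" by simp
  then have "(\<lambda>C. norm ((nm ((f + g) (rep C)))\<^sup>2)) summable_on R"
    by (rule Infinite_Sum.abs_summable_on_comparison_test) (use le in simp)
  then show "(\<lambda>C. (nm ((f + g) (rep C)))\<^sup>2) summable_on R" by simp
qed

lemma Y_scale: assumes f: "f \<in> Y" shows "(\<lambda>x. sc c (f x)) \<in> Y"
  unfolding Y_iff
proof
  show "equivariant (\<lambda>x. sc c (f x))"
    unfolding equivariant_def using f by (simp add: Y_out[OF f] Y_equivariant[OF f] op_scale[OF \<pi>K_bops])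
  have "(\<lambda>C. (cmod c)\<^sup>2 * (nm (f (rep C)))\<^sup>2) summable_on R"
    by (intro summable_on_cmult_right Y_summable f)
  then show "(\<lambda>C. (nm (sc c (f (rep C))))\<^sup>2) summable_on R"
    by (rule summable_on_cong[THEN iffD1, rotated]) (use f in \<open>simp add: nm_scale power_mult_distrib\<close>)
qed

lemma vector_space_I: "vector_space (scal I)"
  unfolding I_sc
  by unfold_locales (auto simp: fun_eq_iff vs.scale_right_distrib vs.scale_left_distrib)

lemma Y_diff: "f \<in> Y \<Longrightarrow> g \<in> Y \<Longrightarrow> f - g \<in> Y"
  using Y_add[of f "\<lambda>x. sc (-1) (g x)"] Y_scale[of g "-1"] by (simp add: fun_diff_def plus_fun_def)

text \<open>The value at \<open>x\<close> has the norm of the value at the representative of its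
  coset, a single term of the sum. Contractive evaluation makes Cauchy sequences converge
  pointwise.\<close>

lemma I_nm_point_le:
  assumes f: "f \<in> Y" and x: "x \<in> carrier G"
  shows "nm (f x) \<le> hnorm I f"
proof (rule power2_le_imp_le)
  let ?C = "K #>\<^bsub>G\<^esub> x"
  have "(nm (f x))\<^sup>2 = (nm (f (rep ?C)))\<^sup>2"
    using K_invariant_rep[OF K_invariant_nm x, of f] f unfolding Y_iff by simp
  also have "\<dots> = (\<Sum>C\<in>{?C}. (nm (f (rep C)))\<^sup>2)" by simp
  also have "\<dots> \<le> (\<Sum>\<^sub>\<infinity>C\<in>R. (nm (f (rep C)))\<^sup>2)"
    by (rule finite_sum_le_infsum[OF Y_summable[OF f]]) (use x in auto)
  finally show "(nm (f x))\<^sup>2 \<le> (hnorm I f)\<^sup>2" unfolding I_nm[OF f] .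
qed (rule I_nm_ge0[OF f])

text \<open>A bound on finite partial sums is what pointwise limits, bumps and pointwise operators
  are able to provide.\<close>

lemma Y_bounded:
  assumes f: "equivariant f" and le: "\<And>F. finite F \<Longrightarrow> F \<subseteq> R \<Longrightarrow> (\<Sum>C\<in>F. (nm (f (rep C)))\<^sup>2) \<le> e\<^sup>2" and e: "0 \<le> e"
  shows "f \<in> Y" "hnorm I f \<le> e"
proof -
  have sum: "(\<lambda>C. (nm (f (rep C)))\<^sup>2) summable_on R"
    by (rule nonneg_bdd_above_summable_on) (use le in \<open>auto intro!: bdd_aboveI2[where M = "e\<^sup>2"]\<close>)
  then show fY: "f \<in> Y" unfolding Y_iff using f by blast
  show "hnorm I f \<le> e"
  proof (rule power2_le_imp_le[OF _ e])
    show "(hnorm I f)\<^sup>2 \<le> e\<^sup>2" unfolding I_nm[OF fY] by (rule infsum_le_finite_sums[OF sum le])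
  qed
qed

text \<open>The limit is formed pointwise. Bounds on finite partial sums survive pointwise limits,
  as in Fatou's lemma, which gives square summability and norm convergence together.\<close>

lemma I_complete:
  assumes u: "\<And>k::nat. u k \<in> Y" and cauchy: "\<And>e. e > 0 \<Longrightarrow> \<exists>N. \<forall>j\<ge>N. \<forall>k\<ge>N. hnorm I (u j - u k) < e"
  shows "\<exists>f\<in>Y. (\<lambda>k. hnorm I (u k - f)) \<longlonglongrightarrow> 0"
proof -
  have "\<exists>l. l \<in> X \<and> (\<lambda>k. nm (u k x - l)) \<longlonglongrightarrow> 0" if x: "x \<in> carrier G" for x
  proof -
    have c: "\<exists>N. \<forall>j\<ge>N. \<forall>k\<ge>N. nm (u j x - u k x) < e" if e: "e > 0" for e
    proof -
      obtain N where N: "\<forall>j\<ge>N. \<forall>k\<ge>N. hnorm I (u j - u k) < e" using cauchy[OF e] by blast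
      have "nm (u j x - u k x) < e" if "j \<ge> N" "k \<ge> N" for j k
        using I_nm_point_le[OF Y_diff[OF u u] x, of j k] N that by fastforce
      then show ?thesis by blast
    qed
    obtain l where "l \<in> X" "(\<lambda>k. nm (u k x - l)) \<longlonglongrightarrow> 0"
      by (rule complete[of "\<lambda>k. u k x", OF Y_in[OF u x] c])
    then show ?thesis by blast
  qed
  then have "\<forall>x\<in>carrier G. \<exists>l. l \<in> X \<and> (\<lambda>k. nm (u k x - l)) \<longlonglongrightarrow> 0" by blast
  from bchoice[OF this] obtain l where "\<forall>x\<in>carrier G. l x \<in> X \<and> (\<lambda>k. nm (u k x - l x)) \<longlonglongrightarrow> 0" by blast
  then have l: "\<And>x. x \<in> carrier G \<Longrightarrow> l x \<in> X" and lim: "\<And>x. x \<in> carrier G \<Longrightarrow> (\<lambda>k. nm (u k x - l x)) \<longlonglongrightarrow> 0"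
    by simp_all
  define f where "f x = (if x \<in> carrier G then l x else 0)" for x
  have f: "f x \<in> X" "(\<lambda>k. nm (u k x - f x)) \<longlonglongrightarrow> 0" if "x \<in> carrier G" for x
    using l lim that unfolding f_def by simp_all
  have eq: "equivariant f"
    unfolding equivariant_def
  proof (intro conjI ballI allI impI)
    fix k x assume k: "k \<in> K" and x: "x \<in> carrier G"
    have kx: "k \<otimes>\<^bsub>G\<^esub> x \<in> carrier G" using k x by simp
    have "(\<lambda>j. nm (u j (k \<otimes>\<^bsub>G\<^esub> x) - f (k \<otimes>\<^bsub>G\<^esub> x)) + nm (u j x - f x)) \<longlonglongrightarrow> 0 + 0"
      by (intro tendsto_add f kx x)
    moreover have "nm (f (k \<otimes>\<^bsub>G\<^esub> x) - \<pi> k (f x)) \<le> nm (u j (k \<otimes>\<^bsub>G\<^esub> x) - f (k \<otimes>\<^bsub>G\<^esub> x)) + nm (u j x - f x)" for j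
    proof -
      have "nm (u j (k \<otimes>\<^bsub>G\<^esub> x) - \<pi> k (f x)) = nm (\<pi> k (u j x - f x))"
        using Y_equivariant[OF u k x] op_diff[OF \<pi>K_bops[OF k] Y_in[OF u x] f(1)[OF x]] by simp
      also have "\<dots> = nm (u j x - f x)" using k u x f by simp
      finally show ?thesis
        using nm_triangle_via[of "f (k \<otimes>\<^bsub>G\<^esub> x)" "u j (k \<otimes>\<^bsub>G\<^esub> x)" "\<pi> k (f x)"]
          nm_diff_commute[of "f (k \<otimes>\<^bsub>G\<^esub> x)" "u j (k \<otimes>\<^bsub>G\<^esub> x)"] f u k x kx by simp
    qed
    ultimately have "nm (f (k \<otimes>\<^bsub>G\<^esub> x) - \<pi> k (f x)) \<le> 0 + 0"
      by (intro LIMSEQ_le_const) auto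
    moreover have "f (k \<otimes>\<^bsub>G\<^esub> x) - \<pi> k (f x) \<in> X" using f k x kx by auto
    ultimately have "nm (f (k \<otimes>\<^bsub>G\<^esub> x) - \<pi> k (f x)) = 0" "f (k \<otimes>\<^bsub>G\<^esub> x) - \<pi> k (f x) \<in> X"
      by (simp_all add: order_antisym)
    then show "f (k \<otimes>\<^bsub>G\<^esub> x) = \<pi> k (f x)"
      using nm_eq0[of "f (k \<otimes>\<^bsub>G\<^esub> x) - \<pi> k (f x)"] by simp
  qed (use f f_def in auto)
  have close: "u k - f \<in> Y \<and> hnorm I (u k - f) \<le> e"
    if e: "e > 0" and N: "\<forall>j\<ge>N. \<forall>k\<ge>N. hnorm I (u j - u k) < e" and k: "k \<ge> N" for e N k
  proof -
    have "equivariant (u k - f)"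
      unfolding equivariant_def
      using u[of k] eq Y_out[OF u] equivariantD[OF eq] Y_equivariant[OF u] op_diff[OF \<pi>K_bops] by simp
    moreover have "(\<Sum>C\<in>F. (nm ((u k - f) (rep C)))\<^sup>2) \<le> e\<^sup>2" if F: "finite F" "F \<subseteq> R" for F
    proof -
      have "(\<lambda>j. \<Sum>C\<in>F. (nm (u k (rep C) - u j (rep C)))\<^sup>2) \<longlonglongrightarrow> (\<Sum>C\<in>F. (nm (u k (rep C) - f (rep C)))\<^sup>2)"
      proof (intro tendsto_sum tendsto_power)
        fix C assume "C \<in> F"
        then have c: "rep C \<in> carrier G" using F by auto
        show "(\<lambda>j. nm (u k (rep C) - u j (rep C))) \<longlonglongrightarrow> nm (u k (rep C) - f (rep C))"
        proof (rule tendsto_nm)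
          have "(u k (rep C) - u j (rep C)) - (u k (rep C) - f (rep C)) = - (u j (rep C) - f (rep C))" for j
            by simp
          then have "nm ((u k (rep C) - u j (rep C)) - (u k (rep C) - f (rep C))) = nm (u j (rep C) - f (rep C))" for j
            using nm_minus[of "u j (rep C) - f (rep C)"] u f c by simp
          then show "(\<lambda>j. nm ((u k (rep C) - u j (rep C)) - (u k (rep C) - f (rep C)))) \<longlonglongrightarrow> 0"
            using f(2)[OF c] by simp
        qed (use u f c in auto)
      qed
      moreover have "(\<Sum>C\<in>F. (nm (u k (rep C) - u j (rep C)))\<^sup>2) \<le> e\<^sup>2" if j: "j \<ge> N" for j
      proof -
        have "(\<Sum>C\<in>F. (nm ((u k - u j) (rep C)))\<^sup>2) \<le> (\<Sum>\<^sub>\<infinity>C\<in>R. (nm ((u k - u j) (rep C)))\<^sup>2)"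
          by (rule finite_sum_le_infsum[OF Y_summable[OF Y_diff[OF u u]]]) (use F in auto)
        also have "\<dots> = (hnorm I (u k - u j))\<^sup>2" using I_nm[OF Y_diff[OF u u]] by simp
        also have "\<dots> \<le> e\<^sup>2"
          using N k j I_nm_ge0[OF Y_diff[OF u u], of k j] by (intro power_mono) (auto intro: less_imp_le)
        finally show ?thesis by simp
      qed
      ultimately have "(\<Sum>C\<in>F. (nm (u k (rep C) - f (rep C)))\<^sup>2) \<le> e\<^sup>2"
        by (intro LIMSEQ_le_const2[of "\<lambda>j. \<Sum>C\<in>F. (nm (u k (rep C) - u j (rep C)))\<^sup>2"]) auto
      then show ?thesis by simp
    qed
    ultimately show ?thesis using Y_bounded[of "u k - f" e] e by auto
  qed
  obtain N where N: "\<forall>j\<ge>N. \<forall>k\<ge>N. hnorm I (u j - u k) < 1" using cauchy[of 1] by auto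
  have "u N - f \<in> Y" using close[OF _ N, of N] by simp
  then have fY: "f \<in> Y" using Y_diff[OF u[of N], of "u N - f"] by simp
  have "(\<lambda>k. hnorm I (u k - f)) \<longlonglongrightarrow> 0"
  proof (rule LIMSEQ_I)
    fix e :: real assume e: "0 < e"
    obtain N where N: "\<forall>j\<ge>N. \<forall>k\<ge>N. hnorm I (u j - u k) < e/2" using cauchy[of "e/2"] e by auto
    have "norm (hnorm I (u k - f) - 0) < e" if "k \<ge> N" for k
      using close[OF _ N that] e I_nm_ge0[OF Y_diff[OF u fY], of k] by simp
    then show "\<exists>N. \<forall>k\<ge>N. norm (hnorm I (u k - f) - 0) < e" by blast
  qed
  then show ?thesis using fY by blast
qed

lemma hilbert_space_I: "hilbert_space I"
  unfolding hilbert_space_def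
proof (intro conjI ballI allI impI)
  show "vector_space (scal I)" by (rule vector_space_I)
  then interpret V: vector_space "scal I" .
  show "V.subspace Y"
    by (rule V.subspaceI) (use Y_zero Y_add Y_scale in auto)
next
  fix f g h assume fgh: "f \<in> Y" "g \<in> Y" "h \<in> Y"
  have "iprod I (f + g) h = (\<Sum>\<^sub>\<infinity>C\<in>R. ip (f (rep C)) (h (rep C)) + ip (g (rep C)) (h (rep C)))"
    unfolding I_ip by (rule infsum_cong) (use fgh in \<open>simp add: ip_add_left\<close>)
  also have "\<dots> = iprod I f h + iprod I g h"
    unfolding I_ip by (rule infsum_add; rule Y_ip_abs_summable; use fgh in simp)
  finally show "iprod I (f + g) h = iprod I f h + iprod I g h" .
next
  fix c f g assume fg: "f \<in> Y" "g \<in> Y"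
  have "iprod I (scal I c f) g = (\<Sum>\<^sub>\<infinity>C\<in>R. c * ip (f (rep C)) (g (rep C)))"
    unfolding I_ip by (rule infsum_cong) (use fg in \<open>simp add: ip_scale_left\<close>)
  also have "\<dots> = c * iprod I f g" unfolding I_ip by (rule infsum_cmult_right')
  finally show "iprod I (scal I c f) g = c * iprod I f g" .
next
  fix f g assume fg: "f \<in> Y" "g \<in> Y"
  have "iprod I g f = (\<Sum>\<^sub>\<infinity>C\<in>R. cnj (ip (f (rep C)) (g (rep C))))"
    unfolding I_ip by (rule infsum_cong) (use fg in \<open>simp add: ip_commute[symmetric]\<close>)
  then show "iprod I g f = cnj (iprod I f g)" unfolding I_ip by simp
next
  fix f assume f: "f \<in> Y"
  show "iprod I f f \<in> \<real>\<^sub>\<ge>\<^sub>0" unfolding I_nm_sq[OF f] by (simp add: infsum_nonneg)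
  assume "iprod I f f = 0"
  then have "(hnorm I f)\<^sup>2 = 0" unfolding hnorm_def by simp
  then have "hnorm I f = 0" by simp
  then have "nm (f x) = 0" if "x \<in> carrier G" for x
    using I_nm_point_le[OF f that] nm_ge0[OF Y_in[OF f that]] by linarith
  then show "f = 0" using f by (intro Y_eqI[OF f Y_zero]) simp
next
  fix u :: "nat \<Rightarrow> _"
  assume "(\<forall>k. u k \<in> Y) \<and> (\<forall>e>0. \<exists>N. \<forall>j\<ge>N. \<forall>k\<ge>N. hnorm I (u j - u k) < e)"
  then show "\<exists>f\<in>Y. (\<lambda>k. hnorm I (u k - f)) \<longlonglongrightarrow> 0" by (intro I_complete) auto
qed

section \<open>Right translations\<close>

abbreviation "\<rho> \<equiv> ind_rep G K H \<pi>"

lemma \<rho>_apply: "f \<in> Y \<Longrightarrow> \<rho> g f = (\<lambda>x. if x \<in> carrier G then f (x \<otimes>\<^bsub>G\<^esub> g) else 0)"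
  unfolding ind_rep_def by simp

lemma \<rho>_apply' [simp]: "f \<in> Y \<Longrightarrow> x \<in> carrier G \<Longrightarrow> \<rho> g f x = f (x \<otimes>\<^bsub>G\<^esub> g)"
  by (simp add: \<rho>_apply)

lemma \<rho>_in:
  assumes f: "f \<in> Y" and g: "g \<in> carrier G"
  shows "\<rho> g f \<in> Y"
  unfolding Y_iff
proof
  have ef: "equivariant f" using f Y_iff by blast
  show "equivariant (\<rho> g f)"
    unfolding equivariant_def using f g Y_equivariant[OF f] by (simp add: \<rho>_apply BG.m_assoc)
  have "(\<lambda>C. (nm (f (rep C \<otimes>\<^bsub>G\<^esub> g)))\<^sup>2) summable_on R"
    using summable_translate[OF K_invariant_nm[OF ef] g] Y_summable[OF f] by simp
  then show "(\<lambda>C. (nm (\<rho> g f (rep C)))\<^sup>2) summable_on R"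
    by (rule summable_on_cong[THEN iffD1, rotated]) (use f in simp)
qed

lemma \<rho>_ip:
  assumes f: "f \<in> Y" and h: "h \<in> Y" and g: "g \<in> carrier G"
  shows "iprod I (\<rho> g f) (\<rho> g h) = iprod I f h"
proof -
  have "equivariant f" "equivariant h" using f h Y_iff by blast+
  then have "(\<Sum>\<^sub>\<infinity>C\<in>R. ip (f (rep C \<otimes>\<^bsub>G\<^esub> g)) (h (rep C \<otimes>\<^bsub>G\<^esub> g))) = iprod I f h"
    unfolding I_ip by (intro infsum_translate K_invariant_ip g)
  moreover have "iprod I (\<rho> g f) (\<rho> g h) = (\<Sum>\<^sub>\<infinity>C\<in>R. ip (f (rep C \<otimes>\<^bsub>G\<^esub> g)) (h (rep C \<otimes>\<^bsub>G\<^esub> g)))"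
    unfolding I_ip by (rule infsum_cong) (use f h in simp)
  ultimately show ?thesis by simp
qed

lemma \<rho>_mult:
  assumes "f \<in> Y" "g \<in> carrier G" "h \<in> carrier G"
  shows "\<rho> (g \<otimes>\<^bsub>G\<^esub> h) f = \<rho> g (\<rho> h f)"
  by (rule Y_eqI) (use assms \<rho>_in in \<open>simp_all add: BG.m_assoc\<close>)

lemma \<rho>_one: "f \<in> Y \<Longrightarrow> \<rho> \<one>\<^bsub>G\<^esub> f = f"
  by (rule Y_eqI) (use \<rho>_in in simp_all)

lemma \<rho>_Bij: assumes g: "g \<in> carrier G" shows "\<rho> g \<in> Bij Y"
proof -
  have "bij_betw (\<rho> g) Y Y"
  proof (rule bij_betw_byWitness[where f' = "\<rho> (inv\<^bsub>G\<^esub> g)"])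
    show "\<forall>f\<in>Y. \<rho> (inv\<^bsub>G\<^esub> g) (\<rho> g f) = f" "\<forall>f\<in>Y. \<rho> g (\<rho> (inv\<^bsub>G\<^esub> g) f) = f"
      using g \<rho>_mult[symmetric] \<rho>_one by simp_all
  qed (use \<rho>_in g in auto)
  then show ?thesis unfolding Bij_def by (simp add: ind_rep_def)
qed

lemma \<rho>_bounded: assumes g: "g \<in> carrier G" shows "\<rho> g \<in> bounded_ops I"
  unfolding bounded_ops_def
proof (intro CollectI conjI ballI allI exI[of _ 1])
  show "\<rho> g \<in> Y \<rightarrow>\<^sub>E Y" using \<rho>_in[OF _ g] by (auto simp: ind_rep_def)
  show "\<rho> g (f + h) = \<rho> g f + \<rho> g h" if "f \<in> Y" "h \<in> Y" for f h
    using that Y_add by (auto simp: \<rho>_apply fun_eq_iff)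
  show "\<rho> g (scal I c f) = scal I c (\<rho> g f)" if "f \<in> Y" for c f
    using that Y_scale by (auto simp: \<rho>_apply fun_eq_iff)
  show "hnorm I (\<rho> g f) \<le> 1 * hnorm I f" if "f \<in> Y" for f
    unfolding hnorm_def using \<rho>_ip[OF that that g] by simp
qed

lemma unitary_rep_I: "unitary_rep G I \<rho>"
  unfolding unitary_rep_def
proof (intro conjI BG.is_group hilbert_space_I)
  show "\<rho> \<in> hom G (unitary_group I)"
    unfolding hom_def
  proof (intro CollectI conjI ballI funcsetI)
    show "\<rho> g \<in> carrier (unitary_group I)" if "g \<in> carrier G" for g
      unfolding unitary_group_def using \<rho>_Bij \<rho>_bounded \<rho>_ip that by simp
    fix g h assume gh: "g \<in> carrier G" "h \<in> carrier G"
    have "\<rho> (g \<otimes>\<^bsub>G\<^esub> h) = compose Y (\<rho> g) (\<rho> h)"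
    proof (rule extensionalityI[of _ Y])
      show "\<rho> (g \<otimes>\<^bsub>G\<^esub> h) \<in> extensional Y" by (simp add: ind_rep_def)
    qed (use \<rho>_mult gh in \<open>simp_all add: compose_def\<close>)
    then show "\<rho> (g \<otimes>\<^bsub>G\<^esub> h) = \<rho> g \<otimes>\<^bsub>unitary_group I\<^esub> \<rho> h"
      unfolding unitary_group_def BijGroup_def using \<rho>_Bij gh by simp
  qed
qed

sublocale I: urep I G \<rho>
  using unitary_rep_I unitary_rep_iff by blast

section \<open>Vectors supported on one coset\<close>

text \<open>The vector \<delta> of the overview. At \<open>y = k x\<close> equivariance dictates the
  value \<open>\<pi> k v\<close>, and \<open>k\<close> is recovered from \<open>y\<close> and
  \<open>x\<close>.\<close>

definition bump :: "'g \<Rightarrow> 'v \<Rightarrow> 'g \<Rightarrow> 'v" where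
  "bump x v = (\<lambda>y. if y \<in> carrier G \<and> y \<otimes>\<^bsub>G\<^esub> inv\<^bsub>G\<^esub> x \<in> K then \<pi> (y \<otimes>\<^bsub>G\<^esub> inv\<^bsub>G\<^esub> x) v else 0)"

lemma equivariant_bump:
  assumes x: "x \<in> carrier G" and v: "v \<in> X"
  shows "equivariant (bump x v)"
  unfolding equivariant_def
proof (intro conjI ballI allI impI)
  fix k y assume k: "k \<in> K" and y: "y \<in> carrier G"
  have eq: "k \<otimes>\<^bsub>G\<^esub> y \<otimes>\<^bsub>G\<^esub> inv\<^bsub>G\<^esub> x = k \<otimes>\<^bsub>G\<^esub> (y \<otimes>\<^bsub>G\<^esub> inv\<^bsub>G\<^esub> x)"
    using k x y by (simp add: BG.m_assoc)
  have "k \<otimes>\<^bsub>G\<^esub> (y \<otimes>\<^bsub>G\<^esub> inv\<^bsub>G\<^esub> x) \<in> K \<longleftrightarrow> y \<otimes>\<^bsub>G\<^esub> inv\<^bsub>G\<^esub> x \<in> K"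
  proof
    assume "k \<otimes>\<^bsub>G\<^esub> (y \<otimes>\<^bsub>G\<^esub> inv\<^bsub>G\<^esub> x) \<in> K"
    then have "inv\<^bsub>G\<^esub> k \<otimes>\<^bsub>G\<^esub> (k \<otimes>\<^bsub>G\<^esub> (y \<otimes>\<^bsub>G\<^esub> inv\<^bsub>G\<^esub> x)) \<in> K" using k by simp
    then show "y \<otimes>\<^bsub>G\<^esub> inv\<^bsub>G\<^esub> x \<in> K" using k x y by (simp add: BG.m_assoc[symmetric])
  qed (use k in simp)
  then show "bump x v (k \<otimes>\<^bsub>G\<^esub> y) = \<pi> k (bump x v y)"
    unfolding bump_def eq using k x y v op_zero[OF \<pi>K_bops] \<pi>K_mult by simp
qed (use v in \<open>auto simp: bump_def\<close>)

lemma bump_in [simp]: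
  assumes x: "x \<in> carrier G" and v: "v \<in> X"
  shows "bump x v \<in> Y"
proof -
  have "(\<Sum>C\<in>F. (nm (bump x v (rep C)))\<^sup>2) \<le> (nm v)\<^sup>2" if F: "finite F" "F \<subseteq> R" for F
  proof -
    let ?C = "K #>\<^bsub>G\<^esub> x"
    have 0: "bump x v (rep C) = 0" if "C \<in> R" "C \<noteq> ?C" for C
      using that rep_coset[OF that(1)] coset_eq_iff[OF x rep_carrier[OF that(1)]] by (auto simp: bump_def)
    have "(\<Sum>C\<in>F. (nm (bump x v (rep C)))\<^sup>2) = (\<Sum>C\<in>F \<inter> {?C}. (nm (bump x v (rep C)))\<^sup>2)"
    proof (rule sum.mono_neutral_right)
      show "\<forall>i\<in>F - F \<inter> {?C}. (nm (bump x v (rep i)))\<^sup>2 = 0"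
      proof
        fix i assume "i \<in> F - F \<inter> {?C}"
        then have "bump x v (rep i) = 0" using F by (intro 0) auto
        then show "(nm (bump x v (rep i)))\<^sup>2 = 0" by simp
      qed
    qed (use F in auto)
    also have "\<dots> \<le> (nm v)\<^sup>2" using v by (cases "?C \<in> F") (auto simp: bump_def)
    finally show ?thesis .
  qed
  then show ?thesis using Y_bounded[OF equivariant_bump[OF x v], of "nm v"] v by simp
qed

text \<open>Bumps are the Riesz vectors of evaluations: exactly one coset contributes to the sum.
  Density of the bumps and the reading of operators through their coefficients rest on this.\<close>

lemma ip_bump:
  assumes f: "f \<in> Y" and x: "x \<in> carrier G" and v: "v \<in> X"
  shows "iprod I f (bump x v) = ip (f x) v"
proof -
  let ?C = "K #>\<^bsub>G\<^esub> x"
  have 0: "bump x v (rep C) = 0" if "C \<in> R" "C \<noteq> ?C" for C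
    using that rep_coset[OF that(1)] coset_eq_iff[OF x rep_carrier[OF that(1)]] by (auto simp: bump_def)
  have "iprod I f (bump x v) = (\<Sum>\<^sub>\<infinity>C\<in>{?C}. ip (f (rep C)) (bump x v (rep C)))"
    unfolding I_ip by (rule infsum_cong_neutral) (use 0 f x in auto)
  also have "\<dots> = ip (f (rep ?C)) (bump x v (rep ?C))" by simp
  also have "\<dots> = ip (f x) (bump x v x)"
    by (rule K_invariant_rep[OF K_invariant_ip[OF _ equivariant_bump[OF x v]] x]) (use f Y_iff in blast)
  also have "bump x v x = v" using x v by (simp add: bump_def \<pi>K_one)
  finally show ?thesis .
qed

lemma bump_self: "x \<in> carrier G \<Longrightarrow> v \<in> X \<Longrightarrow> bump x v x = v"
  by (simp add: bump_def \<pi>K_one)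

lemma \<rho>_bump:
  assumes x: "x \<in> carrier G" and g: "g \<in> carrier G" and v: "v \<in> X"
  shows "\<rho> g (bump x v) = bump (x \<otimes>\<^bsub>G\<^esub> inv\<^bsub>G\<^esub> g) v"
proof (rule Y_eqI)
  fix y assume y: "y \<in> carrier G"
  have "y \<otimes>\<^bsub>G\<^esub> g \<otimes>\<^bsub>G\<^esub> inv\<^bsub>G\<^esub> x = y \<otimes>\<^bsub>G\<^esub> inv\<^bsub>G\<^esub> (x \<otimes>\<^bsub>G\<^esub> inv\<^bsub>G\<^esub> g)"
    using x g y by (simp add: BG.inv_mult_group BG.m_assoc)
  moreover have "\<rho> g (bump x v) y = bump x v (y \<otimes>\<^bsub>G\<^esub> g)" using x v y by simp
  ultimately show "\<rho> g (bump x v) y = bump (x \<otimes>\<^bsub>G\<^esub> inv\<^bsub>G\<^esub> g) v y"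
    using y g unfolding bump_def by simp
qed (use assms \<rho>_in in auto)

lemma \<rho>_bump_K:
  assumes k: "k \<in> K" and v: "v \<in> X"
  shows "\<rho> k (bump \<one>\<^bsub>G\<^esub> v) = bump \<one>\<^bsub>G\<^esub> (\<pi> k v)"
proof (rule Y_eqI)
  fix y assume y: "y \<in> carrier G"
  have "y \<otimes>\<^bsub>G\<^esub> k \<in> K \<longleftrightarrow> y \<in> K"
  proof
    assume "y \<otimes>\<^bsub>G\<^esub> k \<in> K"
    then have "(y \<otimes>\<^bsub>G\<^esub> k) \<otimes>\<^bsub>G\<^esub> inv\<^bsub>G\<^esub> k \<in> K" using k by (rule K_mult[OF _ K_inv])
    then show "y \<in> K" using k y by (simp add: BG.m_assoc)
  qed (use k in simp)
  moreover have "\<rho> k (bump \<one>\<^bsub>G\<^esub> v) y = bump \<one>\<^bsub>G\<^esub> v (y \<otimes>\<^bsub>G\<^esub> k)" using v y by simp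
  ultimately show "\<rho> k (bump \<one>\<^bsub>G\<^esub> v) y = bump \<one>\<^bsub>G\<^esub> (\<pi> k v) y"
    using k v y unfolding bump_def by (simp add: \<pi>K_mult)
qed (use k v \<rho>_in in auto)

lemma orthogonal_bump:
  assumes f: "f \<in> Y" and 0: "\<And>x v. x \<in> carrier G \<Longrightarrow> v \<in> X \<Longrightarrow> iprod I (bump x v) f = 0"
  shows "f = 0"
proof (rule Y_eqI[OF f Y_zero])
  fix x assume x: "x \<in> carrier G"
  have "iprod I f (bump x (f x)) = 0"
    using 0[OF x, of "f x"] I.ip_commute[of "bump x (f x)" f] f x by simp
  then show "f x = 0 x" using ip_bump[OF f x, of "f x"] f x ip_self_eq0[of "f x"] by simp
qed

text \<open>A vector orthogonal to all bumps has all its values equal to 0, so bumps span a dense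
  subspace.\<close>

lemma closed_subspace_bump:
  assumes W: "I.closed_subspace W" and bump: "\<And>x v. x \<in> carrier G \<Longrightarrow> v \<in> X \<Longrightarrow> bump x v \<in> W"
  shows "W = Y"
proof (rule I.closed_subspace_eq_X[OF W])
  fix p assume p: "p \<in> Y" and orth: "\<And>y. y \<in> W \<Longrightarrow> iprod I y p = 0"
  show "p = 0"
  proof (rule orthogonal_bump[OF p])
    show "iprod I (bump x v) p = 0" if "x \<in> carrier G" "v \<in> X" for x v
      by (rule orth[OF bump[OF that]])
  qed
qed

end

context induced
begin

section \<open>Factoriality of induced representations\<close>

lemma I_nm_bump: "x \<in> carrier G \<Longrightarrow> v \<in> X \<Longrightarrow> hnorm I (bump x v) = nm v"
  unfolding hnorm_def by (simp add: ip_bump bump_self)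

lemma bump_add: 
  "x \<in> carrier G \<Longrightarrow> v \<in> X \<Longrightarrow> w \<in> X \<Longrightarrow> bump x (v + w) = bump x v + bump x w"
proof (rule Y_eqI)
  show "bump x (v + w) y = (bump x v + bump x w) y" if "v \<in> X" "w \<in> X" for y
    using that by (simp add: bump_def op_add[OF \<pi>K_bops])
qed (auto intro!: Y_add bump_in)

lemma bump_scale: "x \<in> carrier G \<Longrightarrow> v \<in> X \<Longrightarrow> bump x (sc c v) = scal I c (bump x v)"
  unfolding I_sc
proof (rule Y_eqI)
  show "bump x (sc c v) y = sc c (bump x v y)" if "v \<in> X" for y
    using that by (simp add: bump_def op_scale[OF \<pi>K_bops])
qed (auto intro!: Y_scale bump_in)

lemma bump_one_apply:
  "y \<in> carrier G \<Longrightarrow> v \<in> X \<Longrightarrow> bump \<one>\<^bsub>G\<^esub> v y = (if y \<in> K then \<pi> y v else 0)"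
  by (simp add: bump_def)

section \<open>The pointwise action of the commutant and the coefficients of an operator\<close>

definition hat :: "('v \<Rightarrow> 'v) \<Rightarrow> ('g \<Rightarrow> 'v) \<Rightarrow> 'g \<Rightarrow> 'v" where
  "hat a = (\<lambda>f\<in>Y. \<lambda>x. a (f x))"

lemma hat_apply: "f \<in> Y \<Longrightarrow> hat a f = (\<lambda>x. a (f x))"
  by (simp add: hat_def)

lemma hat_in_Y:
  assumes a: "a \<in> comm U" and f: "f \<in> Y"
    and K: "0 \<le> L" "\<And>x. x \<in> X \<Longrightarrow> nm (a x) \<le> L * nm x"
  shows "(\<lambda>x. a (f x)) \<in> Y" "hnorm I (\<lambda>x. a (f x)) \<le> L * hnorm I f"
proof -
  note ab = comm_bops[OF a]
  have eq: "equivariant (\<lambda>x. a (f x))"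
    unfolding equivariant_def
    using f ab by (simp add: Y_out[OF f] Y_equivariant[OF f] op_zero[OF ab] comm_\<pi>[OF a])
  have "(\<Sum>C\<in>F. (nm (a (f (rep C))))\<^sup>2) \<le> (L * hnorm I f)\<^sup>2" if F: "finite F" "F \<subseteq> R" for F
  proof -
    have "(\<Sum>C\<in>F. (nm (a (f (rep C))))\<^sup>2) \<le> (\<Sum>C\<in>F. L\<^sup>2 * (nm (f (rep C)))\<^sup>2)"
    proof (rule sum_mono)
      fix C assume "C \<in> F"
      then have x: "f (rep C) \<in> X" using F f by auto
      have "(nm (a (f (rep C))))\<^sup>2 \<le> (L * nm (f (rep C)))\<^sup>2"
        by (rule power_mono[OF K(2)[OF x]]) (use x ab in simp)
      then show "(nm (a (f (rep C))))\<^sup>2 \<le> L\<^sup>2 * (nm (f (rep C)))\<^sup>2" by (simp add: power_mult_distrib)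
    qed
    also have "\<dots> = L\<^sup>2 * (\<Sum>C\<in>F. (nm (f (rep C)))\<^sup>2)" by (simp add: sum_distrib_left)
    also have "\<dots> \<le> L\<^sup>2 * (hnorm I f)\<^sup>2"
      unfolding I_nm[OF f]
      by (intro mult_left_mono finite_sum_le_infsum[OF Y_summable[OF f]]) (use F in auto)
    finally show ?thesis by (simp add: power_mult_distrib)
  qed
  then show "(\<lambda>x. a (f x)) \<in> Y" "hnorm I (\<lambda>x. a (f x)) \<le> L * hnorm I f"
    using Y_bounded[OF eq, of "L * hnorm I f"] K(1) I_nm_ge0[OF f] by auto
qed

text \<open>Acting on values commutes with translating arguments. Enough of the commutant of the
  induced representation arises this way to force coefficients of operators in its von Neumann
  algebra into \<open>N\<close>.\<close>

lemma hat_comm: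
  assumes a: "a \<in> comm U"
  shows "hat a \<in> I.comm I.U"
proof (rule I.commI)
  note ab = comm_bops[OF a]
  obtain L where K: "0 \<le> L" "\<And>x. x \<in> X \<Longrightarrow> nm (a x) \<le> L * nm x"
    using op_bound[OF ab] by metis
  have inY: "(\<lambda>x. a (f x)) \<in> Y" if "f \<in> Y" for f
    using hat_in_Y(1)[OF a that K] .
  show "hat a \<in> I.bops"
  proof (rule I.bopsI[where K = L])
    show "hat a (f + g) = hat a f + hat a g" if "f \<in> Y" "g \<in> Y" for f g
      by (rule Y_eqI) (use that inY ab in \<open>simp_all add: hat_apply op_add del: plus_fun_apply\<close>, use that ab in \<open>simp add: op_add\<close>)
    show "hat a (scal I c f) = scal I c (hat a f)" if "f \<in> Y" for c f
      by (rule Y_eqI) (use that inY I.scale_in[OF that, of c] I.scale_in[OF inY[OF that], of c] ab in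
        \<open>simp_all add: hat_apply op_scale\<close>)
    show "hnorm I (hat a f) \<le> L * hnorm I f" if "f \<in> Y" for f
      using hat_in_Y(2)[OF a that K] that by (simp add: hat_apply)
  qed (use inY in \<open>auto simp: hat_def\<close>)
  fix S f assume "S \<in> I.U" and f: "f \<in> Y"
  then obtain g where g: "g \<in> carrier G" "S = \<rho> g" by blast
  have "hat a (\<rho> g f) = \<rho> g (hat a f)"
    by (rule Y_eqI) (use f g inY \<rho>_in in \<open>simp_all add: hat_apply\<close>)
  then show "hat a (S f) = S (hat a f)" using g by simp
qed

lemma hat_bump: 
  assumes a: "a \<in> comm U" and x: "x \<in> carrier G" and v: "v \<in> X"
  shows "hat a (bump x v) = bump x (a v)"
  using bump_in[OF x v] v op_zero[OF comm_bops[OF a]] comm_\<pi>[OF a] 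
  by (auto simp: hat_apply bump_def)

text \<open>The matrix entry of \<open>T\<close> from the coset \<open>K\<close> to the coset of
  \<open>x\<close>, read at the point \<open>x\<close> of that coset.\<close>

definition coef :: "(('g \<Rightarrow> 'v) \<Rightarrow> 'g \<Rightarrow> 'v) \<Rightarrow> 'g \<Rightarrow> 'v \<Rightarrow> 'v" where
  "coef T x = (\<lambda>v\<in>X. T (bump \<one>\<^bsub>G\<^esub> v) x)"

lemma coef_apply: "v \<in> X \<Longrightarrow> coef T x v = T (bump \<one>\<^bsub>G\<^esub> v) x"
  by (simp add: coef_def)

lemma coef_bops:
  assumes T: "T \<in> I.bops" and x: "x \<in> carrier G"
  shows "coef T x \<in> bops"
proof -
  obtain L where L: "0 \<le> L" "\<And>f. f \<in> Y \<Longrightarrow> hnorm I (T f) \<le> L * hnorm I f"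
    using I.op_bound[OF T] by metis
  show ?thesis
  proof (rule bopsI[where K = L])
    show "coef T x v \<in> X" if "v \<in> X" for v using that T x by (simp add: coef_apply)
    show "coef T x (v + w) = coef T x v + coef T x w" if "v \<in> X" "w \<in> X" for v w
      using that T by (simp add: coef_apply bump_add I.op_add)
    show "coef T x (sc c v) = sc c (coef T x v)" if "v \<in> X" for c v
      using that T by (simp add: coef_apply bump_scale I.op_scale del: I_sc) simp
    show "nm (coef T x v) \<le> L * nm v" if v: "v \<in> X" for v
    proof -
      have b: "bump \<one>\<^bsub>G\<^esub> v \<in> Y" using v by simp
      have "nm (T (bump \<one>\<^bsub>G\<^esub> v) x) \<le> hnorm I (T (bump \<one>\<^bsub>G\<^esub> v))"
        by (rule I_nm_point_le[OF I.op_in[OF T b] x])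
      also have "\<dots> \<le> L * nm v" using L(2)[OF b] v by (simp add: I_nm_bump)
      finally show ?thesis using v by (simp add: coef_apply)
    qed
  qed (simp add: coef_def)
qed

lemma coef_in_N:
  assumes T: "T \<in> I.N" and x: "x \<in> carrier G"
  shows "coef T x \<in> N"
proof -
  have Tc: "T \<in> I.comm (I.comm I.U)" using T I.N_eq by simp
  show ?thesis unfolding N_eq
  proof (rule commI[OF coef_bops[OF I.comm_bops[OF Tc] x]])
    fix a v assume a: "a \<in> comm U" and v: "v \<in> X"
    have b: "bump \<one>\<^bsub>G\<^esub> v \<in> Y" using v by simp
    have Tb: "T (bump \<one>\<^bsub>G\<^esub> v) \<in> Y" using I.comm_in[OF Tc b] .
    have "T (bump \<one>\<^bsub>G\<^esub> (a v)) = T (hat a (bump \<one>\<^bsub>G\<^esub> v))" using hat_bump[OF a _ v] by simp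
    also have "\<dots> = hat a (T (bump \<one>\<^bsub>G\<^esub> v))" by (rule I.comm_apply[OF Tc hat_comm[OF a] b])
    finally show "coef T x (a v) = a (coef T x v)"
      using v comm_in[OF a v] Tb by (simp add: coef_apply hat_apply)
  qed
qed

lemma coef_translate:
  assumes T: "T \<in> I.comm I.U" and x: "x \<in> carrier G" and k: "k \<in> K" and v: "v \<in> X"
  shows "coef T (x \<otimes>\<^bsub>G\<^esub> k) v = coef T x (\<pi> k v)"
proof -
  have b: "bump \<one>\<^bsub>G\<^esub> v \<in> Y" using v by simp
  have Tb: "T (bump \<one>\<^bsub>G\<^esub> v) \<in> Y" using I.comm_in[OF T b] .
  have "T (bump \<one>\<^bsub>G\<^esub> (\<pi> k v)) = T (\<rho> k (bump \<one>\<^bsub>G\<^esub> v))" using \<rho>_bump_K[OF k v] by simp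
  also have "\<dots> = \<rho> k (T (bump \<one>\<^bsub>G\<^esub> v))" by (rule I.comm_\<pi>[OF T _ b]) (use k in simp)
  finally show ?thesis using v k x Tb by (simp add: coef_apply)
qed

lemma coef_K:
  assumes T: "T \<in> I.bops" and k: "k \<in> K" and v: "v \<in> X"
  shows "coef T k v = \<pi> k (coef T \<one>\<^bsub>G\<^esub> v)"
  using Y_equivariant[OF I.op_in[OF T bump_in[OF BG.one_closed v]] k, of "\<one>\<^bsub>G\<^esub>"] v k
  by (simp add: coef_apply)

text \<open>The operators \<open>coef T (x k)\<close>, \<open>k \<in> K\<close>, lie in \<open>N\<close>, all have the same trace norm, and their
  Gram operators over any set of distinct cosets sum up to at most \<open>\<parallel>T\<parallel>\<^sup>2\<close>; on an infinite orbit
  this is only possible if they vanish.\<close>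

lemma coef_eq_0:
  assumes fin: "finite_vna H N" and T: "T \<in> I.N" "T \<in> I.comm I.U" and x: "x \<in> carrier G"
    and inf: "infinite ((\<lambda>k. K #>\<^bsub>G\<^esub> (x \<otimes>\<^bsub>G\<^esub> k)) ` K)" and v: "v \<in> X"
  shows "coef T x v = 0"
proof (rule ccontr)
  assume nz: "coef T x v \<noteq> 0"
  interpret vn_algebra H N by unfold_locales (rule von_neumann_algebra_N)
  let ?A = "coef T x"
  have AN: "coef T y \<in> N" if "y \<in> carrier G" for y using coef_in_N[OF T(1) that] .
  have Ab: "?A \<in> bops" using M_bops[OF AN[OF x]] .
  have pos: "compose X (adj ?A) ?A \<in> pos_part H N"
    by (intro pos_partI M_compose M_adj AN[OF x] adj_compose_positive Ab)
  have "compose X (adj ?A) ?A \<noteq> scalar_op H 0"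
  proof
    assume "compose X (adj ?A) ?A = scalar_op H 0"
    then have "ip (compose X (adj ?A) ?A v) v = 0" using v by simp
    then have "nm (?A v) = 0" unfolding form_adj_compose[OF Ab v] by simp
    then show False using nz Ab v by simp
  qed
  then obtain \<phi> where \<phi>: "finite_trace H N \<phi>" "\<phi> (compose X (adj ?A) ?A) \<noteq> 0"
    using fin pos unfolding finite_vna_def by blast
  interpret traced H N \<phi> by unfold_locales (rule \<phi>(1))
  have t0: "0 < trace_norm2 ?A"
    using trace_norm2_ge0[OF AN[OF x]] \<phi>(2) unfolding trace_norm2_def by simp
  obtain L where L: "0 \<le> L" "\<And>f. f \<in> Y \<Longrightarrow> hnorm I (T f) \<le> L * hnorm I f"
    using I.op_bound[OF I.comm_bops[OF T(2)]] by metis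
  have t_eq: "trace_norm2 (coef T (x \<otimes>\<^bsub>G\<^esub> k)) = trace_norm2 ?A" if k: "k \<in> K" for k
  proof -
    have "coef T (x \<otimes>\<^bsub>G\<^esub> k) = compose X ?A (\<pi> k)"
      by (rule op_eqI) (use M_bops[OF AN, of "x \<otimes>\<^bsub>G\<^esub> k"] Ab x k coef_translate[OF T(2) x k] in auto)
    moreover have "trace_norm2 (compose X ?A (\<pi> k)) = trace_norm2 ?A"
    proof (rule trace_norm2_isometry_right[OF AN[OF x]])
      show "\<pi> k \<in> N" using \<pi>_in_N[of k] k by simp
      show "nm (adj (\<pi> k) y) = nm y" if "y \<in> X" for y
        using adj_\<pi>[of k] nm_\<pi>[of "inv\<^bsub>G\<lparr>carrier := K\<rparr>\<^esub> k" y] G.inv_closed[of k] k that by simp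
    qed
    ultimately show ?thesis by simp
  qed
  have bound: "real m * trace_norm2 ?A \<le> L\<^sup>2 * trace_norm2 (scalar_op H 1)" for m :: nat
  proof -
    obtain D where D: "D \<subseteq> (\<lambda>k. K #>\<^bsub>G\<^esub> (x \<otimes>\<^bsub>G\<^esub> k)) ` K" "finite D" "card D = m"
      using infinite_arbitrarily_large[OF inf, of m] by blast
    have "\<forall>C\<in>D. \<exists>k. k \<in> K \<and> C = K #>\<^bsub>G\<^esub> (x \<otimes>\<^bsub>G\<^esub> k)" using D(1) by blast
    from bchoice[OF this] obtain \<kappa> where \<kappa>: "\<forall>C\<in>D. \<kappa> C \<in> K \<and> C = K #>\<^bsub>G\<^esub> (x \<otimes>\<^bsub>G\<^esub> \<kappa> C)" by blast
    have xk: "x \<otimes>\<^bsub>G\<^esub> \<kappa> C \<in> carrier G" if "C \<in> D" for C using \<kappa> that x by simp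
    have DR: "D \<subseteq> R"
    proof
      fix C assume C: "C \<in> D"
      then have "C = K #>\<^bsub>G\<^esub> (x \<otimes>\<^bsub>G\<^esub> \<kappa> C)" using \<kappa> by blast
      then show "C \<in> R" using coset_in_R[OF xk[OF C]] by simp
    qed
    have "(\<Sum>C\<in>D. 1 * trace_norm2 (coef T (x \<otimes>\<^bsub>G\<^esub> \<kappa> C))) \<le> (\<Sum>_\<in>{()}. L\<^sup>2 * trace_norm2 (scalar_op H 1))"
    proof (rule trace_norm2_combination_le[OF D(2)])
      show "coef T (x \<otimes>\<^bsub>G\<^esub> \<kappa> C) \<in> N" if "C \<in> D" for C using AN[OF xk[OF that]] .
      fix w assume w: "w \<in> X"
      have b: "bump \<one>\<^bsub>G\<^esub> w \<in> Y" using w by simp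
      let ?f = "T (bump \<one>\<^bsub>G\<^esub> w)"
      have f: "?f \<in> Y" using I.comm_in[OF T(2) b] .
      then have eqf: "equivariant ?f" using Y_iff by blast
      have "(\<Sum>C\<in>D. 1 * (nm (coef T (x \<otimes>\<^bsub>G\<^esub> \<kappa> C) w))\<^sup>2) = (\<Sum>C\<in>D. (nm (?f (rep C)))\<^sup>2)"
      proof (rule sum.cong[OF refl])
        fix C assume C: "C \<in> D"
        have "(nm (?f (rep (K #>\<^bsub>G\<^esub> (x \<otimes>\<^bsub>G\<^esub> \<kappa> C)))))\<^sup>2 = (nm (?f (x \<otimes>\<^bsub>G\<^esub> \<kappa> C)))\<^sup>2"
          by (rule K_invariant_rep[OF K_invariant_nm[OF eqf] xk[OF C]])
        then show "1 * (nm (coef T (x \<otimes>\<^bsub>G\<^esub> \<kappa> C) w))\<^sup>2 = (nm (?f (rep C)))\<^sup>2"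
          using \<kappa> C w by (simp add: coef_apply)
      qed
      also have "\<dots> \<le> (hnorm I ?f)\<^sup>2"
        unfolding I_nm[OF f] by (rule finite_sum_le_infsum[OF Y_summable[OF f] D(2) DR]) simp
      also have "\<dots> \<le> (L * nm w)\<^sup>2"
        using L(2)[OF b] I_nm_ge0[OF f] w by (intro power_mono) (simp_all add: I_nm_bump)
      finally show "(\<Sum>C\<in>D. 1 * (nm (coef T (x \<otimes>\<^bsub>G\<^esub> \<kappa> C) w))\<^sup>2) \<le>
          (\<Sum>_\<in>{()}. L\<^sup>2 * (nm (scalar_op H 1 w))\<^sup>2)"
        using w by (simp add: power_mult_distrib)
    qed (use M_scalar in auto)
    moreover have "(\<Sum>C\<in>D. 1 * trace_norm2 (coef T (x \<otimes>\<^bsub>G\<^esub> \<kappa> C))) = (\<Sum>C\<in>D. trace_norm2 ?A)"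
      using \<kappa> t_eq by (intro sum.cong) auto
    ultimately show ?thesis using D(3) by simp
  qed
  obtain m :: nat where "L\<^sup>2 * trace_norm2 (scalar_op H 1) < real m * trace_norm2 ?A"
    using reals_Archimedean3[OF t0] by blast
  then show False using bound[of m] by linarith
qed

lemma central_bump:
  assumes fin: "finite_vna H N" and center: "N \<inter> comm N = range (scalar_op H)"
    and inf: "\<And>x. x \<in> carrier G \<Longrightarrow> x \<notin> K \<Longrightarrow> infinite ((\<lambda>k. K #>\<^bsub>G\<^esub> (x \<otimes>\<^bsub>G\<^esub> k)) ` K)"
    and T: "T \<in> I.N" "T \<in> I.comm I.U"
  shows "\<exists>c. \<forall>x\<in>carrier G. \<forall>v\<in>X. T (bump x v) = scal I c (bump x v)"
proof -
  note Tb = I.comm_bops[OF T(2)]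
  have "coef T \<one>\<^bsub>G\<^esub> \<in> comm U"
  proof (rule commI)
    fix S v assume "S \<in> U" and v: "v \<in> X"
    then obtain k where k: "k \<in> K" "S = \<pi> k" by auto
    \<comment> \<open>The coefficient at \<open>k\<close> is evaluated twice, by right translation
      here and by left equivariance through \<open>coef_K\<close>; comparison gives commutation with
      \<open>\<pi> k\<close>.\<close>
    have "coef T (\<one>\<^bsub>G\<^esub> \<otimes>\<^bsub>G\<^esub> k) v = coef T \<one>\<^bsub>G\<^esub> (\<pi> k v)"
      by (rule coef_translate[OF T(2) BG.one_closed k(1) v])
    then have "coef T k v = coef T \<one>\<^bsub>G\<^esub> (\<pi> k v)" using k by simp
    then show "coef T \<one>\<^bsub>G\<^esub> (S v) = S (coef T \<one>\<^bsub>G\<^esub> v)" using coef_K[OF Tb k(1) v] k(2) by simp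
  qed (use coef_bops[OF Tb] in auto)
  then have "coef T \<one>\<^bsub>G\<^esub> \<in> N \<inter> comm N" unfolding comm_N using coef_in_N[OF T(1) BG.one_closed] by (rule IntI[rotated])
  then obtain c where c: "coef T \<one>\<^bsub>G\<^esub> = scalar_op H c" using center by auto
  have one: "T (bump \<one>\<^bsub>G\<^esub> v) = scal I c (bump \<one>\<^bsub>G\<^esub> v)" if v: "v \<in> X" for v
  proof (rule Y_eqI)
    fix x assume x: "x \<in> carrier G"
    show "T (bump \<one>\<^bsub>G\<^esub> v) x = scal I c (bump \<one>\<^bsub>G\<^esub> v) x"
    proof (cases "x \<in> K")
      case True
      have "T (bump \<one>\<^bsub>G\<^esub> v) x = \<pi> x (sc c v)"
        using coef_K[OF Tb True v] c v by (simp add: coef_apply)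
      then show ?thesis using True v x by (simp add: bump_one_apply op_scale)
    next
      case False
      have "coef T x v = 0" by (rule coef_eq_0[OF fin T x inf[OF x False] v])
      then show ?thesis using False v x by (simp add: coef_apply bump_one_apply)
    qed
  qed (use v Tb I.scale_in in auto)
  have "T (bump x v) = scal I c (bump x v)" if x: "x \<in> carrier G" and v: "v \<in> X" for x v
  proof -
    have b: "bump \<one>\<^bsub>G\<^esub> v \<in> Y" using v by simp
    \<comment> \<open>Every bump is a translate of a bump at the identity, and \<open>T\<close>
      commutes with translations.\<close>
    have eq: "bump x v = \<rho> (inv\<^bsub>G\<^esub> x) (bump \<one>\<^bsub>G\<^esub> v)" using \<rho>_bump[of "\<one>\<^bsub>G\<^esub>" "inv\<^bsub>G\<^esub> x" v] x v by simp
    have "T (bump x v) = \<rho> (inv\<^bsub>G\<^esub> x) (T (bump \<one>\<^bsub>G\<^esub> v))"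
      unfolding eq by (rule I.comm_\<pi>[OF T(2) _ b]) (use x in simp)
    also have "\<dots> = scal I c (bump x v)"
      unfolding one[OF v] eq by (rule I.op_scale[OF I.\<pi>_bops b]) (use x in simp)
    finally show ?thesis .
  qed
  then show ?thesis by blast
qed

theorem factor_rep_induced:
  assumes factor: "factor H N" and fin: "finite_vna H N"
    and inf: "\<And>x. x \<in> carrier G \<Longrightarrow> x \<notin> K \<Longrightarrow> infinite ((\<lambda>k. K #>\<^bsub>G\<^esub> (x \<otimes>\<^bsub>G\<^esub> k)) ` K)"
  shows "factor_rep G I \<rho>"
  unfolding factor_rep_def factor_def
proof (intro conjI)
  show "unitary_rep G I \<rho>" by (rule unitary_rep_I)
  show "von_neumann_algebra I I.N" by (rule I.von_neumann_algebra_N)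
  have center: "N \<inter> comm N = range (scalar_op H)" and "X \<noteq> {0}"
    using factor unfolding factor_def by blast+
  then obtain v where v: "v \<in> X" "v \<noteq> 0" using zero_in by blast
  show "Y \<noteq> {0}"
  proof
    assume "Y = {0}"
    then have "bump \<one>\<^bsub>G\<^esub> v = 0" using bump_in[OF BG.one_closed v(1)] by (simp only: singleton_iff)
    then have "bump \<one>\<^bsub>G\<^esub> v \<one>\<^bsub>G\<^esub> = 0" by (simp only: zero_fun_apply)
    then show False using bump_self[OF BG.one_closed v(1)] v(2) by simp
  qed
  have "T \<in> range (scalar_op I)" if T: "T \<in> I.N" "T \<in> I.comm I.U" for T
  proof -
    note Tb = I.comm_bops[OF T(2)]
    \<comment> \<open>The adjoint is analysed in place of \<open>T\<close>: its values on bumps give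
      the inner products of \<open>T f\<close> with bumps, that is, the values of
      \<open>T f\<close>.\<close>
    let ?S = "I.adj T"
    have S: "?S \<in> I.N" "?S \<in> I.comm I.U"
      using I.vna_adj[OF I.von_neumann_algebra_N T(1)] I.comm_adj[OF I.U_bops I.U_adj T(2)] by auto
    obtain c where "\<forall>x\<in>carrier G. \<forall>v\<in>X. ?S (bump x v) = scal I c (bump x v)"
      using central_bump[OF fin center inf S] by blast
    then have c: "?S (bump x v) = scal I c (bump x v)" if "x \<in> carrier G" "v \<in> X" for x v
      using that by blast
    have "T = scalar_op I (cnj c)"
    proof (rule I.op_eqI[OF Tb])
      fix f assume f: "f \<in> Y"
      show "T f = scalar_op I (cnj c) f"
      proof (rule Y_eqI)
        fix x assume x: "x \<in> carrier G"
        have "T f x = sc (cnj c) (f x)"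
        proof (rule eq_if_ip_eq)
          fix v assume v: "v \<in> X"
          have b: "bump x v \<in> Y" using x v by simp
          have "ip (T f x) v = iprod I (T f) (bump x v)"
            by (rule ip_bump[OF I.op_in[OF Tb f] x v, symmetric])
          also have "\<dots> = iprod I f (?S (bump x v))" by (rule I.ip_adj_right[OF Tb f b, symmetric])
          also have "\<dots> = cnj c * iprod I f (bump x v)"
            unfolding c[OF x v] by (rule I.ip_scale_right[OF b f])
          also have "\<dots> = cnj c * ip (f x) v" by (simp add: ip_bump[OF f x v])
          finally show "ip (T f x) v = ip (sc (cnj c) (f x)) v" using f x v by (simp add: ip_scale_left)
        qed (use f x I.op_in[OF Tb f] in auto)
        then show "T f x = scalar_op I (cnj c) f x" using f by simp
      qed (use f Tb I.scale_in[OF f, of "cnj c"] in auto)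
    qed auto
    then show ?thesis by blast
  qed
  moreover have "scalar_op I c \<in> I.N \<inter> I.comm I.U" for c
    unfolding I.N_eq using I.comm_scalar[OF I.comm_subset, of c] I.comm_scalar[OF I.U_bops, of c] by simp
  ultimately show "I.N \<inter> I.comm I.N = range (scalar_op I)"
    unfolding I.comm_N by blast
qed

section \<open>Almost invariance of the vector functionals of induced representations\<close>

text \<open>For \<open>y = k x\<close> one has \<open>y g = (k g) x\<close>, so translation by
  \<open>g\<close> keeps the coset of \<open>x\<close> and turns \<open>v\<close> into
  \<open>\<pi> g v\<close>.\<close>

lemma \<rho>_bump_centralizing:
  assumes x: "x \<in> carrier G" and v: "v \<in> X" and g: "g \<in> K" and gx: "g \<otimes>\<^bsub>G\<^esub> x = x \<otimes>\<^bsub>G\<^esub> g"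
  shows "\<rho> g (bump x v) = bump x (\<pi> g v)"
proof (rule Y_eqI)
  fix y assume y: "y \<in> carrier G"
  have gG: "g \<in> carrier G" using g by simp
  have "inv\<^bsub>G\<^esub> x \<otimes>\<^bsub>G\<^esub> g = inv\<^bsub>G\<^esub> x \<otimes>\<^bsub>G\<^esub> (g \<otimes>\<^bsub>G\<^esub> x) \<otimes>\<^bsub>G\<^esub> inv\<^bsub>G\<^esub> x"
    using x gG by (simp add: BG.m_assoc)
  also have "\<dots> = (inv\<^bsub>G\<^esub> x \<otimes>\<^bsub>G\<^esub> x) \<otimes>\<^bsub>G\<^esub> g \<otimes>\<^bsub>G\<^esub> inv\<^bsub>G\<^esub> x"
    unfolding gx using x gG by (simp only: BG.m_assoc BG.inv_closed BG.m_closed)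
  also have "\<dots> = g \<otimes>\<^bsub>G\<^esub> inv\<^bsub>G\<^esub> x" using x gG by simp
  finally have eq: "y \<otimes>\<^bsub>G\<^esub> g \<otimes>\<^bsub>G\<^esub> inv\<^bsub>G\<^esub> x = y \<otimes>\<^bsub>G\<^esub> inv\<^bsub>G\<^esub> x \<otimes>\<^bsub>G\<^esub> g"
    using x y gG by (simp add: BG.m_assoc)
  let ?z = "y \<otimes>\<^bsub>G\<^esub> inv\<^bsub>G\<^esub> x"
  have zG: "?z \<in> carrier G" using x y by simp
  have iff: "?z \<otimes>\<^bsub>G\<^esub> g \<in> K \<longleftrightarrow> ?z \<in> K"
  proof
    assume "?z \<otimes>\<^bsub>G\<^esub> g \<in> K"
    then have "(?z \<otimes>\<^bsub>G\<^esub> g) \<otimes>\<^bsub>G\<^esub> inv\<^bsub>G\<^esub> g \<in> K" using g by (rule K_mult[OF _ K_inv])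
    then show "?z \<in> K" using zG gG by (simp add: BG.m_assoc[of ?z g])
  next
    assume "?z \<in> K"
    then show "?z \<otimes>\<^bsub>G\<^esub> g \<in> K" using g by (rule K_mult)
  qed
  have "\<rho> g (bump x v) y = bump x v (y \<otimes>\<^bsub>G\<^esub> g)" using x v y by simp
  then show "\<rho> g (bump x v) y = bump x (\<pi> g v) y"
    unfolding bump_def eq iff using y gG g v \<pi>K_mult[of ?z g v] by simp
qed (use assms \<rho>_in in auto)

text \<open>Between bumps at \<open>x\<close> and \<open>y\<close> the coefficients of the induced
  representation are coefficients of \<open>\<pi>\<close>, evaluated on a shifted restriction of
  \<open>a\<close> to \<open>K\<close>. Adding \<open>F0\<close>, \<open>x\<close> and
  \<open>y\<close> to the finite set puts \<open>g\<close> into \<open>K\<close> and makes it act on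
  both bumps through \<open>\<pi> g\<close>, so the variations correspond as well.\<close>

lemma almost_invariant_bump:
  assumes inv: "\<And>v w. v \<in> X \<Longrightarrow> w \<in> X \<Longrightarrow> almost_invariant v w"
    and F0: "finite F0" "F0 \<subseteq> carrier G" "I.centralizer F0 \<subseteq> K"
    and x: "x \<in> carrier G" and y: "y \<in> carrier G" and v: "v \<in> X" and w: "w \<in> X"
  shows "I.almost_invariant (bump x v) (bump y w)"
proof (rule I.almost_invariantI)
  fix e :: real assume e: "e > 0"
  obtain F where F: "finite F" "F \<subseteq> K"
    "\<forall>g\<in>centralizer F. \<forall>a. contractive a \<longrightarrow> cmod (variation g a v w) \<le> e"
    using inv[OF v w] e unfolding almost_invariant_def by auto
  let ?F = "F \<union> F0 \<union> {x, y}"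
  have "cmod (I.variation g a (bump x v) (bump y w)) \<le> e"
    if g: "g \<in> I.centralizer ?F" and a: "I.contractive a" for g a
  proof -
    have "g \<in> I.centralizer F0" using g unfolding I.centralizer_def by auto
    then have gK: "g \<in> K" using F0 by blast
    have gx: "g \<otimes>\<^bsub>G\<^esub> x = x \<otimes>\<^bsub>G\<^esub> g" and gy: "g \<otimes>\<^bsub>G\<^esub> y = y \<otimes>\<^bsub>G\<^esub> g" and gF: "g \<in> centralizer F"
      using g gK unfolding I.centralizer_def centralizer_def by auto
    \<comment> \<open>Translation by \<open>h\<close> maps the bump at \<open>x\<close> to the bump
      at \<open>x h\<^sup>-\<^sup>1\<close>, whose value at \<open>y\<close> is governed by
      \<open>k = y h x\<^sup>-\<^sup>1\<close>; only those \<open>h\<close> with \<open>k\<close> in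
      \<open>K\<close> contribute.\<close>
    define a' where "a' k = (if k \<in> K then a (inv\<^bsub>G\<^esub> y \<otimes>\<^bsub>G\<^esub> k \<otimes>\<^bsub>G\<^esub> x) else 0)" for k
    have aG: "finite {h. a h \<noteq> 0}" "\<And>h. a h \<noteq> 0 \<Longrightarrow> h \<in> carrier G"
      using I.group_algD[OF I.contractive_alg[OF a]] by auto
    have shift1: "y \<otimes>\<^bsub>G\<^esub> (inv\<^bsub>G\<^esub> y \<otimes>\<^bsub>G\<^esub> k \<otimes>\<^bsub>G\<^esub> x) \<otimes>\<^bsub>G\<^esub> inv\<^bsub>G\<^esub> x = k" if "k \<in> carrier G" for k
    proof -
      have "y \<otimes>\<^bsub>G\<^esub> (inv\<^bsub>G\<^esub> y \<otimes>\<^bsub>G\<^esub> k \<otimes>\<^bsub>G\<^esub> x) \<otimes>\<^bsub>G\<^esub> inv\<^bsub>G\<^esub> x = (y \<otimes>\<^bsub>G\<^esub> inv\<^bsub>G\<^esub> y) \<otimes>\<^bsub>G\<^esub> k \<otimes>\<^bsub>G\<^esub> (x \<otimes>\<^bsub>G\<^esub> inv\<^bsub>G\<^esub> x)"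
        using that x y by (simp only: BG.m_assoc BG.inv_closed BG.m_closed)
      then show ?thesis using that x y by simp
    qed
    have shift2: "inv\<^bsub>G\<^esub> y \<otimes>\<^bsub>G\<^esub> (y \<otimes>\<^bsub>G\<^esub> h \<otimes>\<^bsub>G\<^esub> inv\<^bsub>G\<^esub> x) \<otimes>\<^bsub>G\<^esub> x = h" if "h \<in> carrier G" for h
    proof -
      have "inv\<^bsub>G\<^esub> y \<otimes>\<^bsub>G\<^esub> (y \<otimes>\<^bsub>G\<^esub> h \<otimes>\<^bsub>G\<^esub> inv\<^bsub>G\<^esub> x) \<otimes>\<^bsub>G\<^esub> x = (inv\<^bsub>G\<^esub> y \<otimes>\<^bsub>G\<^esub> y) \<otimes>\<^bsub>G\<^esub> h \<otimes>\<^bsub>G\<^esub> (inv\<^bsub>G\<^esub> x \<otimes>\<^bsub>G\<^esub> x)"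
        using that x y by (simp only: BG.m_assoc BG.inv_closed BG.m_closed)
      then show ?thesis using that x y by simp
    qed
    have supp: "{k. a' k \<noteq> 0} \<subseteq> (\<lambda>h. y \<otimes>\<^bsub>G\<^esub> h \<otimes>\<^bsub>G\<^esub> inv\<^bsub>G\<^esub> x) ` {h. a h \<noteq> 0}"
    proof
      fix k assume "k \<in> {k. a' k \<noteq> 0}"
      then have k: "k \<in> K" "a (inv\<^bsub>G\<^esub> y \<otimes>\<^bsub>G\<^esub> k \<otimes>\<^bsub>G\<^esub> x) \<noteq> 0" unfolding a'_def by (auto split: if_splits)
      show "k \<in> (\<lambda>h. y \<otimes>\<^bsub>G\<^esub> h \<otimes>\<^bsub>G\<^esub> inv\<^bsub>G\<^esub> x) ` {h. a h \<noteq> 0}"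
        by (rule image_eqI[of _ _ "inv\<^bsub>G\<^esub> y \<otimes>\<^bsub>G\<^esub> k \<otimes>\<^bsub>G\<^esub> x"]) (use shift1[of k] k in auto)
    qed
    have a'_alg: "a' \<in> group_alg (G\<lparr>carrier := K\<rparr>)"
      unfolding group_alg_def using finite_subset[OF supp finite_imageI[OF aG(1)]]
      by (auto simp: a'_def split: if_splits)
    have key: "iprod I (I.rop a (bump x v)) (bump y w) = ip (rop a' v) w" if v: "v \<in> X" and w: "w \<in> X" for v w
    proof -
      let ?k = "\<lambda>h. y \<otimes>\<^bsub>G\<^esub> h \<otimes>\<^bsub>G\<^esub> inv\<^bsub>G\<^esub> x"
      have b: "bump x v \<in> Y" "bump y w \<in> Y" using x y v w by auto
      have "iprod I (I.rop a (bump x v)) (bump y w)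
          = (\<Sum>h | a h \<noteq> 0. iprod I (scal I (a h) (\<rho> h (bump x v))) (bump y w))"
        unfolding I.rop_apply[OF b(1)]
        by (rule I.ip_sum_left[OF _ b(2)]) (use aG(2) b I.scale_in \<rho>_in in blast)
      also have "\<dots> = (\<Sum>h | a h \<noteq> 0. if ?k h \<in> K then a h * ip (\<pi> (?k h) v) w else 0)"
      proof (rule sum.cong[OF refl])
        fix h assume "h \<in> {h. a h \<noteq> 0}"
        then have h: "h \<in> carrier G" using aG(2) by blast
        have "iprod I (scal I (a h) (\<rho> h (bump x v))) (bump y w) = a h * iprod I (\<rho> h (bump x v)) (bump y w)"
          by (rule I.ip_scale_left[OF \<rho>_in[OF b(1) h] b(2)])
        also have "iprod I (\<rho> h (bump x v)) (bump y w) = ip (bump x v (y \<otimes>\<^bsub>G\<^esub> h)) w"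
          using ip_bump[OF \<rho>_in[OF b(1) h] y w] b y by simp
        finally show "iprod I (scal I (a h) (\<rho> h (bump x v))) (bump y w) =
            (if ?k h \<in> K then a h * ip (\<pi> (?k h) v) w else 0)"
          using h y w unfolding bump_def by simp
      qed
      also have "\<dots> = (\<Sum>h | a h \<noteq> 0 \<and> ?k h \<in> K. a h * ip (\<pi> (?k h) v) w)"
        using aG(1) by (simp add: sum.inter_filter[symmetric])
      also have "\<dots> = (\<Sum>k | a' k \<noteq> 0. a' k * ip (\<pi> k v) w)"
      proof (rule sum.reindex_bij_witness[where i = "\<lambda>k. inv\<^bsub>G\<^esub> y \<otimes>\<^bsub>G\<^esub> k \<otimes>\<^bsub>G\<^esub> x" and j = ?k])
        fix h assume h: "h \<in> {h. a h \<noteq> 0 \<and> ?k h \<in> K}"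
        then have hG: "h \<in> carrier G" using aG(2) by blast
        show "inv\<^bsub>G\<^esub> y \<otimes>\<^bsub>G\<^esub> ?k h \<otimes>\<^bsub>G\<^esub> x = h" by (rule shift2[OF hG])
        then show "?k h \<in> {k. a' k \<noteq> 0}" "a' (?k h) * ip (\<pi> (?k h) v) w = a h * ip (\<pi> (?k h) v) w"
          using h by (auto simp: a'_def)
      next
        fix k assume "k \<in> {k. a' k \<noteq> 0}"
        then have k: "k \<in> K" "a (inv\<^bsub>G\<^esub> y \<otimes>\<^bsub>G\<^esub> k \<otimes>\<^bsub>G\<^esub> x) \<noteq> 0" unfolding a'_def by (auto split: if_splits)
        show "?k (inv\<^bsub>G\<^esub> y \<otimes>\<^bsub>G\<^esub> k \<otimes>\<^bsub>G\<^esub> x) = k" by (rule shift1) (use k in simp)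
        then show "inv\<^bsub>G\<^esub> y \<otimes>\<^bsub>G\<^esub> k \<otimes>\<^bsub>G\<^esub> x \<in> {h. a h \<noteq> 0 \<and> ?k h \<in> K}" using k by auto
      qed
      also have "\<dots> = (\<Sum>k | a' k \<noteq> 0. ip (sc (a' k) (\<pi> k v)) w)"
        by (rule sum.cong[OF refl]) (use v w in \<open>auto simp: a'_def ip_scale_left split: if_splits\<close>)
      also have "\<dots> = ip (rop a' v) w"
        unfolding rop_apply[OF v]
        by (rule ip_sum_left[OF _ w, symmetric]) (use v in \<open>auto simp: a'_def split: if_splits\<close>)
      finally show ?thesis .
    qed
    \<comment> \<open>\<open>rop a'\<close> is a compression of the operator of \<open>a\<close>:
      bumps at a fixed point embed the inducing space isometrically.\<close>
    have "contractive a'"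
      unfolding contractive_def
    proof (intro conjI ballI a'_alg)
      fix v assume v: "v \<in> X"
      show "nm (rop a' v) \<le> nm v"
      proof (rule nm_le_if_ip_le)
        fix w assume w: "w \<in> X"
        show "cmod (ip (rop a' v) w) \<le> nm v * nm w"
          using I.contractive_ip[OF a bump_in[OF x v] bump_in[OF y w]] key[OF v w] x y v w
          by (simp add: I_nm_bump)
      qed (use v a'_alg in auto)
    qed
    then have "cmod (variation g a' v w) \<le> e" using F(3) gF by blast
    moreover have "I.variation g a (bump x v) (bump y w) = variation g a' v w"
      unfolding I.variation_def variation_def
        \<rho>_bump_centralizing[OF x v gK gx] \<rho>_bump_centralizing[OF y w gK gy]
      using key[OF v w] key[of "\<pi> g v" "\<pi> g w"] gK v w by simp
    ultimately show ?thesis by simp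
  qed
  then show "\<exists>F. finite F \<and> F \<subseteq> carrier G \<and>
      (\<forall>g\<in>I.centralizer F. \<forall>a. I.contractive a \<longrightarrow> cmod (I.variation g a (bump x v) (bump y w)) \<le> e)"
    using F F0 x y K_subset by (intro exI[of _ ?F]) auto
qed

text \<open>Two density arguments, one in each argument: the second vector is extended from bumps
  with the first a fixed bump, then the first with the second arbitrary.\<close>

theorem almost_invariant_induced:
  assumes inv: "\<And>v w. v \<in> X \<Longrightarrow> w \<in> X \<Longrightarrow> almost_invariant v w"
    and F0: "finite F0" "F0 \<subseteq> carrier G" "I.centralizer F0 \<subseteq> K"
    and f: "f \<in> Y" and g: "g \<in> Y"
  shows "I.almost_invariant f g"
proof -
  have 1: "I.almost_invariant (bump x v) h" if xv: "x \<in> carrier G" "v \<in> X" and h: "h \<in> Y" for x v h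
  proof -
    have "{h \<in> Y. I.almost_invariant (bump x v) h} = Y"
      by (rule closed_subspace_bump[OF I.closed_subspace_almost_invariant_right[OF bump_in[OF xv]]])
        (use almost_invariant_bump[OF inv F0] xv in auto)
    then show ?thesis using h by blast
  qed
  have "{h \<in> Y. I.almost_invariant h g} = Y"
    by (rule closed_subspace_bump[OF I.closed_subspace_almost_invariant_left[OF g]]) (use 1 g in auto)
  then show ?thesis using f by blast
qed

end

section \<open>The norm of the group C*-algebra\<close>

locale group_algebra = group G for G :: "'a monoid" (structure)
begin

definition delta :: "'a \<Rightarrow> 'a \<Rightarrow> complex" where
  "delta g = (\<lambda>h. if h = g then 1 else 0)"

lemma delta_support: "{h. delta g h \<noteq> 0} = {g}"
  by (auto simp: delta_def)

lemma delta_in [simp]: "g \<in> carrier G \<Longrightarrow> delta g \<in> group_alg G"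
  by (simp add: group_alg_def delta_support)

lemma ga_star_delta: assumes "g \<in> carrier G" shows "ga_star G (delta g) = delta (inv g)"
proof
  fix h
  show "ga_star G (delta g) h = delta (inv g) h"
    using assms unfolding ga_star_def delta_def by (auto simp: inv_equality)
qed

lemma ga_mult_delta:
  assumes g: "g \<in> carrier G" and h: "h \<in> carrier G"
  shows "ga_mult G (delta g) (delta h) = delta (g \<otimes> h)"
proof
  fix x
  have "inv g \<otimes> x = h \<longleftrightarrow> x = g \<otimes> h" if x: "x \<in> carrier G"
    using g h x inv_solve_left[of h g x] by auto
  then show "ga_mult G (delta g) (delta h) x = delta (g \<otimes> h) x"
    using g h unfolding ga_mult_def delta_support by (auto simp: delta_def)
qed

lemma group_alg_zero: "0 \<in> group_alg G"
  by (simp add: group_alg_def)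

lemma group_alg_add:
  assumes "a \<in> group_alg G" "b \<in> group_alg G"
  shows "a + b \<in> group_alg G"
proof -
  have "{g. (a + b) g \<noteq> 0} \<subseteq> {g. a g \<noteq> 0} \<union> {g. b g \<noteq> 0}" by auto
  then show ?thesis using assms unfolding group_alg_def by (auto intro: finite_subset)
qed

lemma group_alg_scale: "a \<in> group_alg G \<Longrightarrow> (\<lambda>g. c * a g) \<in> group_alg G"
proof -
  assume a: "a \<in> group_alg G"
  have "{g. c * a g \<noteq> 0} \<subseteq> {g. a g \<noteq> 0}" by auto
  then show ?thesis using a unfolding group_alg_def by (auto intro: finite_subset)
qed

context
  fixes p assumes p: "cstar_seminorm G p"
begin

lemma
  shows seminorm_ge0: "a \<in> group_alg G \<Longrightarrow> 0 \<le> p a"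
    and seminorm_add: "a \<in> group_alg G \<Longrightarrow> b \<in> group_alg G \<Longrightarrow> p (a + b) \<le> p a + p b"
    and seminorm_scale: "a \<in> group_alg G \<Longrightarrow> p (\<lambda>g. c * a g) = cmod c * p a"
    and seminorm_star: "a \<in> group_alg G \<Longrightarrow> p (ga_mult G (ga_star G a) a) = (p a)\<^sup>2"
  using p unfolding cstar_seminorm_def by blast+

text \<open>The star of \<open>delta g\<close> times \<open>delta g\<close> is
  \<open>delta \<one>\<close>, so the squared value at every \<open>g\<close> equals the value at
  the identity, which therefore equals its own square.\<close>

lemma seminorm_delta_le: assumes g: "g \<in> carrier G" shows "p (delta g) \<le> 1"
proof -
  have sq: "(p (delta h))\<^sup>2 = p (delta \<one>)" if "h \<in> carrier G" for h
    using seminorm_star[of "delta h"] that by (simp add: ga_star_delta ga_mult_delta)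
  have "p (delta \<one>) \<le> 1"
  proof (rule ccontr)
    assume "\<not> p (delta \<one>) \<le> 1"
    then have "p (delta \<one>) * 1 < p (delta \<one>) * p (delta \<one>)" by (intro mult_strict_left_mono) auto
    then show False using sq[of \<one>] by (auto simp: power2_eq_square)
  qed
  then have "(p (delta g))\<^sup>2 \<le> 1\<^sup>2" using sq[OF g] by simp
  then show ?thesis by (rule power2_le_imp_le) simp
qed

text \<open>It bounds all seminorms at a fixed \<open>a\<close> at once, so that the supremum in
  \<open>cstar_norm\<close> is over a bounded set.\<close>

lemma seminorm_le_l1:
  assumes a: "a \<in> group_alg G"
  shows "p a \<le> (\<Sum>g | a g \<noteq> 0. cmod (a g))"
proof -
  have fin: "finite {g. a g \<noteq> 0}" and supp: "{g. a g \<noteq> 0} \<subseteq> carrier G"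
    using a unfolding group_alg_def by auto
  have "(\<lambda>h. if h \<in> F then a h else 0) \<in> group_alg G \<and>
      p (\<lambda>h. if h \<in> F then a h else 0) \<le> (\<Sum>g\<in>F. cmod (a g))" if "finite F" "F \<subseteq> carrier G" for F
    using that
  proof (induction F rule: finite_induct)
    case empty
    have "p (\<lambda>g. 0 * 0) = 0" using seminorm_scale[OF group_alg_zero, of 0] by simp
    then show ?case using group_alg_zero by (simp add: zero_fun_def)
  next
    case (insert g F)
    let ?aF = "\<lambda>h. if h \<in> F then a h else 0"
    have IH: "?aF \<in> group_alg G" "p ?aF \<le> (\<Sum>g\<in>F. cmod (a g))" using insert by auto
    have g: "g \<in> carrier G" using insert by auto
    have d: "(\<lambda>h. a g * delta g h) \<in> group_alg G" by (intro group_alg_scale delta_in g)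
    have eq: "(\<lambda>h. if h \<in> insert g F then a h else 0) = ?aF + (\<lambda>h. a g * delta g h)"
      using insert.hyps by (auto simp: delta_def fun_eq_iff)
    have "p (?aF + (\<lambda>h. a g * delta g h)) \<le> p ?aF + cmod (a g) * p (delta g)"
      using seminorm_add[OF IH(1) d] seminorm_scale[OF delta_in[OF g], of "a g"] by simp
    also have "\<dots> \<le> (\<Sum>g\<in>F. cmod (a g)) + cmod (a g) * 1"
      by (intro add_mono IH(2) mult_left_mono seminorm_delta_le[OF g]) simp
    finally show ?case unfolding eq using insert.hyps group_alg_add[OF IH(1) d] by simp
  qed
  note * = this[OF fin supp]
  have "(\<lambda>h. if h \<in> {g. a g \<noteq> 0} then a h else 0) = a" by auto
  then show ?thesis using * by simp
qed

end

text \<open>Guarantees that the supremum in \<open>cstar_norm\<close> is over a nonempty set, and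
  that it is nonnegative.\<close>

lemma zero_seminorm: "cstar_seminorm G (\<lambda>_. 0)"
  unfolding cstar_seminorm_def by simp

lemma cstar_norm_upper:
  assumes "cstar_seminorm G p" "a \<in> group_alg G"
  shows "p a \<le> cstar_norm G a"
  unfolding cstar_norm_def
proof (rule cSUP_upper)
  show "bdd_above ((\<lambda>p. p a) ` Collect (cstar_seminorm G))"
    by (rule bdd_aboveI2) (use seminorm_le_l1 assms(2) in blast)
qed (use assms in simp)

lemma cstar_norm_delta_le: "g \<in> carrier G \<Longrightarrow> cstar_norm G (delta g) \<le> 1"
  unfolding cstar_norm_def
  by (rule cSUP_least) (use zero_seminorm seminorm_delta_le in auto)

lemma cstar_norm_zero_le: "cstar_norm G 0 \<le> 1"
  unfolding cstar_norm_def
proof (rule cSUP_least)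
  fix p assume "p \<in> Collect (cstar_seminorm G)"
  then show "p 0 \<le> 1" using seminorm_le_l1[of p 0] group_alg_zero by simp
qed (use zero_seminorm in auto)

section \<open>The dual of the group algebra as a metric space\<close>

definition unit_ball :: "('a \<Rightarrow> complex) set" where
  "unit_ball = {a \<in> group_alg G. cstar_norm G a \<le> 1}"

lemma dual_norm_eq: "dual_norm G \<omega> = (SUP a\<in>unit_ball. cmod (functional_at \<omega> a))"
  by (simp add: dual_norm_def unit_ball_def)

lemma zero_in_unit_ball: "0 \<in> unit_ball"
  using group_alg_zero cstar_norm_zero_le by (simp add: unit_ball_def)

lemma dual_norm_le:
  assumes "\<And>a. a \<in> unit_ball \<Longrightarrow> cmod (functional_at \<omega> a) \<le> C"
  shows "dual_norm G \<omega> \<le> C"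
  unfolding dual_norm_eq by (rule cSUP_least) (use assms zero_in_unit_ball in auto)

lemma le_dual_norm:
  assumes w: "\<omega> \<in> cstar_dual G" and a: "a \<in> unit_ball"
  shows "cmod (functional_at \<omega> a) \<le> dual_norm G \<omega>"
  unfolding dual_norm_eq
proof (rule cSUP_upper[OF a])
  obtain L where L: "\<forall>a\<in>group_alg G. cmod (functional_at \<omega> a) \<le> L * cstar_norm G a"
    using w unfolding cstar_dual_def by blast
  \<comment> \<open>Membership in the dual does not say that \<open>L\<close> is nonnegative, hence
    the absolute value.\<close>
  have "cmod (functional_at \<omega> b) \<le> \<bar>L\<bar>" if b: "b \<in> unit_ball" for b
  proof -
    have bg: "b \<in> group_alg G" "cstar_norm G b \<le> 1" using b unfolding unit_ball_def by auto
    have "0 \<le> cstar_norm G b" using cstar_norm_upper[OF zero_seminorm bg(1)] .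
    then have "L * cstar_norm G b \<le> \<bar>L\<bar> * 1" using bg(2) by (intro mult_mono) auto
    then show ?thesis using L bg(1) by force
  qed
  then show "bdd_above ((\<lambda>a. cmod (functional_at \<omega> a)) ` unit_ball)" by (intro bdd_aboveI2)
qed

lemma functional_at_delta: "functional_at \<omega> (delta g) = \<omega> g"
  unfolding functional_at_def delta_support by (simp add: delta_def)

lemma functional_at_diff:
  assumes "a \<in> group_alg G"
  shows "functional_at (\<lambda>g\<in>carrier G. \<omega>1 g - \<omega>2 g) a = functional_at \<omega>1 a - functional_at \<omega>2 a"
proof -
  have "functional_at (\<lambda>g\<in>carrier G. \<omega>1 g - \<omega>2 g) a = (\<Sum>g | a g \<noteq> 0. a g * \<omega>1 g - a g * \<omega>2 g)"
    unfolding functional_at_def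
    by (rule sum.cong) (use assms in \<open>auto simp: group_alg_def algebra_simps\<close>)
  then show ?thesis unfolding functional_at_def by (simp add: sum_subtractf)
qed

lemma cstar_dual_diff:
  assumes "\<omega>1 \<in> cstar_dual G" "\<omega>2 \<in> cstar_dual G"
  shows "(\<lambda>g\<in>carrier G. \<omega>1 g - \<omega>2 g) \<in> cstar_dual G"
proof -
  obtain L1 where L1: "\<forall>a\<in>group_alg G. cmod (functional_at \<omega>1 a) \<le> L1 * cstar_norm G a"
    using assms(1) unfolding cstar_dual_def by blast
  obtain L2 where L2: "\<forall>a\<in>group_alg G. cmod (functional_at \<omega>2 a) \<le> L2 * cstar_norm G a"
    using assms(2) unfolding cstar_dual_def by blast
  have "cmod (functional_at (\<lambda>g\<in>carrier G. \<omega>1 g - \<omega>2 g) a) \<le> (L1 + L2) * cstar_norm G a"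
    if a: "a \<in> group_alg G" for a
    using L1[rule_format, OF a] L2[rule_format, OF a]
      norm_triangle_ineq4[of "functional_at \<omega>1 a" "functional_at \<omega>2 a"]
    unfolding functional_at_diff[OF a] distrib_right by linarith
  then show ?thesis unfolding cstar_dual_def by auto
qed

lemma dual_dist_eq:
  "\<omega>1 \<in> cstar_dual G \<Longrightarrow> \<omega>2 \<in> cstar_dual G \<Longrightarrow>
    dual_dist G \<omega>1 \<omega>2 = dual_norm G (\<lambda>g\<in>carrier G. \<omega>1 g - \<omega>2 g)"
  by (simp add: dual_dist_def)

lemma dual_dist_le:
  assumes w: "\<omega>1 \<in> cstar_dual G" "\<omega>2 \<in> cstar_dual G"
    and le: "\<And>a. a \<in> unit_ball \<Longrightarrow> cmod (functional_at \<omega>1 a - functional_at \<omega>2 a) \<le> C"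
  shows "dual_dist G \<omega>1 \<omega>2 \<le> C"
  unfolding dual_dist_eq[OF w]
  by (rule dual_norm_le) (use le functional_at_diff in \<open>simp add: unit_ball_def\<close>)

lemma le_dual_dist:
  assumes w: "\<omega>1 \<in> cstar_dual G" "\<omega>2 \<in> cstar_dual G" and a: "a \<in> unit_ball"
  shows "cmod (functional_at \<omega>1 a - functional_at \<omega>2 a) \<le> dual_dist G \<omega>1 \<omega>2"
  using le_dual_norm[OF cstar_dual_diff[OF w] a] functional_at_diff[of a \<omega>1 \<omega>2] a
  unfolding dual_dist_eq[OF w] by (simp add: unit_ball_def)

lemma dual_metric: "Metric_space (cstar_dual G) (dual_dist G)"
proof
  show nonneg: "0 \<le> dual_dist G x y" for x y
  proof (cases "x \<in> cstar_dual G \<and> y \<in> cstar_dual G")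
    case True
    then show ?thesis
      using order_trans[OF norm_ge_zero le_dual_dist[OF _ _ zero_in_unit_ball, of x y]] by simp
  qed (auto simp: dual_dist_def)
  have le: "dual_dist G x y \<le> dual_dist G y x" if "x \<in> cstar_dual G" "y \<in> cstar_dual G" for x y
    by (rule dual_dist_le[OF that]) (use le_dual_dist[OF that(2,1)] in \<open>simp add: norm_minus_commute\<close>)
  show "dual_dist G x y = dual_dist G y x" for x y
    using le[of x y] le[of y x]
    by (cases "x \<in> cstar_dual G \<and> y \<in> cstar_dual G") (auto simp: dual_dist_def)
  show "dual_dist G x y = 0 \<longleftrightarrow> x = y" if xy: "x \<in> cstar_dual G" "y \<in> cstar_dual G" for x y
  proof
    assume 0: "dual_dist G x y = 0"
    show "x = y"
    proof (rule extensionalityI[of _ "carrier G"])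
      show "x \<in> extensional (carrier G)" "y \<in> extensional (carrier G)"
        using xy unfolding cstar_dual_def by blast+
      \<comment> \<open>Point masses lie in the unit ball and separate functionals, since a
        functional is represented by its values on the group.\<close>
      show "x g = y g" if g: "g \<in> carrier G" for g
        using le_dual_dist[OF xy, of "delta g"] 0 g cstar_norm_delta_le[OF g]
        by (simp add: unit_ball_def functional_at_delta)
    qed
  next
    assume "x = y"
    then show "dual_dist G x y = 0"
      using dual_dist_le[OF xy, of 0] nonneg[of x y] by simp
  qed
  show "dual_dist G x z \<le> dual_dist G x y + dual_dist G y z"
    if xyz: "x \<in> cstar_dual G" "y \<in> cstar_dual G" "z \<in> cstar_dual G" for x y z
  proof (rule dual_dist_le[OF xyz(1,3)])
    fix a assume a: "a \<in> unit_ball"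
    show "cmod (functional_at x a - functional_at z a) \<le> dual_dist G x y + dual_dist G y z"
      using le_dual_dist[OF xyz(1,2) a] le_dual_dist[OF xyz(2,3) a]
        norm_triangle_ineq[of "functional_at x a - functional_at y a" "functional_at y a - functional_at z a"]
      by simp
  qed
qed

section \<open>Inner automorphisms\<close>

definition Ad :: "'a \<Rightarrow> 'a \<Rightarrow> 'a" where
  "Ad g = (\<lambda>x\<in>carrier G. g \<otimes> x \<otimes> inv g)"

lemma Ad_apply: "x \<in> carrier G \<Longrightarrow> Ad g x = g \<otimes> x \<otimes> inv g"
  by (simp add: Ad_def)

lemma inner_autos_eq: "inner_autos G = Ad ` carrier G"
  by (simp add: inner_autos_def Ad_def)

lemma Ad_auto: assumes g: "g \<in> carrier G" shows "Ad g \<in> auto G"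
proof -
  have "bij_betw (Ad g) (carrier G) (carrier G)"
  proof (rule bij_betw_byWitness[where f' = "Ad (inv g)"])
    have *: "a \<otimes> (b \<otimes> x \<otimes> inv b) \<otimes> inv a = (a \<otimes> b) \<otimes> x \<otimes> (inv b \<otimes> inv a)"
      if "a \<in> carrier G" "b \<in> carrier G" "x \<in> carrier G" for a b x
      using that by (simp add: m_assoc)
    show "\<forall>x\<in>carrier G. Ad (inv g) (Ad g x) = x" "\<forall>x\<in>carrier G. Ad g (Ad (inv g) x) = x"
      using g *[of "inv g" g] *[of g "inv g"] by (simp_all add: Ad_apply)
  qed (use g in \<open>auto simp: Ad_apply\<close>)
  moreover have "Ad g (x \<otimes> y) = Ad g x \<otimes> Ad g y" if "x \<in> carrier G" "y \<in> carrier G" for x y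
  proof -
    have "Ad g x \<otimes> Ad g y = g \<otimes> x \<otimes> (inv g \<otimes> g) \<otimes> y \<otimes> inv g"
      using g that by (simp only: Ad_apply m_assoc inv_closed m_closed)
    then show ?thesis using g that by (simp add: Ad_apply m_assoc)
  qed
  ultimately show ?thesis
    unfolding auto_def Bij_def hom_def using g by (auto simp: Ad_def)
qed

end

section \<open>Stability\<close>

context urep
begin

sublocale GA: group_algebra G
  by unfold_locales

section \<open>The star representation of the group algebra\<close>

lemma rop_superset:
  assumes x: "x \<in> X" and F: "finite F" "{g. a g \<noteq> 0} \<subseteq> F" "F \<subseteq> carrier G"
  shows "rop a x = (\<Sum>g\<in>F. sc (a g) (\<pi> g x))"
  unfolding rop_apply[OF x] by (rule sum.mono_neutral_left) (use F in auto)

lemma rop_add: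
  assumes a: "a \<in> group_alg G" and b: "b \<in> group_alg G" and x: "x \<in> X"
  shows "rop (a + b) x = rop a x + rop b x"
proof -
  let ?F = "{g. a g \<noteq> 0} \<union> {g. b g \<noteq> 0}"
  have F: "finite ?F" "?F \<subseteq> carrier G" using a b unfolding group_alg_def by auto
  have "{g. (a + b) g \<noteq> 0} \<subseteq> ?F" by auto
  then have "rop (a + b) x = (\<Sum>g\<in>?F. sc ((a + b) g) (\<pi> g x))"
    using F by (intro rop_superset x) auto
  also have "\<dots> = (\<Sum>g\<in>?F. sc (a g) (\<pi> g x)) + (\<Sum>g\<in>?F. sc (b g) (\<pi> g x))"
    by (simp add: vs.scale_left_distrib sum.distrib)
  also have "\<dots> = rop a x + rop b x"
    using rop_superset[OF x F(1) _ F(2), of a] rop_superset[OF x F(1) _ F(2), of b] by auto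
  finally show ?thesis .
qed

lemma rop_scale:
  assumes a: "a \<in> group_alg G" and x: "x \<in> X"
  shows "rop (\<lambda>g. c * a g) x = sc c (rop a x)"
proof -
  have F: "finite {g. a g \<noteq> 0}" "{g. a g \<noteq> 0} \<subseteq> carrier G" using a unfolding group_alg_def by auto
  have "rop (\<lambda>g. c * a g) x = (\<Sum>g | a g \<noteq> 0. sc (c * a g) (\<pi> g x))"
    by (rule rop_superset[OF x F(1) _ F(2)]) auto
  then show ?thesis unfolding rop_apply[OF x] by (simp add: vs.scale_sum_right)
qed

lemma ga_mult_support:
  assumes a: "a \<in> group_alg G" and b: "b \<in> group_alg G"
  shows "{g. ga_mult G a b g \<noteq> 0} \<subseteq> (\<lambda>(h, k). h \<otimes>\<^bsub>G\<^esub> k) ` ({h. a h \<noteq> 0} \<times> {k. b k \<noteq> 0})"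
proof
  fix g assume "g \<in> {g. ga_mult G a b g \<noteq> 0}"
  then have g: "g \<in> carrier G" and "(\<Sum>h | a h \<noteq> 0. a h * b (inv\<^bsub>G\<^esub> h \<otimes>\<^bsub>G\<^esub> g)) \<noteq> 0"
    unfolding ga_mult_def by (auto split: if_splits)
  then obtain h where h: "a h \<noteq> 0" "b (inv\<^bsub>G\<^esub> h \<otimes>\<^bsub>G\<^esub> g) \<noteq> 0"
    by (metis (mono_tags, lifting) mem_Collect_eq mult_zero_right sum.neutral)
  then have "h \<in> carrier G" using group_algD[OF a] by blast
  then have "g = h \<otimes>\<^bsub>G\<^esub> (inv\<^bsub>G\<^esub> h \<otimes>\<^bsub>G\<^esub> g)" using g by (simp add: G.m_assoc[symmetric])
  then show "g \<in> (\<lambda>(h, k). h \<otimes>\<^bsub>G\<^esub> k) ` ({h. a h \<noteq> 0} \<times> {k. b k \<noteq> 0})"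
    using h by (intro image_eqI[of _ _ "(h, inv\<^bsub>G\<^esub> h \<otimes>\<^bsub>G\<^esub> g)"]) auto
qed

lemma ga_mult_in:
  assumes a: "a \<in> group_alg G" and b: "b \<in> group_alg G"
  shows "ga_mult G a b \<in> group_alg G"
  unfolding group_alg_def
proof (intro CollectI conjI)
  show "finite {g. ga_mult G a b g \<noteq> 0}"
    by (rule finite_subset[OF ga_mult_support[OF a b]]) (use group_algD[OF a] group_algD[OF b] in auto)
  show "{g. ga_mult G a b g \<noteq> 0} \<subseteq> carrier G" by (auto simp: ga_mult_def split: if_splits)
qed

lemma ga_star_in:
  assumes a: "a \<in> group_alg G"
  shows "ga_star G a \<in> group_alg G"
proof -
  have "{g. ga_star G a g \<noteq> 0} \<subseteq> (\<lambda>g. inv\<^bsub>G\<^esub> g) ` {g. a g \<noteq> 0}"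
  proof
    fix g assume "g \<in> {g. ga_star G a g \<noteq> 0}"
    then have "g \<in> carrier G" "a (inv\<^bsub>G\<^esub> g) \<noteq> 0" unfolding ga_star_def by (auto split: if_splits)
    then show "g \<in> (\<lambda>g. inv\<^bsub>G\<^esub> g) ` {g. a g \<noteq> 0}" by (intro image_eqI[of _ _ "inv\<^bsub>G\<^esub> g"]) auto
  qed
  then show ?thesis
    unfolding group_alg_def using group_algD[OF a]
    by (auto simp: ga_star_def split: if_splits intro: finite_subset)
qed

lemma rop_mult:
  assumes a: "a \<in> group_alg G" and b: "b \<in> group_alg G" and x: "x \<in> X"
  shows "rop (ga_mult G a b) x = rop a (rop b x)"
proof -
  let ?A = "{h. a h \<noteq> 0}" and ?B = "{k. b k \<noteq> 0}"
  let ?F = "(\<lambda>(h, k). h \<otimes>\<^bsub>G\<^esub> k) ` (?A \<times> ?B)"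
  have A: "finite ?A" "?A \<subseteq> carrier G" and B: "finite ?B" "?B \<subseteq> carrier G"
    using a b unfolding group_alg_def by auto
  have F: "finite ?F" "?F \<subseteq> carrier G" using A B by auto
  \<comment> \<open>For fixed \<open>h\<close> only products of \<open>h\<close> with the support of
    \<open>b\<close> contribute, which allows the substitution \<open>g = h k\<close>.\<close>
  have inner: "(\<Sum>g\<in>?F. sc (b (inv\<^bsub>G\<^esub> h \<otimes>\<^bsub>G\<^esub> g)) (\<pi> g x)) = \<pi> h (rop b x)" if h: "h \<in> ?A" for h
  proof -
    have hG: "h \<in> carrier G" using h A by blast
    have "(\<Sum>g\<in>?F. sc (b (inv\<^bsub>G\<^esub> h \<otimes>\<^bsub>G\<^esub> g)) (\<pi> g x)) =
        (\<Sum>g\<in>(\<lambda>k. h \<otimes>\<^bsub>G\<^esub> k) ` ?B. sc (b (inv\<^bsub>G\<^esub> h \<otimes>\<^bsub>G\<^esub> g)) (\<pi> g x))"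
    proof (rule sum.mono_neutral_right)
      show "(\<lambda>k. h \<otimes>\<^bsub>G\<^esub> k) ` ?B \<subseteq> ?F" using h by auto
      show "\<forall>g\<in>?F - (\<lambda>k. h \<otimes>\<^bsub>G\<^esub> k) ` ?B. sc (b (inv\<^bsub>G\<^esub> h \<otimes>\<^bsub>G\<^esub> g)) (\<pi> g x) = 0"
      proof
        fix g assume g: "g \<in> ?F - (\<lambda>k. h \<otimes>\<^bsub>G\<^esub> k) ` ?B"
        then have "g \<in> carrier G" using F by blast
        then have "g = h \<otimes>\<^bsub>G\<^esub> (inv\<^bsub>G\<^esub> h \<otimes>\<^bsub>G\<^esub> g)" using hG by (simp add: G.m_assoc[symmetric])
        then have "b (inv\<^bsub>G\<^esub> h \<otimes>\<^bsub>G\<^esub> g) = 0" using g by blast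
        then show "sc (b (inv\<^bsub>G\<^esub> h \<otimes>\<^bsub>G\<^esub> g)) (\<pi> g x) = 0" by simp
      qed
    qed (rule F)
    also have "\<dots> = (\<Sum>k\<in>?B. sc (b (inv\<^bsub>G\<^esub> h \<otimes>\<^bsub>G\<^esub> (h \<otimes>\<^bsub>G\<^esub> k))) (\<pi> (h \<otimes>\<^bsub>G\<^esub> k) x))"
      by (rule sum.reindex[unfolded o_def]) (use hG B in \<open>auto intro!: inj_onI simp: subset_iff\<close>)
    also have "\<dots> = (\<Sum>k\<in>?B. \<pi> h (sc (b k) (\<pi> k x)))"
    proof (rule sum.cong[OF refl])
      fix k assume "k \<in> ?B"
      then have k: "k \<in> carrier G" using B by blast
      have "inv\<^bsub>G\<^esub> h \<otimes>\<^bsub>G\<^esub> (h \<otimes>\<^bsub>G\<^esub> k) = k" using hG k by (simp add: G.m_assoc[symmetric])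
      then show "sc (b (inv\<^bsub>G\<^esub> h \<otimes>\<^bsub>G\<^esub> (h \<otimes>\<^bsub>G\<^esub> k))) (\<pi> (h \<otimes>\<^bsub>G\<^esub> k) x) = \<pi> h (sc (b k) (\<pi> k x))"
        using \<pi>_mult[OF hG k x] op_scale[OF \<pi>_bops[OF hG] \<pi>_in[OF k x]] by simp
    qed
    also have "\<dots> = \<pi> h (rop b x)"
      unfolding rop_apply[OF x] by (rule op_sum[OF \<pi>_bops[OF hG], symmetric]) (use B x in auto)
    finally show ?thesis .
  qed
  have "rop (ga_mult G a b) x = (\<Sum>g\<in>?F. sc (ga_mult G a b g) (\<pi> g x))"
    by (rule rop_superset[OF x F(1) ga_mult_support[OF a b] F(2)])
  also have "\<dots> = (\<Sum>g\<in>?F. \<Sum>h\<in>?A. sc (a h) (sc (b (inv\<^bsub>G\<^esub> h \<otimes>\<^bsub>G\<^esub> g)) (\<pi> g x)))"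
  proof (rule sum.cong[OF refl])
    fix g assume "g \<in> ?F"
    then have "g \<in> carrier G" using F by blast
    then show "sc (ga_mult G a b g) (\<pi> g x) = (\<Sum>h\<in>?A. sc (a h) (sc (b (inv\<^bsub>G\<^esub> h \<otimes>\<^bsub>G\<^esub> g)) (\<pi> g x)))"
      by (simp add: ga_mult_def vs.scale_sum_left)
  qed
  also have "\<dots> = (\<Sum>h\<in>?A. \<Sum>g\<in>?F. sc (a h) (sc (b (inv\<^bsub>G\<^esub> h \<otimes>\<^bsub>G\<^esub> g)) (\<pi> g x)))"
    by (rule sum.swap)
  also have "\<dots> = (\<Sum>h\<in>?A. sc (a h) (\<pi> h (rop b x)))"
    by (rule sum.cong[OF refl]) (use inner in \<open>simp only: vs.scale_sum_right[symmetric]\<close>)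
  also have "\<dots> = rop a (rop b x)"
    by (rule rop_apply[symmetric]) (use b x in simp)
  finally show ?thesis .
qed

lemma rop_star:
  assumes a: "a \<in> group_alg G"
  shows "adj (rop a) = rop (ga_star G a)"
proof (rule adj_unique[OF rop_bops[OF a] rop_bops[OF ga_star_in[OF a]]])
  fix x y assume x: "x \<in> X" and y: "y \<in> X"
  let ?A = "{g. a g \<noteq> 0}"
  have A: "finite ?A" "?A \<subseteq> carrier G" using a unfolding group_alg_def by auto
  have S: "{g. ga_star G a g \<noteq> 0} \<subseteq> carrier G" "finite {g. ga_star G a g \<noteq> 0}"
    using ga_star_in[OF a] unfolding group_alg_def by auto
  have "ip (rop a x) y = (\<Sum>g\<in>?A. a g * ip x (\<pi> (inv\<^bsub>G\<^esub> g) y))"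
    unfolding rop_apply[OF x] using A x y
    by (subst ip_sum_left) (auto intro!: sum.cong simp: ip_scale_left ip_\<pi>_left subset_iff)
  also have "\<dots> = (\<Sum>g | ga_star G a g \<noteq> 0. cnj (ga_star G a g) * ip x (\<pi> g y))"
    by (rule sum.reindex_bij_witness[where i = "\<lambda>g. inv\<^bsub>G\<^esub> g" and j = "\<lambda>g. inv\<^bsub>G\<^esub> g"])
      (use A in \<open>auto simp: ga_star_def split: if_splits\<close>)
  also have "\<dots> = (\<Sum>g | ga_star G a g \<noteq> 0. cnj (ip (sc (ga_star G a g) (\<pi> g y)) x))"
  proof (rule sum.cong[OF refl])
    fix g assume "g \<in> {g. ga_star G a g \<noteq> 0}"
    then have g: "\<pi> g y \<in> X" using S y by auto
    show "cnj (ga_star G a g) * ip x (\<pi> g y) = cnj (ip (sc (ga_star G a g) (\<pi> g y)) x)"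
      using ip_commute[OF g x] ip_scale_left[OF g x] by simp
  qed
  also have "\<dots> = cnj (\<Sum>g | ga_star G a g \<noteq> 0. ip (sc (ga_star G a g) (\<pi> g y)) x)" by simp
  also have "(\<Sum>g | ga_star G a g \<noteq> 0. ip (sc (ga_star G a g) (\<pi> g y)) x) = ip (rop (ga_star G a) y) x"
    unfolding rop_apply[OF y] by (rule ip_sum_left[OF _ x, symmetric]) (use S y in auto)
  also have "cnj (ip (rop (ga_star G a) y) x) = ip x (rop (ga_star G a) y)"
    by (rule ip_commute[symmetric]) (use ga_star_in[OF a] x y in auto)
  finally show "ip (rop a x) y = ip x (rop (ga_star G a) y)" .
qed

section \<open>The operator norm as a seminorm on the group algebra\<close>

definition opn :: "('v \<Rightarrow> 'v) \<Rightarrow> real" where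
  "opn T = (SUP x\<in>{x \<in> X. nm x \<le> 1}. nm (T x))"

lemma opn_least:
  assumes "0 \<le> C" "\<And>x. x \<in> X \<Longrightarrow> nm (T x) \<le> C * nm x"
  shows "opn T \<le> C"
  unfolding opn_def
proof (rule cSUP_least)
  fix x assume "x \<in> {x \<in> X. nm x \<le> 1}"
  then show "nm (T x) \<le> C"
    using assms(2)[of x] mult_left_mono[of "nm x" 1 C] assms(1) by auto
qed (use zero_in nm_zero in \<open>auto intro!: exI[of _ 0]\<close>)

lemma opn_ge:
  assumes T: "T \<in> bops" and x: "x \<in> X"
  shows "nm (T x) \<le> opn T * nm x"
proof (cases "x = 0")
  case True
  then show ?thesis using op_zero[OF T] by simp
next
  case False
  obtain L where L: "0 \<le> L" "\<And>x. x \<in> X \<Longrightarrow> nm (T x) \<le> L * nm x"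
    using op_bound[OF T] by metis
  have n: "0 < nm x" using False nm_eq0[OF x] nm_ge0[OF x] by linarith
  let ?y = "sc (complex_of_real (1 / nm x)) x"
  have y: "?y \<in> X" "nm ?y \<le> 1" using x n by (simp_all add: nm_scale norm_divide)
  have "nm (T ?y) \<le> opn T"
    unfolding opn_def
  proof (rule cSUP_upper)
    have "nm (T z) \<le> L" if "z \<in> X" "nm z \<le> 1" for z
      using L(2)[OF that(1)] mult_left_mono[OF that(2) L(1)] by simp
    then show "bdd_above ((\<lambda>x. nm (T x)) ` {x \<in> X. nm x \<le> 1})" by (intro bdd_aboveI2) auto
  qed (use y in simp)
  moreover have "nm (T ?y) = nm (T x) / nm x"
    using x n T by (simp add: op_scale nm_scale norm_divide)
  ultimately show ?thesis using n by (simp add: pos_divide_le_eq)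
qed

lemma opn_ge0: "T \<in> bops \<Longrightarrow> 0 \<le> opn T"
  unfolding opn_def
proof -
  assume T: "T \<in> bops"
  obtain L where L: "0 \<le> L" "\<And>x. x \<in> X \<Longrightarrow> nm (T x) \<le> L * nm x"
    using op_bound[OF T] by metis
  have b: "nm (T z) \<le> L" if "z \<in> X" "nm z \<le> 1" for z
    using L(2)[OF that(1)] mult_left_mono[OF that(2) L(1)] by simp
  have "nm (T 0) \<le> (SUP x\<in>{x \<in> X. nm x \<le> 1}. nm (T x))"
    by (rule cSUP_upper) (use b in \<open>auto intro!: bdd_aboveI2\<close>)
  then show "0 \<le> (SUP x\<in>{x \<in> X. nm x \<le> 1}. nm (T x))" using op_zero[OF T] by simp
qed

text \<open>It places the operator norm among the seminorms whose supremum is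
  \<open>cstar_norm\<close>, so that every unitary representation is contractive for that
  norm.\<close>

lemma cstar_seminorm_opn: "cstar_seminorm G (\<lambda>a. opn (rop a))"
  unfolding cstar_seminorm_def
proof (intro conjI ballI allI)
  fix a assume a: "a \<in> group_alg G"
  note ab = rop_bops[OF a]
  show "0 \<le> opn (rop a)" by (rule opn_ge0[OF ab])
  { fix b assume b: "b \<in> group_alg G"
    note bb = rop_bops[OF b]
    show "opn (rop (a + b)) \<le> opn (rop a) + opn (rop b)"
    proof (rule opn_least)
      fix x assume x: "x \<in> X"
      show "nm (rop (a + b) x) \<le> (opn (rop a) + opn (rop b)) * nm x"
        unfolding rop_add[OF a b x]
        using nm_triangle[OF op_in[OF ab x] op_in[OF bb x]] opn_ge[OF ab x] opn_ge[OF bb x]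
        by (simp add: distrib_right)
    qed (use opn_ge0[OF ab] opn_ge0[OF bb] in simp)
    show "opn (rop (ga_mult G a b)) \<le> opn (rop a) * opn (rop b)"
    proof (rule opn_least)
      fix x assume x: "x \<in> X"
      have "nm (rop (ga_mult G a b) x) \<le> opn (rop a) * nm (rop b x)"
        unfolding rop_mult[OF a b x] by (rule opn_ge[OF ab op_in[OF bb x]])
      also have "\<dots> \<le> opn (rop a) * (opn (rop b) * nm x)"
        by (rule mult_left_mono[OF opn_ge[OF bb x] opn_ge0[OF ab]])
      finally show "nm (rop (ga_mult G a b) x) \<le> opn (rop a) * opn (rop b) * nm x" by (simp add: mult.assoc)
    qed (use opn_ge0[OF ab] opn_ge0[OF bb] in simp) }
  note mult = this
  have scale_le: "opn (rop (\<lambda>g. c * a g)) \<le> cmod c * opn (rop a)" if a: "a \<in> group_alg G" for c a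
  proof (rule opn_least)
    fix x assume x: "x \<in> X"
    show "nm (rop (\<lambda>g. c * a g) x) \<le> cmod c * opn (rop a) * nm x"
      unfolding rop_scale[OF a x] using opn_ge[OF rop_bops[OF a] x] x a
      by (simp add: nm_scale mult.assoc mult_left_mono)
  qed (use opn_ge0[OF rop_bops[OF a]] in simp)
  show "opn (rop (\<lambda>g. c * a g)) = cmod c * opn (rop a)" for c
  proof (cases "c = 0")
    case True
    then show ?thesis
      using scale_le[OF a, of c] opn_ge0[OF rop_bops[OF GA.group_alg_scale[OF a, of c]]] by simp
  next
    case False
    \<comment> \<open>The reverse inequality is the one already shown, applied to the factor
      \<open>inverse c\<close>.\<close>
    have "opn (rop (\<lambda>g. inverse c * (c * a g))) \<le> cmod (inverse c) * opn (rop (\<lambda>g. c * a g))"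
      by (rule scale_le[OF GA.group_alg_scale[OF a]])
    then have "opn (rop a) \<le> inverse (cmod c) * opn (rop (\<lambda>g. c * a g))"
      using False by (simp add: mult.assoc[symmetric] norm_inverse)
    then have "cmod c * opn (rop a) \<le> cmod c * (inverse (cmod c) * opn (rop (\<lambda>g. c * a g)))"
      by (rule mult_left_mono) simp
    then have "cmod c * opn (rop a) \<le> opn (rop (\<lambda>g. c * a g))"
      using False by (simp add: mult.assoc[symmetric])
    then show ?thesis using scale_le[OF a, of c] by simp
  qed
  have sa: "ga_star G a \<in> group_alg G" by (rule ga_star_in[OF a])
  \<comment> \<open>Moving \<open>rop a\<close> to the other side of
    \<open>ip (rop a x) (rop a x)\<close> gives one half of the norm identity.\<close>
  have star: "nm (rop a x) * nm (rop a x) \<le> opn (rop (ga_mult G (ga_star G a) a)) * nm x * nm x" if x: "x \<in> X" for x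
  proof -
    have ma: "ga_mult G (ga_star G a) a \<in> group_alg G" by (rule ga_mult_in[OF sa a])
    have "(nm (rop a x))\<^sup>2 = Re (ip (rop (ga_mult G (ga_star G a) a) x) x)"
      using ip_adj_left[OF ab op_in[OF ab x] x] rop_mult[OF sa a x] rop_star[OF a] nm_sq[OF op_in[OF ab x]] by simp
    also have "\<dots> \<le> nm (rop (ga_mult G (ga_star G a) a) x) * nm x"
      by (rule Re_ip_le) (use ma x in auto)
    also have "\<dots> \<le> (opn (rop (ga_mult G (ga_star G a) a)) * nm x) * nm x"
      by (rule mult_right_mono[OF opn_ge[OF rop_bops[OF ma] x]]) (use x in simp)
    finally show ?thesis by (simp add: power2_eq_square)
  qed
  let ?q = "opn (rop (ga_mult G (ga_star G a) a))"
  have q0: "0 \<le> ?q" by (rule opn_ge0[OF rop_bops[OF ga_mult_in[OF sa a]]])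
  have "opn (rop a) \<le> sqrt ?q"
  proof (rule opn_least)
    fix x assume x: "x \<in> X"
    have "(nm (rop a x))\<^sup>2 \<le> (sqrt ?q * nm x)\<^sup>2"
      using star[OF x] q0 by (simp add: power_mult_distrib power2_eq_square[of "nm _"] mult.assoc)
    then show "nm (rop a x) \<le> sqrt ?q * nm x" by (rule power2_le_imp_le) (use q0 x in simp)
  qed (use q0 in simp)
  then have le1: "(opn (rop a))\<^sup>2 \<le> ?q"
    using opn_ge0[OF ab] q0 by (metis power_mono real_sqrt_pow2)
  \<comment> \<open>By duality the adjoint has no larger norm; submultiplicativity then gives the
    other half.\<close>
  have adj_le: "opn (rop (ga_star G b)) \<le> opn (rop b)" if b: "b \<in> group_alg G" for b
  proof (rule opn_least)
    note bb = rop_bops[OF b] and sb = rop_bops[OF ga_star_in[OF b]]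
    fix x assume x: "x \<in> X"
    show "nm (rop (ga_star G b) x) \<le> opn (rop b) * nm x"
    proof (rule nm_le_if_ip_le)
      fix y assume y: "y \<in> X"
      have "cmod (ip (rop (ga_star G b) x) y) = cmod (ip x (rop b y))"
        using ip_adj_left[OF bb x y] rop_star[OF b] by simp
      also have "\<dots> \<le> nm x * nm (rop b y)" by (rule Cauchy_Schwarz[OF x op_in[OF bb y]])
      also have "\<dots> \<le> nm x * (opn (rop b) * nm y)" by (rule mult_left_mono[OF opn_ge[OF bb y] nm_ge0[OF x]])
      finally show "cmod (ip (rop (ga_star G b) x) y) \<le> opn (rop b) * nm x * nm y" by (simp add: mult_ac)
    qed (use sb x opn_ge0[OF bb] in auto)
  qed (rule opn_ge0[OF rop_bops[OF b]])
  have "?q \<le> opn (rop (ga_star G a)) * opn (rop a)"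
  proof (rule opn_least)
    fix x assume x: "x \<in> X"
    have "nm (rop (ga_mult G (ga_star G a) a) x) \<le> opn (rop (ga_star G a)) * nm (rop a x)"
      unfolding rop_mult[OF sa a x] by (rule opn_ge[OF rop_bops[OF sa] op_in[OF ab x]])
    also have "\<dots> \<le> opn (rop (ga_star G a)) * (opn (rop a) * nm x)"
      by (rule mult_left_mono[OF opn_ge[OF ab x] opn_ge0[OF rop_bops[OF sa]]])
    finally show "nm (rop (ga_mult G (ga_star G a) a) x) \<le> opn (rop (ga_star G a)) * opn (rop a) * nm x"
      by (simp add: mult.assoc)
  qed (use opn_ge0[OF ab] opn_ge0[OF rop_bops[OF sa]] in simp)
  also have "\<dots> \<le> opn (rop a) * opn (rop a)"
    by (rule mult_right_mono[OF adj_le[OF a] opn_ge0[OF ab]])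
  finally show "?q = (opn (rop a))\<^sup>2" using le1 by (simp add: power2_eq_square)
qed

lemma nm_rop_le: "a \<in> group_alg G \<Longrightarrow> x \<in> X \<Longrightarrow> nm (rop a x) \<le> cstar_norm G a * nm x"
  using opn_ge[OF rop_bops, of a x] mult_right_mono[OF GA.cstar_norm_upper[OF cstar_seminorm_opn, of a] nm_ge0[of x]]
  by simp

lemma contractive_unit_ball:
  assumes "a \<in> GA.unit_ball"
  shows "contractive a"
  unfolding contractive_def
proof (intro conjI ballI)
  have a: "a \<in> group_alg G" "cstar_norm G a \<le> 1" using assms unfolding GA.unit_ball_def by blast+
  show "a \<in> group_alg G" by (rule a)
  fix x assume x: "x \<in> X"
  have "nm (rop a x) \<le> cstar_norm G a * nm x" by (rule nm_rop_le[OF a(1) x])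
  also have "\<dots> \<le> 1 * nm x" by (rule mult_right_mono[OF a(2) nm_ge0[OF x]])
  finally show "nm (rop a x) \<le> nm x" by simp
qed

lemma functional_at_vector:
  assumes a: "a \<in> group_alg G" and v: "v \<in> X"
  shows "functional_at (\<lambda>g\<in>carrier G. ip (\<pi> g v) v) a = ip (rop a v) v"
proof -
  have "ip (rop a v) v = (\<Sum>g | a g \<noteq> 0. ip (sc (a g) (\<pi> g v)) v)"
    unfolding rop_apply[OF v] by (rule ip_sum_left) (use group_algD(2)[OF a] v in auto)
  also have "\<dots> = functional_at (\<lambda>g\<in>carrier G. ip (\<pi> g v) v) a"
    unfolding functional_at_def
    by (rule sum.cong[OF refl]) (use group_algD(2)[OF a] v in \<open>auto simp: ip_scale_left\<close>)
  finally show ?thesis by simp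
qed

lemma vector_functional_Ad:
  assumes g: "g \<in> carrier G" and v: "v \<in> X"
  shows "compose (carrier G) (vector_functional G H \<pi> v) (GA.Ad g) =
    (\<lambda>h\<in>carrier G. ip (\<pi> h (\<pi> (inv\<^bsub>G\<^esub> g) v)) (\<pi> (inv\<^bsub>G\<^esub> g) v))"
proof
  fix h
  show "compose (carrier G) (vector_functional G H \<pi> v) (GA.Ad g) h =
    (\<lambda>h\<in>carrier G. ip (\<pi> h (\<pi> (inv\<^bsub>G\<^esub> g) v)) (\<pi> (inv\<^bsub>G\<^esub> g) v)) h"
  proof (cases "h \<in> carrier G")
    case True
    have "ip (\<pi> (g \<otimes>\<^bsub>G\<^esub> h \<otimes>\<^bsub>G\<^esub> inv\<^bsub>G\<^esub> g) v) v = ip (\<pi> g (\<pi> h (\<pi> (inv\<^bsub>G\<^esub> g) v))) v"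
      using g True v by (simp add: \<pi>_mult)
    then show ?thesis
      using True g v ip_\<pi>_left[OF g, of "\<pi> h (\<pi> (inv\<^bsub>G\<^esub> g) v)" v]
      by (simp add: compose_def vector_functional_def GA.Ad_apply)
  qed (simp add: compose_def)
qed

lemma vector_functional_dual:
  assumes v: "v \<in> X"
  shows "(\<lambda>h\<in>carrier G. ip (\<pi> h v) v) \<in> cstar_dual G"
  unfolding cstar_dual_def
proof (intro CollectI conjI exI[of _ "nm v * nm v"] ballI)
  fix a assume a: "a \<in> group_alg G"
  have "cmod (ip (rop a v) v) \<le> nm (rop a v) * nm v"
    by (rule Cauchy_Schwarz[OF op_in[OF rop_bops[OF a] v] v])
  also have "\<dots> \<le> (cstar_norm G a * nm v) * nm v"
    by (rule mult_right_mono[OF nm_rop_le[OF a v] nm_ge0[OF v]])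
  finally show "cmod (functional_at (\<lambda>h\<in>carrier G. ip (\<pi> h v) v) a) \<le> nm v * nm v * cstar_norm G a"
    unfolding functional_at_vector[OF a v] by (simp add: mult_ac)
qed simp

text \<open>Translating by \<open>\<theta>\<^sub>0 = Ad g\<^sub>0\<close> turns the vector functional of \<open>\<eta>\<close> into the one of
  \<open>\<pi>(g\<^sub>0)\<^sup>-\<^sup>1 \<eta>\<close>, so that continuity need only be checked at the identity.\<close>

theorem stable_repI:
  assumes inv: "\<And>v. v \<in> X \<Longrightarrow> almost_invariant v v"
  shows "stable_rep G H \<pi>"
  unfolding stable_rep_def
proof (intro conjI ballI)
  show "unitary_rep G H \<pi>" using unitary_rep_iff urep_axioms by blast
  fix v assume v: "v \<in> X"
  interpret Metric_space "cstar_dual G" "dual_dist G" by (rule GA.dual_metric)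
  let ?\<Omega> = "\<lambda>\<theta>. compose (carrier G) (vector_functional G H \<pi> v) \<theta>"
  let ?T = "subtopology (aut_topology G) (inner_autos G)"
  show "continuous_map ?T (dual_topology G) ?\<Omega>"
    unfolding dual_topology_def continuous_map_to_metric
  proof (intro ballI allI impI)
    fix \<theta>0 and e :: real assume \<theta>0: "\<theta>0 \<in> topspace ?T" and e: "e > 0"
    then obtain g0 where g0: "g0 \<in> carrier G" "\<theta>0 = GA.Ad g0"
      unfolding GA.inner_autos_eq by auto
    define w where "w = \<pi> (inv\<^bsub>G\<^esub> g0) v"
    have w: "w \<in> X" unfolding w_def using g0 v by simp
    \<comment> \<open>Half of \<open>e\<close>, because the dual distance is only bounded weakly
      while the ball is open.\<close>
    obtain F where F: "finite F" "F \<subseteq> carrier G"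
      "\<forall>g\<in>centralizer F. \<forall>a. contractive a \<longrightarrow> cmod (variation g a w w) \<le> e / 2"
      using inv[OF w, unfolded almost_invariant_def, rule_format, of "e / 2"] e by auto
    \<comment> \<open>The identity element keeps the intersection over a nonempty index set and
      imposes no condition on an automorphism.\<close>
    let ?F = "insert \<one>\<^bsub>G\<^esub> F"
    have F': "finite ?F" "?F \<subseteq> carrier G" "?F \<noteq> {}" using F by auto
    define V where "V = (\<Inter>f\<in>?F. \<theta>0 <#\<^bsub>AutoGroup G\<^esub> aut_stab G f)"
    have "openin (aut_topology G) V"
      unfolding V_def
    proof (rule openin_INT2[OF F'(1,3)])
      fix f assume f: "f \<in> ?F"
      show "openin (aut_topology G) (\<theta>0 <#\<^bsub>AutoGroup G\<^esub> aut_stab G f)"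
        unfolding aut_topology_def
        by (rule topology_generated_by_Basis) (use f F'(2) g0 GA.Ad_auto in blast)
    qed
    then have op: "openin ?T (V \<inter> inner_autos G)" by (rule openin_subtopology_Int)
    have mult: "\<theta>0 \<otimes>\<^bsub>AutoGroup G\<^esub> \<psi> = compose (carrier G) \<theta>0 \<psi>" if "\<psi> \<in> auto G" for \<psi>
      using GA.Ad_auto[OF g0(1)] that g0(2) unfolding AutoGroup_def BijGroup_def auto_def by simp
    have id: "(\<lambda>x\<in>carrier G. x) \<in> auto G" by (rule G.id_in_auto)
    have "\<theta>0 = compose (carrier G) \<theta>0 (\<lambda>x\<in>carrier G. x)"
      unfolding g0(2) GA.Ad_def compose_def by auto
    then have "\<theta>0 \<in> \<theta>0 <#\<^bsub>AutoGroup G\<^esub> aut_stab G f" if "f \<in> ?F" for f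
      using that F'(2) id mult[OF id] unfolding l_coset_def aut_stab_def
      by (auto intro!: exI[of _ "\<lambda>x\<in>carrier G. x"])
    then have in_V: "\<theta>0 \<in> V \<inter> inner_autos G"
      unfolding V_def GA.inner_autos_eq using g0 by auto
    have near: "?\<Omega> \<theta> \<in> mball (?\<Omega> \<theta>0) e" if \<theta>: "\<theta> \<in> V \<inter> inner_autos G" for \<theta>
    proof -
      obtain g where g: "g \<in> carrier G" "\<theta> = GA.Ad g" using \<theta> unfolding GA.inner_autos_eq by auto
      \<comment> \<open>\<open>Ad g\<close> and \<open>Ad g0\<close> agree at \<open>f\<close>
        exactly when this \<open>k\<close> commutes with \<open>f\<close>; moreover
        \<open>\<pi> k\<close> carries the vector belonging to \<open>g0\<close> to the one
        belonging to \<open>g\<close>.\<close>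
      define k where "k = inv\<^bsub>G\<^esub> g \<otimes>\<^bsub>G\<^esub> g0"
      have k: "k \<in> carrier G" unfolding k_def using g g0 by simp
      have kw: "\<pi> k w = \<pi> (inv\<^bsub>G\<^esub> g) v"
        unfolding k_def w_def using g g0 v by (simp add: \<pi>_mult \<pi>_inv2)
      have "k \<in> centralizer F"
        unfolding centralizer_def
      proof (intro CollectI conjI k ballI)
        fix f assume f: "f \<in> F"
        then have fG: "f \<in> carrier G" using F by blast
        have "\<theta> \<in> \<theta>0 <#\<^bsub>AutoGroup G\<^esub> aut_stab G f" using \<theta> f unfolding V_def by blast
        then obtain \<psi> where \<psi>: "\<psi> \<in> auto G" "\<psi> f = f" "\<theta> = \<theta>0 \<otimes>\<^bsub>AutoGroup G\<^esub> \<psi>"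
          unfolding l_coset_def aut_stab_def by blast
        then have "\<theta> f = \<theta>0 f" using mult fG by (simp add: compose_def)
        then have eq: "g \<otimes>\<^bsub>G\<^esub> f \<otimes>\<^bsub>G\<^esub> inv\<^bsub>G\<^esub> g = g0 \<otimes>\<^bsub>G\<^esub> f \<otimes>\<^bsub>G\<^esub> inv\<^bsub>G\<^esub> g0"
          using g g0 fG by (simp add: GA.Ad_apply)
        have "k \<otimes>\<^bsub>G\<^esub> f = inv\<^bsub>G\<^esub> g \<otimes>\<^bsub>G\<^esub> (g0 \<otimes>\<^bsub>G\<^esub> f \<otimes>\<^bsub>G\<^esub> inv\<^bsub>G\<^esub> g0) \<otimes>\<^bsub>G\<^esub> g0"
          unfolding k_def using g(1) g0(1) fG by (simp add: G.m_assoc)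
        also have "\<dots> = (inv\<^bsub>G\<^esub> g \<otimes>\<^bsub>G\<^esub> g) \<otimes>\<^bsub>G\<^esub> f \<otimes>\<^bsub>G\<^esub> (inv\<^bsub>G\<^esub> g \<otimes>\<^bsub>G\<^esub> g0)"
          unfolding eq[symmetric] using g(1) g0(1) fG by (simp only: G.m_assoc G.inv_closed G.m_closed)
        also have "\<dots> = f \<otimes>\<^bsub>G\<^esub> k" unfolding k_def using g(1) g0(1) fG by simp
        finally show "k \<otimes>\<^bsub>G\<^esub> f = f \<otimes>\<^bsub>G\<^esub> k" .
      qed
      then have var: "cmod (variation k a w w) \<le> e / 2" if "contractive a" for a
        using F(3) that by blast
      have \<Omega>0: "?\<Omega> \<theta>0 = (\<lambda>h\<in>carrier G. ip (\<pi> h w) w)"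
        unfolding g0(2) w_def by (rule vector_functional_Ad[OF g0(1) v])
      have \<Omega>: "?\<Omega> \<theta> = (\<lambda>h\<in>carrier G. ip (\<pi> h (\<pi> k w)) (\<pi> k w))"
        unfolding g(2) kw by (rule vector_functional_Ad[OF g(1) v])
      have dual: "?\<Omega> \<theta>0 \<in> cstar_dual G" "?\<Omega> \<theta> \<in> cstar_dual G"
        unfolding \<Omega>0 \<Omega> using vector_functional_dual w k by auto
      have "dual_dist G (?\<Omega> \<theta>0) (?\<Omega> \<theta>) \<le> e / 2"
      proof (rule GA.dual_dist_le[OF dual])
        fix a assume a: "a \<in> GA.unit_ball"
        then have aG: "a \<in> group_alg G" unfolding GA.unit_ball_def by blast
        have "functional_at (?\<Omega> \<theta>0) a - functional_at (?\<Omega> \<theta>) a = - variation k a w w"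
          unfolding \<Omega>0 \<Omega> variation_def
          using functional_at_vector[OF aG w] functional_at_vector[OF aG \<pi>_in[OF k w]] by simp
        then show "cmod (functional_at (?\<Omega> \<theta>0) a - functional_at (?\<Omega> \<theta>) a) \<le> e / 2"
          using var[OF contractive_unit_ball[OF a]] by simp
      qed
      then show ?thesis using dual e by simp
    qed
    then show "\<exists>U. openin ?T U \<and> \<theta>0 \<in> U \<and> (\<forall>\<theta>\<in>U. ?\<Omega> \<theta> \<in> mball (?\<Omega> \<theta>0) e)"
      using op in_V by (intro exI[of _ "V \<inter> inner_autos G"]) auto
  qed
qed

end

section \<open>The group \<open>B\<close>\<close>

lemma B_carrier_iff:
  "(z, s) \<in> carrier B_grp \<longleftrightarrow>
    finite {k. z k \<noteq> 0} \<and> z 0 = 0 \<and> s permutes {1..} \<and> finite {k. s k \<noteq> k}"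
  by (simp add: B_grp_def)

lemma B_mult: "(z, s) \<otimes>\<^bsub>B_grp\<^esub> (z', s') = (\<lambda>k. z k + z' (inv_into UNIV s k), s \<circ> s')"
  by (simp add: B_grp_def)

lemma B_one: "\<one>\<^bsub>B_grp\<^esub> = (\<lambda>k. 0, id)"
  by (simp add: B_grp_def)

lemma group_B: "group B_grp"
proof (rule groupI)
  fix x y assume x: "x \<in> carrier B_grp" and y: "y \<in> carrier B_grp"
  obtain z s z' s' where xy: "x = (z, s)" "y = (z', s')" by fastforce
  have s: "s permutes {1..}" "s' permutes {1..}" using x y unfolding xy B_carrier_iff by auto
  have "{k. z k + z' (inv_into UNIV s k) \<noteq> 0} \<subseteq> {k. z k \<noteq> 0} \<union> s ` {k. z' k \<noteq> 0}"
  proof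
    fix k assume "k \<in> {k. z k + z' (inv_into UNIV s k) \<noteq> 0}"
    then have "z k \<noteq> 0 \<or> z' (inv_into UNIV s k) \<noteq> 0" by auto
    moreover have "k = s (inv_into UNIV s k)" using permutes_inverses(1)[OF s(1)] by simp
    ultimately show "k \<in> {k. z k \<noteq> 0} \<union> s ` {k. z' k \<noteq> 0}" by blast
  qed
  then have "finite {k. z k + z' (inv_into UNIV s k) \<noteq> 0}"
    using x y unfolding xy B_carrier_iff by (auto intro: finite_subset)
  moreover have "{k. (s \<circ> s') k \<noteq> k} \<subseteq> {k. s k \<noteq> k} \<union> {k. s' k \<noteq> k}" by auto
  then have "finite {k. (s \<circ> s') k \<noteq> k}"
    using x y unfolding xy B_carrier_iff by (auto intro: finite_subset)
  moreover have "inv_into UNIV s 0 = 0" using permutes_not_in[OF permutes_inv[OF s(1)], of 0] by simp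
  ultimately show "x \<otimes>\<^bsub>B_grp\<^esub> y \<in> carrier B_grp"
    using x y permutes_compose[OF s(2,1)] unfolding xy B_mult B_carrier_iff by simp
next
  show "\<one>\<^bsub>B_grp\<^esub> \<in> carrier B_grp" by (simp add: B_one B_carrier_iff permutes_id)
next
  fix x y w assume "x \<in> carrier B_grp" "y \<in> carrier B_grp" "w \<in> carrier B_grp"
  moreover obtain z s z' s' z'' s'' where e: "x = (z, s)" "y = (z', s')" "w = (z'', s'')" by fastforce
  ultimately have "bij s" "bij s'" unfolding B_carrier_iff by (auto dest: permutes_bij simp: B_carrier_iff)
  then show "x \<otimes>\<^bsub>B_grp\<^esub> y \<otimes>\<^bsub>B_grp\<^esub> w = x \<otimes>\<^bsub>B_grp\<^esub> (y \<otimes>\<^bsub>B_grp\<^esub> w)"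
    unfolding e B_mult by (simp only: o_inv_distrib o_apply o_assoc add.assoc)
next
  fix x assume "x \<in> carrier B_grp"
  show "\<one>\<^bsub>B_grp\<^esub> \<otimes>\<^bsub>B_grp\<^esub> x = x" by (cases x) (simp only: B_one B_mult inv_id id_apply add_0_left id_o)
next
  fix x assume x: "x \<in> carrier B_grp"
  obtain z s where e: "x = (z, s)" by fastforce
  have s: "s permutes {1..}" using x unfolding e B_carrier_iff by auto
  have "{k. z (s k) \<noteq> 0} \<subseteq> inv_into UNIV s ` {k. z k \<noteq> 0}"
    using permutes_inverses(2)[OF s] by (auto intro!: image_eqI)
  then have "finite {k. z (s k) \<noteq> 0}"
    by (rule finite_subset) (use x in \<open>simp add: e B_carrier_iff del: bit_not_zero_iff\<close>)
  moreover have "{k. inv_into UNIV s k \<noteq> k} \<subseteq> {k. s k \<noteq> k}"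
  proof
    fix k assume "k \<in> {k. inv_into UNIV s k \<noteq> k}"
    moreover have "inv_into UNIV s k = k" if "s k = k"
      using permutes_inverses(2)[OF s, of k] that by simp
    ultimately show "k \<in> {k. s k \<noteq> k}" by blast
  qed
  then have "finite {k. inv_into UNIV s k \<noteq> k}" using x unfolding e B_carrier_iff by (auto intro: finite_subset)
  moreover have "s 0 = 0" using permutes_not_in[OF s, of 0] by simp
  \<comment> \<open>The inverse of \<open>(z, s)\<close>: the sequence is pulled back along
    \<open>s\<close>, without a sign change since in \<open>bit\<close> every element is its own
    negative.\<close>
  ultimately have "(\<lambda>k. z (s k), inv_into UNIV s) \<in> carrier B_grp"
    using x permutes_inv[OF s] unfolding e B_carrier_iff by simp
  moreover have "(\<lambda>k. z (s k), inv_into UNIV s) \<otimes>\<^bsub>B_grp\<^esub> x = \<one>\<^bsub>B_grp\<^esub>"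
    unfolding e B_mult B_one using permutes_inv_o(2)[OF s] permutes_inv_inv[OF s] by (simp add: fun_eq_iff)
  ultimately show "\<exists>y\<in>carrier B_grp. y \<otimes>\<^bsub>B_grp\<^esub> x = \<one>\<^bsub>B_grp\<^esub>" by blast
qed

lemma B_inf_imp:
  assumes "x \<in> B_inf n"
  shows "x \<in> carrier B_grp" "snd x ` {1..n} = {1..n}"
proof -
  obtain h k where hk: "h \<in> B_fin n" "k \<in> B_tail n" "x = h \<otimes>\<^bsub>B_grp\<^esub> k"
    using assms unfolding B_inf_def set_mult_def by auto
  obtain z s z' s' where e: "h = (z, s)" "k = (z', s')" by fastforce
  have hk_in: "h \<in> carrier B_grp" "k \<in> carrier B_grp" using hk unfolding B_fin_def B_tail_def by auto
  show "x \<in> carrier B_grp" using monoid.m_closed[OF group.is_monoid[OF group_B]] hk_in hk(3) by simp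
  have "s permutes {1..}" using hk_in unfolding e B_carrier_iff by auto
  moreover have "s i = i" if "i \<notin> {1..n}" for i
    using hk(1) that unfolding B_fin_def B_supp_def e by auto
  ultimately have "s permutes {1..n}" unfolding permutes_def by blast
  then have 1: "s ` {1..n} = {1..n}" by (rule permutes_image)
  have "s' i = i" if "i \<in> {1..n}" for i
    using hk(2) that unfolding B_tail_def B_supp_def e by fastforce
  then have 2: "s' ` {1..n} = {1..n}" by auto
  show "snd x ` {1..n} = {1..n}" unfolding hk(3) e B_mult snd_conv image_comp[symmetric] 2 1 ..
qed

text \<open>Together with \<open>B_inf_imp\<close> this identifies the subgroup as the elements
  whose permutation preserves \<open>{1..n}\<close>. The sequence imposes nothing, because it splits
  at \<open>n\<close> into two finitely supported parts.\<close>

lemma B_infI: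
  assumes x: "(z, s) \<in> carrier B_grp" and im: "s ` {1..n} = {1..n}"
  shows "(z, s) \<in> B_inf n"
proof -
  have s: "s permutes {1..}" and z: "finite {k. z k \<noteq> 0}" "z 0 = 0" and fs: "finite {k. s k \<noteq> k}"
    using x unfolding B_carrier_iff by auto
  have inj: "inj s" by (rule permutes_inj[OF s])
  define s1 where "s1 = restrict_id s {1..n}"
  define s2 where "s2 = restrict_id s {n + 1..}"
  have s1: "s1 permutes {1..n}"
    unfolding s1_def by (rule permutes_restrict_id) (use inj im in \<open>auto simp: bij_betw_def inj_on_def\<close>)
  have tail: "{n + 1..} = {1..} - {1..n}" by auto
  have im2: "s ` {n + 1..} = {n + 1..}"
    unfolding tail image_set_diff[OF inj] permutes_image[OF s] im ..
  have s2: "s2 permutes {n + 1..}"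
    unfolding s2_def by (rule permutes_restrict_id) (use inj im2 in \<open>auto simp: bij_betw_def inj_on_def\<close>)
  \<comment> \<open>The condition \<open>k \<le> n\<close> also takes in index 0, where
    \<open>z\<close> vanishes.\<close>
  define z1 where "z1 k = (if k \<le> n then z k else 0)" for k
  define z2 where "z2 k = (if k \<le> n then 0 else z k)" for k
  have "finite {k. z1 k \<noteq> 0}" "finite {k. z2 k \<noteq> 0}"
    using z(1) by (auto simp: z1_def z2_def intro: finite_subset[rotated])
  moreover have "finite {k. s1 k \<noteq> k}" "finite {k. s2 k \<noteq> k}"
    using fs by (auto simp: s1_def s2_def restrict_id_def intro: finite_subset[rotated])
  moreover have "s1 permutes {1..}" "s2 permutes {1..}"
    by (rule permutes_subset[OF s1], force, rule permutes_subset[OF s2], force)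
  ultimately have c: "(z1, s1) \<in> carrier B_grp" "(z2, s2) \<in> carrier B_grp"
    unfolding B_carrier_iff using z(2) by (auto simp: z1_def z2_def)
  have z1_pos: "k \<in> {1..n}" if "z1 k \<noteq> 0" for k
    using that z(2) by (cases "k = 0") (auto simp: z1_def split: if_splits)
  have "k \<in> {1..n}" if "k \<in> B_supp (z1, s1)" for k
    using that z1_pos permutes_not_in[OF s1] unfolding B_supp_def by (cases "s1 k = k") force+
  then have "(z1, s1) \<in> B_fin n" unfolding B_fin_def using c(1) by blast
  moreover have "k \<in> {n + 1..}" if "k \<in> B_supp (z2, s2)" for k
    using that permutes_not_in[OF s2] unfolding B_supp_def z2_def by (cases "s2 k = k") (force split: if_splits)+
  then have "(z2, s2) \<in> B_tail n" unfolding B_tail_def using c(2) by blast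
  moreover have "(z, s) = (z1, s1) \<otimes>\<^bsub>B_grp\<^esub> (z2, s2)"
  proof -
    have "z k = z1 k + z2 (inv_into UNIV s1 k)" for k
    proof (cases "k \<in> {1..n}")
      case True
      then have "inv_into UNIV s1 k \<in> {1..n}" using permutes_in_image[OF permutes_inv[OF s1]] by blast
      then show ?thesis using True by (simp add: z1_def z2_def)
    next
      case False
      then have "inv_into UNIV s1 k = k" by (rule permutes_not_in[OF permutes_inv[OF s1]])
      then show ?thesis by (simp add: z1_def z2_def)
    qed
    moreover have "s k = s1 (s2 k)" for k
    proof (cases "k \<ge> n + 1")
      case True
      then have "s k \<in> {n + 1..}" using im2 by blast
      then show ?thesis using True by (simp add: s1_def s2_def restrict_id_def)
    next
      case False
      then show ?thesis using permutes_not_in[OF s, of 0]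
        by (cases "k = 0") (auto simp: s1_def s2_def restrict_id_def)
    qed
    ultimately show ?thesis unfolding B_mult by (simp add: fun_eq_iff)
  qed
  ultimately show ?thesis unfolding B_inf_def set_mult_def by blast
qed

text \<open>Conjugation by \<open>(z, s)\<close> carries the sign at \<open>i\<close> to the sign at
  \<open>s i\<close>, so commuting with it forces \<open>s i = i\<close>.\<close>

lemma B_inf_contains_centralizer:
  assumes x: "x \<in> carrier B_grp"
    and comm: "\<And>i. i \<in> {1..n} \<Longrightarrow>
      x \<otimes>\<^bsub>B_grp\<^esub> (\<lambda>k. if k = i then 1 else 0, id) = (\<lambda>k. if k = i then 1 else 0, id) \<otimes>\<^bsub>B_grp\<^esub> x"
  shows "x \<in> B_inf n"
proof -
  obtain z s where e: "x = (z, s)" by fastforce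
  have s: "s permutes {1..}" using x unfolding e B_carrier_iff by auto
  have "s i = i" if i: "i \<in> {1..n}" for i
  proof -
    have eq: "z i + (if inv_into UNIV s i = i then 1 else 0) = 1 + z i"
      using arg_cong[OF comm[OF i], of "\<lambda>x. fst x i"] unfolding e B_mult by (simp only: fst_conv if_True inv_id id_apply simp_thms)
    have "inv_into UNIV s i = i"
    proof (rule ccontr)
      assume "inv_into UNIV s i \<noteq> i"
      then have "z i + 0 = z i + 1" using eq by (simp only: if_False add.commute)
      then have "(0::bit) = 1" by (rule add_left_imp_eq)
      then show False by simp
    qed
    then show ?thesis using permutes_inverses(1)[OF s, of i] by simp
  qed
  then have "s ` {1..n} = {1..n}" by auto
  then show ?thesis using B_infI x unfolding e by blast
qed

text \<open>A right coset of \<open>(z, s)\<close> determines the set of points that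
  \<open>s\<close> maps into \<open>{1..n}\<close>, since elements of the subgroup preserve
  \<open>{1..n}\<close> from the left. Transpositions of points beyond \<open>n\<close> lie in the
  subgroup, and multiplying by them from the right moves this set in infinitely many ways.\<close>

lemma B_inf_orbit_infinite:
  assumes x: "x \<in> carrier B_grp" and nx: "x \<notin> B_inf n"
  shows "infinite ((\<lambda>k. B_inf n #>\<^bsub>B_grp\<^esub> (x \<otimes>\<^bsub>B_grp\<^esub> k)) ` B_inf n)"
proof -
  obtain z s where e: "x = (z, s)" by fastforce
  have s: "s permutes {1..}" using x unfolding e B_carrier_iff by auto
  have inj: "inj s" by (rule permutes_inj[OF s])
  \<comment> \<open>Otherwise the inverse of \<open>s\<close> maps the finite set
    \<open>{1..n}\<close> injectively into itself, hence onto, and the element lies in the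
    subgroup.\<close>
  have "\<exists>j>n. s j \<in> {1..n}"
  proof (rule ccontr)
    assume no: "\<not> (\<exists>j>n. s j \<in> {1..n})"
    have "inv_into UNIV s ` {1..n} \<subseteq> {1..n}"
    proof
      fix j assume "j \<in> inv_into UNIV s ` {1..n}"
      then have sj: "s j \<in> {1..n}" using permutes_inverses(1)[OF s] by auto
      moreover have "s 0 = 0" using permutes_not_in[OF s, of 0] by simp
      ultimately have "j \<noteq> 0" by (cases "j = 0") simp_all
      then show "j \<in> {1..n}" using no sj by force
    qed
    moreover have "inj_on (inv_into UNIV s) {1..n}"
      using permutes_inj[OF permutes_inv[OF s]] by (rule inj_on_subset) simp
    ultimately have "inv_into UNIV s ` {1..n} = {1..n}" by (intro endo_inj_surj) auto
    then have "s ` inv_into UNIV s ` {1..n} = s ` {1..n}" by simp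
    then have "s ` {1..n} = {1..n}" using permutes_inverses(1)[OF s] by (simp add: image_comp)
    then show False using nx B_infI x unfolding e by blast
  qed
  then obtain j where j: "j > n" "s j \<in> {1..n}" by blast
  \<comment> \<open>The second condition removes finitely many points only, as \<open>s\<close> is
    injective.\<close>
  define S where "S = {m. m > n \<and> s m \<notin> {1..n}}"
  define \<tau> where "\<tau> m = ((\<lambda>k. 0) :: nat \<Rightarrow> bit, Transposition.transpose j m)" for m
  have "finite {m. s m \<in> {1..n}}"
    using finite_vimageI[OF _ inj, of "{1..n}"] by (simp add: vimage_def)
  moreover have "{n<..} \<subseteq> S \<union> {m. s m \<in> {1..n}}" unfolding S_def by auto
  ultimately have inf: "infinite S"
    using infinite_Ioi[of n] finite_subset finite_UnI by metis
  have \<tau>: "\<tau> m \<in> B_inf n" if m: "m \<in> S" for m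
    unfolding \<tau>_def
  proof (rule B_infI)
    have mn: "m > n" using m unfolding S_def by blast
    have "Transposition.transpose j m permutes {1..}" by (rule permutes_swap_id) (use j mn in auto)
    moreover have "finite {k. Transposition.transpose j m k \<noteq> k}"
      by (rule finite_subset[of _ "{j, m}"]) (auto simp: Transposition.transpose_def)
    ultimately show "(\<lambda>k. 0, Transposition.transpose j m) \<in> carrier B_grp" unfolding B_carrier_iff by simp
    show "Transposition.transpose j m ` {1..n} = {1..n}" using j mn by (auto simp: Transposition.transpose_def image_iff)
  qed
  have coset: "y \<in> B_inf n #>\<^bsub>B_grp\<^esub> w \<longleftrightarrow> (\<exists>h\<in>B_inf n. y = h \<otimes>\<^bsub>B_grp\<^esub> w)" for y w
    by (simp add: r_coset_def)
  have "inj_on (\<lambda>m. B_inf n #>\<^bsub>B_grp\<^esub> (x \<otimes>\<^bsub>B_grp\<^esub> \<tau> m)) S"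
  proof (rule inj_onI, rule ccontr)
    fix m m' assume m: "m \<in> S" "m' \<in> S" and ne: "m \<noteq> m'"
      and eq: "B_inf n #>\<^bsub>B_grp\<^esub> (x \<otimes>\<^bsub>B_grp\<^esub> \<tau> m) = B_inf n #>\<^bsub>B_grp\<^esub> (x \<otimes>\<^bsub>B_grp\<^esub> \<tau> m')"
    have "\<one>\<^bsub>B_grp\<^esub> \<in> B_inf n"
      unfolding B_one by (rule B_infI) (simp_all add: B_carrier_iff permutes_id)
    then have "\<one>\<^bsub>B_grp\<^esub> \<otimes>\<^bsub>B_grp\<^esub> (x \<otimes>\<^bsub>B_grp\<^esub> \<tau> m) \<in> B_inf n #>\<^bsub>B_grp\<^esub> (x \<otimes>\<^bsub>B_grp\<^esub> \<tau> m')"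
      unfolding eq[symmetric] coset by (rule rev_bexI) (rule refl)
    then obtain \<kappa> where \<kappa>: "\<kappa> \<in> B_inf n" "\<one>\<^bsub>B_grp\<^esub> \<otimes>\<^bsub>B_grp\<^esub> (x \<otimes>\<^bsub>B_grp\<^esub> \<tau> m) = \<kappa> \<otimes>\<^bsub>B_grp\<^esub> (x \<otimes>\<^bsub>B_grp\<^esub> \<tau> m')"
      unfolding coset by (rule bexE)
    obtain z1 s1 where k: "\<kappa> = (z1, s1)" by fastforce
    have "s \<circ> Transposition.transpose j m = s1 \<circ> (s \<circ> Transposition.transpose j m')"
      using \<kappa>(2) unfolding k e \<tau>_def B_one B_mult by simp
    \<comment> \<open>Evaluation at \<open>m\<close>: the left side is \<open>s j\<close>, inside
      \<open>{1..n}\<close>; the right side is \<open>s1 (s m)\<close>, which cannot lie there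
      because \<open>s m\<close> does not.\<close>
    then have "s (Transposition.transpose j m m) = s1 (s (Transposition.transpose j m' m))" by (simp only: fun_eq_iff o_apply)
    moreover have "m \<noteq> j" using m(1) j(2) unfolding S_def by auto
    ultimately have sj: "s j = s1 (s m)" using ne by (simp add: Transposition.transpose_def)
    have im: "s1 ` {1..n} = {1..n}" and k': "(z1, s1) \<in> carrier B_grp" using B_inf_imp[OF \<kappa>(1)] unfolding k by auto
    have "inj s1" using k' unfolding B_carrier_iff by (auto intro: permutes_inj)
    moreover have "s1 (s m) \<in> s1 ` {1..n}" using sj j(2) im by simp
    ultimately have "s m \<in> {1..n}" by (simp add: inj_image_mem_iff)
    then show False using m(1) unfolding S_def by blast
  qed
  then have "infinite ((\<lambda>m. B_inf n #>\<^bsub>B_grp\<^esub> (x \<otimes>\<^bsub>B_grp\<^esub> \<tau> m)) ` S)"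
    using inf by (simp only: finite_image_iff not_False_eq_True)
  moreover have "(\<lambda>m. B_inf n #>\<^bsub>B_grp\<^esub> (x \<otimes>\<^bsub>B_grp\<^esub> \<tau> m)) ` S \<subseteq>
      (\<lambda>k. B_inf n #>\<^bsub>B_grp\<^esub> (x \<otimes>\<^bsub>B_grp\<^esub> k)) ` B_inf n"
    using \<tau> by blast
  ultimately show ?thesis by (rule infinite_super[rotated])
qed

theorem theorem19:
  fixes n :: nat
    and H :: "'v::ab_group_add hspace"
    and \<pi> :: "(nat \<Rightarrow> bit) \<times> (nat \<Rightarrow> nat) \<Rightarrow> 'v \<Rightarrow> 'v"
  assumes "finite_type_factor_rep (B_grp\<lparr>carrier := B_inf n\<rparr>) H \<pi>"
  shows "stable_rep B_grp (ind_space B_grp (B_inf n) H \<pi>) (ind_rep B_grp (B_inf n) H \<pi>) \<and>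
         factor_rep B_grp (ind_space B_grp (B_inf n) H \<pi>) (ind_rep B_grp (B_inf n) H \<pi>)"
proof -
  have rep: "unitary_rep (B_grp\<lparr>carrier := B_inf n\<rparr>) H \<pi>"
    and factor: "factor H (rep_vna (B_grp\<lparr>carrier := B_inf n\<rparr>) H \<pi>)"
    and fin: "finite_vna H (rep_vna (B_grp\<lparr>carrier := B_inf n\<rparr>) H \<pi>)"
    using assms unfolding finite_type_factor_rep_def factor_rep_def by blast+
  interpret induced B_grp "B_inf n" H \<pi>
    unfolding induced_def induced_axioms_def
    by (intro conjI subsetI rep[unfolded unitary_rep_iff] group_B B_inf_imp(1))
  \<comment> \<open>For \<open>n = 0\<close> the set of signs is empty, which is consistent because
    \<open>B_inf 0\<close> is the whole group.\<close>
  let ?sign = "\<lambda>i. (\<lambda>k. if k = i then 1 else 0, id) :: (nat \<Rightarrow> bit) \<times> (nat \<Rightarrow> nat)"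
  have signs: "?sign ` {1..n} \<subseteq> carrier B_grp"
    by (auto simp: B_carrier_iff permutes_id)
  have centralizer: "I.centralizer (?sign ` {1..n}) \<subseteq> B_inf n"
    unfolding I.centralizer_def by (auto intro!: B_inf_contains_centralizer)
  have "I.almost_invariant f f" if "f \<in> carrier (ind_space B_grp (B_inf n) H \<pi>)" for f
    by (rule almost_invariant_induced[OF almost_invariant_of_finite[OF fin] _ signs centralizer that that]) auto
  then have "stable_rep B_grp (ind_space B_grp (B_inf n) H \<pi>) (ind_rep B_grp (B_inf n) H \<pi>)"
    by (rule I.stable_repI)
  moreover have "factor_rep B_grp (ind_space B_grp (B_inf n) H \<pi>) (ind_rep B_grp (B_inf n) H \<pi>)"
    by (rule factor_rep_induced[OF factor fin B_inf_orbit_infinite])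
  ultimately show ?thesis by blast
qed

end
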